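(* Let $d\ge 1$. The sequence of ideals $\{I_d(n)\}_{n\ge 0}$ of tensor identities of $d\times d$ matrices is generated, as a $T$-ideal (in the sense that includes stability under the formal partial trace $\mathtt t$), by the antisymmetrizer $\sum_{\sigma\in S_{d+1}}\epsilon_\sigma\,\sigma\in \mathbb Q[S_{d+1}]\subset \mathcal T(X,d+1)$ and by the relation $tr(1)=d$, i.e. the element $tr(1)-d\in\mathcal T(X,0)$. That is, $\{I_d(n)\}$ is the smallest $T$-ideal containing these two elements.
   Context: Work over $\mathbb Q$; $X=\{x_1,x_2,\dots\}$ is a set of variables indexed by $\mathbb N$, and $\epsilon_\sigma=\pm1$ is the sign of $\sigma$. Free algebra with trace: an algebra with trace is an associative algebra $A$ with a linear map $tr:A\to A$ such that $tr(a)b=b\,tr(a)$, $tr(ab)=tr(ba)$, $tr(tr(a)b)=tr(a)tr(b)$. $T\langle X\rangle=\mathbb Q\langle X\rangle[tr(M)]$ is the free algebra with trace: the polynomial algebra over the free associative unital algebra $\mathbb Q\langle X\rangle$ in commuting central indeterminates $tr(M)$, one for each cyclic equivalence class of monomials $M$ (including $M=1$). Its trace algebra is the polynomial ring $\mathbb Q[tr(M)]$. $T\langle X\rangle^{\otimes n}$ is the $n$-fold tensor product over $\mathbb Q[tr(M)]$ (equal to $\mathbb Q[tr(M)]$ for $n=0$). Twisted algebra: $\mathcal T(X,n):=T\langle X\rangle^{\otimes n}\ltimes\mathbb Q[S_n]$ is $T\langle X\rangle^{\otimes n}\otimes\mathbb Q[S_n]$ with commutation relations $\sigma\circ M_1\otimes\cdots\otimes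 M_n=M_{\sigma^{-1}(1)}\otimes\cdots\otimes M_{\sigma^{-1}(n)}\circ\sigma$, $\sigma\in S_n$. In particular $\mathcal T(X,0)=\mathbb Q[tr(M)]$ and $\mathcal T(X,1)=T\langle X\rangle$. Tensor identities: each assignment $X\to M_d$ of $d\times d$ matrices (over commutative $\mathbb Q$-algebras, equivalently over $\mathbb Q$) to the variables induces an evaluation homomorphism $\mathcal T(X,n)\to M_d^{\otimes n}$, where formal traces go to traces (so $tr(1)\mapsto d$) and $\sigma\in S_n$ goes to the operator $v_1\otimes\cdots\otimes v_n\mapsto v_{\sigma^{-1}(1)}\otimes\cdots\otimes v_{\sigma^{-1}(n)}$. $I_d(n)\subset\mathcal T(X,n)$ is the two-sided ideal of elements vanishing under all these evaluations. Formal partial trace: for $n\ge1$, $\mathtt t:\mathcal T(X,n)\to\mathcal T(X,n-1)$ is the $\mathbb Q[tr(M)]$-linear map which for $n=1$ is $tr:T\langle X\rangle\to\mathbb Q[tr(M)]$, and for $n\ge 2$ is given, for $\tau\in S_{n-1}$ (the permutations in $S_n$ fixing $n$), $1\le i\le n-1$ and monomials $M_j$, by $\mathtt t(\tau\circ M_1\otimes\cdots\otimes M_n)=tr(M_n)\,\tau\circ M_1\otimes\cdots\otimes M_{n-1}$ and $\mathtt t(\tau(n,i)\circ M_1\otimes\cdots\otimes M_n)=\tau\circ M_1\otimes\cdots\otimes M_nM_i\otimes\cdots\otimes M_{n-1}$ (with $M_nM_i$ in position $i$). It is the formal counterpart of the contraction $M_d^{\otimes n}\to M_d^{\otimes n-1}$,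 $X_1\otimes\cdots\otimes X_n\mapsto tr(X_n)X_1\otimes\cdots\otimes X_{n-1}$. $T$-ideals: a sequence $\{J(n)\}_{n\ge0}$ of two-sided ideals $J(n)\subset\mathcal T(X,n)$ is a $T$-ideal if: (i) for every trace-compatible algebra endomorphism $g$ of $T\langle X\rangle$ (determined by an arbitrary substitution $X\to T\langle X\rangle$), the induced endomorphism $g^{\otimes n}\ltimes 1$ of $\mathcal T(X,n)$ (identity on $S_n$) maps $J(n)$ into $J(n)$; (ii) $J(m)\otimes\mathcal T(X,n)+\mathcal T(X,m)\otimes J(n)\subset J(m+n)$ for all $m,n$, using the homomorphism $\mathcal T(X,m)\otimes\mathcal T(X,n)\to\mathcal T(X,m+n)$ coming from $S_m\times S_n\subset S_{m+n}$, $A\sigma\otimes B\tau\mapsto (A\otimes B)\sigma\tau$; (iii) $\mathtt t(J(n))\subset J(n-1)$ for all $n\ge1$. The $T$-ideal generated by a subset of $\bigcup_n\mathcal T(X,n)$ is the smallest $T$-ideal containing it. *)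

theory Defs
  imports
    "HOL-Analysis.Determinants"
    "HOL-Algebra.Ideal"
    "HOL-Combinatorics.Permutations"
    "HOL-Library.Poly_Mapping"
begin

section \<open>The free algebra with trace\<close>

text \<open>
  A monomial of the free algebra in the variables \<open>x\<^sub>0, x\<^sub>1, \<dots>\<close> is the list of the indices of
  its variables. \<open>Poly_Mapping\<close> writes the monoid underlying a monoid algebra additively, so
  concatenation of words is \<open>+\<close> and the monomial \<open>1\<close> is \<open>0 = []\<close>.
\<close>

instantiation list :: (type) monoid_add
begin
definition zero_list :: "'a list" where "zero_list = []"
definition plus_list :: "'a list \<Rightarrow> 'a list \<Rightarrow> 'a list" where "plus_list = append"
instance by standard (simp_all add: zero_list_def plus_list_def)
end

type_synonym monomial = "nat list"

definition cyc_equiv :: "monomial \<Rightarrow> monomial \<Rightarrow> bool" where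
  "cyc_equiv M N \<longleftrightarrow> (\<exists>k. N = rotate k M)"

lemma equivp_cyc_equiv: "equivp cyc_equiv"
proof (rule equivpI)
  show "reflp cyc_equiv"
    by (rule reflpI) (metis cyc_equiv_def rotate0 id_apply)
  show "symp cyc_equiv"
  proof (rule sympI)
    fix M N assume "cyc_equiv M N"
    then obtain k where k: "N = rotate k M" by (auto simp: cyc_equiv_def)
    define j where "j = length M - k mod length M"
    have "rotate j N = rotate (j + k mod length M) M"
      by (metis k rotate_conv_mod rotate_rotate)
    also have "\<dots> = M"
    proof (cases "M = []")
      case False
      then have "j + k mod length M = length M"
        by (simp add: j_def less_imp_le)
      then show ?thesis by simp
    qed simp
    finally show "cyc_equiv N M" by (metis cyc_equiv_def)
  qed
  show "transp cyc_equiv"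
    by (rule transpI) (metis cyc_equiv_def rotate_rotate)
qed

quotient_type cyclic_word = monomial / cyc_equiv
  by (rule equivp_cyc_equiv)

text \<open>
  \<open>trpoly\<close> is the polynomial ring \<open>\<rat>[tr(M)]\<close>, with one indeterminate per cyclic word, and
  \<open>tralg\<close> is the free algebra with trace: the monoid algebra of the monomials over \<open>\<rat>[tr(M)]\<close>.
\<close>

type_synonym trpoly = "(cyclic_word \<Rightarrow>\<^sub>0 nat) \<Rightarrow>\<^sub>0 rat"
type_synonym tralg = "monomial \<Rightarrow>\<^sub>0 trpoly"

definition tr_var :: "monomial \<Rightarrow> trpoly" where
  "tr_var M = Poly_Mapping.single (Poly_Mapping.single (abs_cyclic_word M) 1) 1"

definition mono :: "monomial \<Rightarrow> tralg" where
  "mono M = Poly_Mapping.single M 1"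

definition scalar :: "trpoly \<Rightarrow> tralg" where
  "scalar c = Poly_Mapping.single [] c"

definition rat_const :: "rat \<Rightarrow> trpoly" where
  "rat_const q = Poly_Mapping.single 0 q"

definition formal_tr :: "tralg \<Rightarrow> trpoly" where
  "formal_tr a = (\<Sum>M\<in>Poly_Mapping.keys a. Poly_Mapping.lookup a M * tr_var M)"

definition trace_endo :: "(tralg \<Rightarrow> tralg) \<Rightarrow> bool" where
  "trace_endo g \<longleftrightarrow>
     g 1 = 1 \<and>
     (\<forall>a b. g (a + b) = g a + g b) \<and>
     (\<forall>a b. g (a * b) = g a * g b) \<and>
     (\<forall>q a. g (scalar (rat_const q) * a) = scalar (rat_const q) * g a) \<and>
     (\<forall>a. g (scalar (formal_tr a)) = scalar (formal_tr (g a)))"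

text \<open>A trace-compatible endomorphism maps the subring \<open>\<rat>[tr(M)]\<close> to itself.\<close>

definition restrict_to_trpoly :: "(tralg \<Rightarrow> tralg) \<Rightarrow> trpoly \<Rightarrow> trpoly" where
  "restrict_to_trpoly g c = inv_into UNIV scalar (g (scalar c))"


section \<open>The twisted algebras\<close>

text \<open>
  The \<open>\<rat>[tr(M)]\<close>-module \<open>\<T>(X,n)\<close> is free on the products \<open>\<sigma> \<circ> M\<^sub>1 \<otimes> \<dots> \<otimes> M\<^sub>n\<close>, with \<open>\<sigma>\<close> in the
  symmetric group and \<open>M\<^sub>i\<close> monomials; such a product is encoded as the pair
  \<open>(\<sigma>, [M\<^sub>1, \<dots>, M\<^sub>n])\<close>. Tensor positions are numbered from \<open>0\<close>, so that the symmetric group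
  consists of the permutations of \<open>{..<n}\<close>.
\<close>

type_synonym basis_elem = "(nat \<Rightarrow> nat) \<times> monomial list"
type_synonym twisted = "basis_elem \<Rightarrow>\<^sub>0 trpoly"

definition basis :: "nat \<Rightarrow> basis_elem set" where
  "basis n = {(\<sigma>, Ms). \<sigma> permutes {..<n} \<and> length Ms = n}"

definition scale :: "trpoly \<Rightarrow> twisted \<Rightarrow> twisted" where
  "scale c F = Poly_Mapping.map ((*) c) F"

definition linear_ext :: "(basis_elem \<Rightarrow> twisted) \<Rightarrow> twisted \<Rightarrow> twisted" where
  "linear_ext h F = (\<Sum>b\<in>Poly_Mapping.keys F. scale (Poly_Mapping.lookup F b) (h b))"

definition bilinear_ext ::
    "(basis_elem \<Rightarrow> basis_elem \<Rightarrow> basis_elem) \<Rightarrow> twisted \<Rightarrow> twisted \<Rightarrow> twisted" where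
  "bilinear_ext h F G =
     (\<Sum>b\<in>Poly_Mapping.keys F. \<Sum>c\<in>Poly_Mapping.keys G.
        Poly_Mapping.single (h b c) (Poly_Mapping.lookup F b * Poly_Mapping.lookup G c))"

text \<open>
  The relation \<open>\<tau> \<circ> N\<^sub>1 \<otimes> \<dots> \<otimes> N\<^sub>n = N\<^bsub>\<tau>\<^sup>-\<^sup>1(1)\<^esub> \<otimes> \<dots> \<otimes> N\<^bsub>\<tau>\<^sup>-\<^sup>1(n)\<^esub> \<circ> \<tau>\<close>, read from right to left, gives
  \<open>M\<^sub>1 \<otimes> \<dots> \<otimes> M\<^sub>n \<circ> \<tau> = \<tau> \<circ> M\<^bsub>\<tau>(1)\<^esub> \<otimes> \<dots> \<otimes> M\<^bsub>\<tau>(n)\<^esub>\<close>.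
\<close>

fun basis_mult :: "basis_elem \<Rightarrow> basis_elem \<Rightarrow> basis_elem" where
  "basis_mult (\<sigma>, Ms) (\<tau>, Ns) = (\<sigma> \<circ> \<tau>, map (\<lambda>i. Ms ! \<tau> i @ Ns ! i) [0..<length Ns])"

definition twisted_algebra :: "nat \<Rightarrow> twisted ring" where
  "twisted_algebra n =
     \<lparr>carrier = {F. Poly_Mapping.keys F \<subseteq> basis n},
      monoid.mult = bilinear_ext basis_mult,
      one = Poly_Mapping.single (id, replicate n []) 1,
      zero = 0,
      add = (+)\<rparr>"

text \<open>The map \<open>\<T>(X,m) \<otimes> \<T>(X,n) \<rightarrow> \<T>(X,m+n)\<close>; the second permutation acts on the last positions.\<close>

fun basis_tensor :: "basis_elem \<Rightarrow> basis_elem \<Rightarrow> basis_elem" where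
  "basis_tensor (\<sigma>, Ms) (\<tau>, Ns) =
     ((\<lambda>i. if i < length Ms then \<sigma> i else length Ms + \<tau> (i - length Ms)), Ms @ Ns)"

definition outer_tensor :: "twisted \<Rightarrow> twisted \<Rightarrow> twisted" where
  "outer_tensor = bilinear_ext basis_tensor"

text \<open>
  The element \<open>\<sigma> \<circ> a\<^sub>1 \<otimes> \<dots> \<otimes> a\<^sub>n\<close> for arbitrary \<open>a\<^sub>i\<close> in the free algebra with trace, expanded
  multilinearly.
\<close>

definition pure_tensor :: "(nat \<Rightarrow> nat) \<Rightarrow> tralg list \<Rightarrow> twisted" where
  "pure_tensor \<sigma> as =
     (\<Sum>Ns\<in>listset (map Poly_Mapping.keys as).
        Poly_Mapping.single (\<sigma>, Ns) (\<Prod>i<length as. Poly_Mapping.lookup (as ! i) (Ns ! i)))"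

text \<open>The induced endomorphism \<open>g\<^sup>\<otimes>\<^sup>n \<ltimes> 1\<close>; it is only semilinear over \<open>\<rat>[tr(M)]\<close>.\<close>

definition induced_endo :: "(tralg \<Rightarrow> tralg) \<Rightarrow> twisted \<Rightarrow> twisted" where
  "induced_endo g F =
     (\<Sum>(\<sigma>, Ms)\<in>Poly_Mapping.keys F.
        scale (restrict_to_trpoly g (Poly_Mapping.lookup F (\<sigma>, Ms)))
              (pure_tensor \<sigma> (map (\<lambda>M. g (mono M)) Ms)))"

text \<open>
  Let \<open>n\<close> be the last position. If \<open>\<sigma>\<close> does not fix \<open>n\<close>, then \<open>\<sigma> = \<tau> \<circ> (n, i)\<close> with \<open>\<tau>\<close> fixing \<open>n\<close>
  exactly for \<open>i = \<sigma>\<^sup>-\<^sup>1(n)\<close> and \<open>\<tau> = \<sigma> \<circ> (n, i)\<close>.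
\<close>

fun basis_partial_trace :: "basis_elem \<Rightarrow> twisted" where
  "basis_partial_trace (\<sigma>, Ms) =
     (let n = length Ms - 1; i = inv_into UNIV \<sigma> n in
      if i = n then Poly_Mapping.single (\<sigma>, butlast Ms) (tr_var (last Ms))
      else Poly_Mapping.single (\<sigma> \<circ> Transposition.transpose n i,
                                (butlast Ms)[i := last Ms @ Ms ! i]) 1)"

definition partial_trace :: "twisted \<Rightarrow> twisted" where
  "partial_trace = linear_ext basis_partial_trace"


section \<open>T-ideals\<close>

definition T_ideal :: "(nat \<Rightarrow> twisted set) \<Rightarrow> bool" where
  "T_ideal J \<longleftrightarrow>
     (\<forall>n. ideal (J n) (twisted_algebra n)) \<and>
     (\<forall>g n. trace_endo g \<longrightarrow> induced_endo g ` J n \<subseteq> J n) \<and>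
     (\<forall>m n. \<forall>F\<in>J m. \<forall>G\<in>carrier (twisted_algebra n). outer_tensor F G \<in> J (m + n)) \<and>
     (\<forall>m n. \<forall>F\<in>carrier (twisted_algebra m). \<forall>G\<in>J n. outer_tensor F G \<in> J (m + n)) \<and>
     (\<forall>n. partial_trace ` J (Suc n) \<subseteq> J n)"

text \<open>
  A subset of the disjoint union of the \<open>\<T>(X,n)\<close> is given by pairs \<open>(n, F)\<close> with \<open>F\<close> in \<open>\<T>(X,n)\<close>.
\<close>

definition T_ideal_generated_by :: "(nat \<times> twisted) set \<Rightarrow> (nat \<Rightarrow> twisted set) \<Rightarrow> bool" where
  "T_ideal_generated_by S J \<longleftrightarrow>
     T_ideal J \<and> (\<forall>(n, F)\<in>S. F \<in> J n) \<and>
     (\<forall>J'. T_ideal J' \<and> (\<forall>(n, F)\<in>S. F \<in> J' n) \<longrightarrow> (\<forall>n. J n \<subseteq> J' n))"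

definition antisymmetrizer :: "nat \<Rightarrow> twisted" where
  "antisymmetrizer n =
     (\<Sum>\<sigma> | \<sigma> permutes {..<n}. Poly_Mapping.single (\<sigma>, replicate n []) (of_int (sign \<sigma>)))"

text \<open>The identification of \<open>\<rat>[tr(M)]\<close> with \<open>\<T>(X,0)\<close>.\<close>

definition twisted0 :: "trpoly \<Rightarrow> twisted" where
  "twisted0 c = Poly_Mapping.single (id, []) c"


section \<open>Tensor identities of matrices\<close>

definition eval_mono :: "(nat \<Rightarrow> rat^'d^'d) \<Rightarrow> monomial \<Rightarrow> rat^'d^'d" where
  "eval_mono A M = foldr (\<lambda>i B. A i ** B) M (mat 1)"

lemma eval_mono_append: "eval_mono A (M @ N) = eval_mono A M ** eval_mono A N"
  by (induction M) (simp_all add: eval_mono_def matrix_mul_assoc)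

lift_definition eval_cyclic_word :: "(nat \<Rightarrow> rat^'d^'d) \<Rightarrow> cyclic_word \<Rightarrow> rat"
  is "\<lambda>A M. trace (eval_mono A M)"
  by (metis append_take_drop_id cyc_equiv_def eval_mono_append rotate_drop_take trace_mul_sym)

definition eval_trpoly :: "(nat \<Rightarrow> rat^'d^'d) \<Rightarrow> trpoly \<Rightarrow> rat" where
  "eval_trpoly A c =
     (\<Sum>m\<in>Poly_Mapping.keys c. Poly_Mapping.lookup c m *
        (\<Prod>w\<in>Poly_Mapping.keys m. eval_cyclic_word A w ^ Poly_Mapping.lookup m w))"

text \<open>
  With \<open>V = \<rat>\<^sup>d\<close>, an element of \<open>M\<^sub>d\<^sup>\<otimes>\<^sup>n = End(V\<^sup>\<otimes>\<^sup>n)\<close> is given by its matrix in the basis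
  \<open>e\<^bsub>J ! 0\<^esub> \<otimes> \<dots> \<otimes> e\<^bsub>J ! (n - 1)\<^esub>\<close> of \<open>V\<^sup>\<otimes>\<^sup>n\<close>, where the multi-index \<open>J\<close> ranges over the lists of length \<open>n\<close>.
\<close>

type_synonym 'd tensor_op = "'d list \<Rightarrow> 'd list \<Rightarrow> rat"

definition op_mult :: "nat \<Rightarrow> 'd::finite tensor_op \<Rightarrow> 'd tensor_op \<Rightarrow> 'd tensor_op" where
  "op_mult n P Q I J = (\<Sum>K | length K = n. P I K * Q K J)"

definition op_tensor :: "(rat^'d^'d) list \<Rightarrow> 'd::finite tensor_op" where
  "op_tensor Bs I J = (\<Prod>k<length Bs. Bs ! k $ (I ! k) $ (J ! k))"

text \<open>\<open>v\<^sub>1 \<otimes> \<dots> \<otimes> v\<^sub>n \<mapsto> v\<^bsub>\<sigma>\<^sup>-\<^sup>1(1)\<^esub> \<otimes> \<dots> \<otimes> v\<^bsub>\<sigma>\<^sup>-\<^sup>1(n)\<^esub>\<close>\<close>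

definition op_perm :: "(nat \<Rightarrow> nat) \<Rightarrow> 'd tensor_op" where
  "op_perm \<sigma> I J = (if I = map (\<lambda>k. J ! inv_into UNIV \<sigma> k) [0..<length J] then 1 else 0)"

definition eval_twisted :: "nat \<Rightarrow> (nat \<Rightarrow> rat^'d^'d) \<Rightarrow> twisted \<Rightarrow> 'd::finite tensor_op" where
  "eval_twisted n A F I J =
     (\<Sum>(\<sigma>, Ms)\<in>Poly_Mapping.keys F. eval_trpoly A (Poly_Mapping.lookup F (\<sigma>, Ms)) *
        op_mult n (op_perm \<sigma>) (op_tensor (map (eval_mono A) Ms)) I J)"

definition tensor_identities :: "'d::finite itself \<Rightarrow> nat \<Rightarrow> twisted set" where
  "tensor_identities _ n =
     {F \<in> carrier (twisted_algebra n).
        \<forall>(A :: nat \<Rightarrow> rat^'d^'d) I J. length I = n \<and> length J = n \<longrightarrow> eval_twisted n A F I J = 0}"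

end

theory Submission
  imports Defs "HOL-Computational_Algebra.Polynomial" "HOL-Computational_Algebra.Primes"
begin

text \<open>
  Every element of \<open>\<T>(X,n)\<close> of multidegree \<open>x\<^bsub>l(1)\<^esub> \<dots> x\<^bsub>l(N)\<^esub>\<close> is, modulo \<open>tr(1) = d\<close>, an iterated partial
  trace \<open>t\<^sup>N(a \<circ> 1\<^sup>\<otimes>\<^sup>n \<otimes> x\<^bsub>l(1)\<^esub> \<otimes> \<dots> \<otimes> x\<^bsub>l(N)\<^esub>)\<close> with \<open>a \<in> \<rat>[S\<^bsub>n+N\<^esub>]\<close>. If it is a tensor identity, then so is
  its full polarisation, and evaluating the polarisation on matrix units shows that the symmetrised \<open>a\<close>
  acts as zero on the tensor power of \<open>V\<close>. The kernel of \<open>\<rat>[S\<^sub>m]\<close> on \<open>V\<^sup>\<otimes>\<^sup>m\<close> is the ideal generated by the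
  antisymmetriser on \<open>d + 1\<close> letters: this antisymmetriser rewrites any permutation with a decreasing
  chain of length \<open>d + 1\<close> into lexicographically smaller ones, and the permutations without such a
  chain act linearly independently. Hence \<open>a\<close>, and with it the identity, lies in every T-ideal
  containing the two generators.
\<close>

section \<open>Linear extension\<close>

text \<open>Two obstacles shape the proof. When letters repeat, neither the permutation describing a
  term nor the labelling of equal letters is canonical, and an identity controls only the sum over
  all relabellings that fix the word of letters. Therefore each occurrence gets its own letter, all
  these relabellings are carried along, and each relabelled term keeps its own permutation. Putting
  the repeated letters back makes the relabelled terms equal, so the sum is the original element
  times the number of relabellings, which is invertible over the rationals. Moreover, formal
  rewriting and numerical evaluation have to agree on the permutation and the constant they use. The
  rewriting is therefore stated for all T-ideals containing tr(1) - d at once, with permutation and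
  constant fixed beforehand: for the ideals of tensor identities it is an evaluation formula, for an
  arbitrary T-ideal a congruence. In the same way, what the lexicographic reduction subtracts lies
  in every T-ideal containing the antisymmetriser, so the remainder stays an identity.\<close>

lemma poly_mapping_sum_single:
  fixes F :: "'a \<Rightarrow>\<^sub>0 'b::comm_monoid_add"
  shows "F = (\<Sum>b\<in>Poly_Mapping.keys F. Poly_Mapping.single b (Poly_Mapping.lookup F b))"
proof (rule poly_mapping_eqI)
  fix k
  have "(\<Sum>b\<in>Poly_Mapping.keys F. Poly_Mapping.lookup (Poly_Mapping.single b (Poly_Mapping.lookup F b)) k)
      = (\<Sum>b\<in>Poly_Mapping.keys F. if b = k then Poly_Mapping.lookup F k else 0)"
    by (intro sum.cong) (auto simp: lookup_single when_def)
  then show "Poly_Mapping.lookup F k =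
      Poly_Mapping.lookup (\<Sum>b\<in>Poly_Mapping.keys F. Poly_Mapping.single b (Poly_Mapping.lookup F b)) k"
    by (auto simp: lookup_sum in_keys_iff)
qed

text \<open>The operations below are additive, so their properties are checked on single basis
  elements; the set \<open>S\<close> carries membership in \<open>basis n\<close> into that
  case.\<close>

lemma poly_mapping_single_induct [consumes 1, case_names zero single add]:
  fixes F :: "'a \<Rightarrow>\<^sub>0 'b::comm_monoid_add"
  assumes F: "Poly_Mapping.keys F \<subseteq> S"
    and zero: "P 0"
    and single: "\<And>b c. b \<in> S \<Longrightarrow> P (Poly_Mapping.single b c)"
    and add: "\<And>F G. P F \<Longrightarrow> P G \<Longrightarrow> P (F + G)"
  shows "P F"
proof -
  have "P (\<Sum>b\<in>B. Poly_Mapping.single b (Poly_Mapping.lookup F b))"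
    if "finite B" "B \<subseteq> S" for B
    using that by (induction B) (auto intro: zero single add)
  from this[OF finite_keys F] show ?thesis
    by (simp flip: poly_mapping_sum_single)
qed

lemma sum_keys_single:
  assumes "f k 0 = 0"
  shows "(\<Sum>b\<in>Poly_Mapping.keys (Poly_Mapping.single k c). f b (Poly_Mapping.lookup (Poly_Mapping.single k c) b)) = f k c"
  using assms by (cases "c = 0") auto

text \<open>Cancellation can shrink the support of \<open>F + G\<close>; since
  \<open>f k 0 = 0\<close>, all three sums may be taken over the union of the two supports.\<close>

lemma sum_keys_add:
  fixes F :: "'a \<Rightarrow>\<^sub>0 'b::comm_monoid_add"
  assumes "\<And>k. f k 0 = 0" "\<And>k a b. f k (a + b) = f k a + f k b"
  shows "(\<Sum>k\<in>Poly_Mapping.keys (F + G). f k (Poly_Mapping.lookup (F + G) k)) =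
    (\<Sum>k\<in>Poly_Mapping.keys F. f k (Poly_Mapping.lookup F k)) +
    (\<Sum>k\<in>Poly_Mapping.keys G. f k (Poly_Mapping.lookup G k))"
  using assms by (intro setsum_keys_plus_distrib)

lemma lookup_scale [simp]: "Poly_Mapping.lookup (scale c F) b = c * Poly_Mapping.lookup F b"
  by (simp add: scale_def Poly_Mapping.map.rep_eq when_def)

lemma scale_single [simp]: "scale c (Poly_Mapping.single b e) = Poly_Mapping.single b (c * e)"
  by (rule poly_mapping_eqI) (simp add: lookup_single when_def)

lemma scale_add: "scale c (F + G) = scale c F + scale c G"
  by (rule poly_mapping_eqI) (simp add: lookup_add algebra_simps)

lemma scale_add_left: "scale (c + e) F = scale c F + scale e F"
  by (rule poly_mapping_eqI) (simp add: lookup_add algebra_simps)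

lemma scale_diff: "scale c (F - G) = scale c F - scale c G"
  by (rule poly_mapping_eqI) (simp add: lookup_minus algebra_simps)

lemma scale_zero [simp]: "scale c 0 = 0" "scale 0 F = 0"
  by (rule poly_mapping_eqI; simp)+

lemma scale_one [simp]: "scale 1 F = F"
  by (rule poly_mapping_eqI) simp

lemma scale_scale [simp]: "scale c (scale e F) = scale (c * e) F"
  by (rule poly_mapping_eqI) (simp add: mult.assoc)

lemma scale_sum: "scale c (\<Sum>i\<in>I. F i) = (\<Sum>i\<in>I. scale c (F i))"
  by (induction I rule: infinite_finite_induct) (simp_all add: scale_add)

lemma keys_scale: "Poly_Mapping.keys (scale c F) \<subseteq> Poly_Mapping.keys F"
  by (auto simp: in_keys_iff)

lemma linear_ext_add: "linear_ext h (F + G) = linear_ext h F + linear_ext h G"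
  unfolding linear_ext_def by (rule sum_keys_add) (simp_all add: scale_add_left)

lemma linear_ext_single: "linear_ext h (Poly_Mapping.single b c) = scale c (h b)"
  unfolding linear_ext_def by (rule sum_keys_single) simp

lemma linear_ext_zero [simp]: "linear_ext h 0 = 0"
  by (simp add: linear_ext_def)

lemma linear_ext_scale: "linear_ext h (scale c F) = scale c (linear_ext h F)"
proof -
  have "Poly_Mapping.keys F \<subseteq> UNIV" by simp
  then show ?thesis
    by (induction rule: poly_mapping_single_induct) (simp_all add: linear_ext_single linear_ext_add scale_add)
qed

lemma linear_ext_diff: "linear_ext h (F - G) = linear_ext h F - linear_ext h G"
  by (metis add_diff_cancel diff_add_cancel linear_ext_add)

lemma bilinear_ext_add_left: "bilinear_ext h (F + F') G = bilinear_ext h F G + bilinear_ext h F' G"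
  unfolding bilinear_ext_def
  by (rule sum_keys_add[where f = "\<lambda>b x. \<Sum>c\<in>Poly_Mapping.keys G. Poly_Mapping.single (h b c) (x * Poly_Mapping.lookup G c)"])
    (simp_all add: distrib_right single_add sum.distrib)

lemma bilinear_ext_add_right: "bilinear_ext h F (G + G') = bilinear_ext h F G + bilinear_ext h F G'"
proof -
  have "(\<Sum>c\<in>Poly_Mapping.keys (G + G'). Poly_Mapping.single (h b c) (x * Poly_Mapping.lookup (G + G') c)) =
    (\<Sum>c\<in>Poly_Mapping.keys G. Poly_Mapping.single (h b c) (x * Poly_Mapping.lookup G c)) +
    (\<Sum>c\<in>Poly_Mapping.keys G'. Poly_Mapping.single (h b c) (x * Poly_Mapping.lookup G' c))" for b x
    by (rule sum_keys_add[where f = "\<lambda>c y. Poly_Mapping.single (h b c) (x * y)"])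
      (simp_all add: distrib_left single_add)
  then show ?thesis by (simp add: bilinear_ext_def sum.distrib)
qed

lemma bilinear_ext_zero [simp]: "bilinear_ext h 0 G = 0" "bilinear_ext h F 0 = 0"
  by (simp_all add: bilinear_ext_def)

lemma bilinear_ext_single [simp]:
  "bilinear_ext h (Poly_Mapping.single b x) (Poly_Mapping.single c y) = Poly_Mapping.single (h b c) (x * y)"
  by (cases "x = 0"; cases "y = 0") (simp_all add: bilinear_ext_def)

lemma bilinear_ext_sum_left:
  "bilinear_ext h (\<Sum>i\<in>I. F i) G = (\<Sum>i\<in>I. bilinear_ext h (F i) G)"
  by (induction I rule: infinite_finite_induct) (simp_all add: bilinear_ext_add_left)

lemma bilinear_ext_sum_right:
  "bilinear_ext h G (\<Sum>i\<in>I. F i) = (\<Sum>i\<in>I. bilinear_ext h G (F i))"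
  by (induction I rule: infinite_finite_induct) (simp_all add: bilinear_ext_add_right)

lemma keys_bilinear_ext:
  assumes "Poly_Mapping.keys F \<subseteq> B" "Poly_Mapping.keys G \<subseteq> C" "\<And>b c. b \<in> B \<Longrightarrow> c \<in> C \<Longrightarrow> h b c \<in> D"
  shows "Poly_Mapping.keys (bilinear_ext h F G) \<subseteq> D"
proof -
  have "Poly_Mapping.keys (bilinear_ext h F G) \<subseteq>
     (\<Union>b\<in>Poly_Mapping.keys F. \<Union>c\<in>Poly_Mapping.keys G. {h b c})"
    unfolding bilinear_ext_def
    by (intro order_trans[OF keys_sum] UN_mono order_refl) auto
  also have "\<dots> \<subseteq> D" using assms by blast
  finally show ?thesis .
qed

section \<open>The twisted algebras\<close>

lemma basis_iff: "(\<sigma>, Ms) \<in> basis n \<longleftrightarrow> \<sigma> permutes {..<n} \<and> length Ms = n"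
  by (simp add: basis_def)

lemma permutes_less: "\<sigma> permutes {..<n} \<Longrightarrow> k < n \<Longrightarrow> \<sigma> k < n"
  using permutes_in_image[of \<sigma> "{..<n}" k] by simp

lemma permutes_inv_less: "\<sigma> permutes {..<n} \<Longrightarrow> k < n \<Longrightarrow> inv_into UNIV \<sigma> k < n"
  using permutes_less[OF permutes_inv] by blast

lemma carrier_twisted: "F \<in> carrier (twisted_algebra n) \<longleftrightarrow> Poly_Mapping.keys F \<subseteq> basis n"
  by (simp add: twisted_algebra_def)

lemma single_in_carrier: "b \<in> basis n \<Longrightarrow> Poly_Mapping.single b c \<in> carrier (twisted_algebra n)"
  by (auto simp: carrier_twisted)

lemma mult_twisted: "F \<otimes>\<^bsub>twisted_algebra n\<^esub> G = bilinear_ext basis_mult F G"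
  by (simp add: twisted_algebra_def)

lemma basis_mult_closed: "b \<in> basis n \<Longrightarrow> c \<in> basis n \<Longrightarrow> basis_mult b c \<in> basis n"
  by (cases b; cases c) (auto simp: basis_iff permutes_compose)

lemma basis_mult_assoc:
  assumes "b \<in> basis n" "c \<in> basis n" "e \<in> basis n"
  shows "basis_mult (basis_mult b c) e = basis_mult b (basis_mult c e)"
proof -
  obtain \<sigma> Ms \<tau> Ns \<rho> Ps where [simp]: "b = (\<sigma>, Ms)" "c = (\<tau>, Ns)" "e = (\<rho>, Ps)"
    by (metis surj_pair)
  show ?thesis using assms
    by (auto simp: basis_iff permutes_less comp_assoc)
qed

text \<open>The unit carries a coefficient \<open>c\<close> so that scaling becomes multiplication
  by an element of the algebra; this makes every two-sided ideal a module over the trace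
  ring.\<close>

lemma mult_one_left: "F \<in> carrier (twisted_algebra n) \<Longrightarrow>
    bilinear_ext basis_mult (Poly_Mapping.single (id, replicate n []) c) F = scale c F"
  unfolding carrier_twisted
proof (induction rule: poly_mapping_single_induct)
  case (single b c)
  then show ?case by (cases b) (auto simp: basis_iff permutes_less intro!: arg_cong2[where f = Poly_Mapping.single] nth_equalityI)
qed (simp_all add: bilinear_ext_add_right scale_add)

lemma mult_one_right: "F \<in> carrier (twisted_algebra n) \<Longrightarrow>
    bilinear_ext basis_mult F (Poly_Mapping.single (id, replicate n []) c) = scale c F"
  unfolding carrier_twisted
proof (induction rule: poly_mapping_single_induct)
  case (single b c)
  then show ?case by (cases b) (auto simp: basis_iff permutes_less mult.commute intro!: arg_cong2[where f = Poly_Mapping.single] nth_equalityI)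
qed (simp_all add: bilinear_ext_add_left scale_add)

lemma mult_closed:
  "F \<in> carrier (twisted_algebra n) \<Longrightarrow> G \<in> carrier (twisted_algebra n) \<Longrightarrow>
    bilinear_ext basis_mult F G \<in> carrier (twisted_algebra n)"
  unfolding carrier_twisted by (erule (1) keys_bilinear_ext) (rule basis_mult_closed)

lemma mult_twisted_assoc:
  assumes "F \<in> carrier (twisted_algebra n)" "G \<in> carrier (twisted_algebra n)" "H \<in> carrier (twisted_algebra n)"
  shows "bilinear_ext basis_mult (bilinear_ext basis_mult F G) H =
    bilinear_ext basis_mult F (bilinear_ext basis_mult G H)"
  using assms(1) unfolding carrier_twisted
proof (induction rule: poly_mapping_single_induct)
  case (single b x)
  note b = this
  show ?case
    using assms(2) unfolding carrier_twisted
  proof (induction rule: poly_mapping_single_induct)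
    case (single c y)
    note c = this
    show ?case
      using assms(3) unfolding carrier_twisted
    proof (induction rule: poly_mapping_single_induct)
      case (single e z)
      then show ?case using b c by (simp add: basis_mult_assoc mult.assoc)
    qed (simp_all add: bilinear_ext_add_right)
  qed (simp_all add: bilinear_ext_add_right bilinear_ext_add_left)
qed (simp_all add: bilinear_ext_add_left)

lemma keys_add_subset: "Poly_Mapping.keys F \<subseteq> S \<Longrightarrow> Poly_Mapping.keys G \<subseteq> S \<Longrightarrow> Poly_Mapping.keys (F + G) \<subseteq> S"
  using keys_add[of F G] by blast

lemma ring_twisted_algebra: "ring (twisted_algebra n)"
proof (rule ringI)
  show "abelian_group (twisted_algebra n)"
  proof (rule abelian_groupI)
    fix F assume "F \<in> carrier (twisted_algebra n)"
    then show "\<exists>G\<in>carrier (twisted_algebra n). G \<oplus>\<^bsub>twisted_algebra n\<^esub> F = \<zero>\<^bsub>twisted_algebra n\<^esub>"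
      by (intro bexI[of _ "- F"]) (auto simp: twisted_algebra_def in_keys_iff)
  qed (auto simp: twisted_algebra_def add_ac dest: keys_add_subset intro: keys_add_subset[THEN subsetD])
  show "Group.monoid (twisted_algebra n)"
  proof (rule monoidI)
    have [simp]: "\<one>\<^bsub>twisted_algebra n\<^esub> = Poly_Mapping.single (id, replicate n []) 1"
      by (simp add: twisted_algebra_def)
    show "\<one>\<^bsub>twisted_algebra n\<^esub> \<in> carrier (twisted_algebra n)"
      by (auto intro!: single_in_carrier simp: basis_iff permutes_id)
    fix F G H assume F: "F \<in> carrier (twisted_algebra n)"
    then show "\<one>\<^bsub>twisted_algebra n\<^esub> \<otimes>\<^bsub>twisted_algebra n\<^esub> F = F" "F \<otimes>\<^bsub>twisted_algebra n\<^esub> \<one>\<^bsub>twisted_algebra n\<^esub> = F"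
      by (simp_all add: mult_twisted mult_one_left mult_one_right)
    assume "G \<in> carrier (twisted_algebra n)"
    with F show "F \<otimes>\<^bsub>twisted_algebra n\<^esub> G \<in> carrier (twisted_algebra n)"
      by (simp add: mult_twisted mult_closed)
    assume "H \<in> carrier (twisted_algebra n)"
    with \<open>G \<in> _\<close> F show "F \<otimes>\<^bsub>twisted_algebra n\<^esub> G \<otimes>\<^bsub>twisted_algebra n\<^esub> H =
       F \<otimes>\<^bsub>twisted_algebra n\<^esub> (G \<otimes>\<^bsub>twisted_algebra n\<^esub> H)"
      by (simp add: mult_twisted mult_twisted_assoc)
  qed
qed (simp_all add: twisted_algebra_def bilinear_ext_add_left bilinear_ext_add_right)

section \<open>Evaluation on matrices\<close>

definition eval_pmon :: "(nat \<Rightarrow> rat^'d^'d) \<Rightarrow> (cyclic_word \<Rightarrow>\<^sub>0 nat) \<Rightarrow> rat" where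
  "eval_pmon A m = (\<Prod>w\<in>Poly_Mapping.keys m. eval_cyclic_word A w ^ Poly_Mapping.lookup m w)"

lemma eval_pmon_superset:
  "finite S \<Longrightarrow> Poly_Mapping.keys m \<subseteq> S \<Longrightarrow>
    eval_pmon A m = (\<Prod>w\<in>S. eval_cyclic_word A w ^ Poly_Mapping.lookup m w)"
  unfolding eval_pmon_def by (rule prod.mono_neutral_left) (auto simp: in_keys_iff)

lemma eval_pmon_add: "eval_pmon A (m + m') = eval_pmon A m * eval_pmon A m'"
proof -
  let ?S = "Poly_Mapping.keys m \<union> Poly_Mapping.keys m'"
  have "eval_pmon A (m + m') = (\<Prod>w\<in>?S. eval_cyclic_word A w ^ Poly_Mapping.lookup (m + m') w)"
    by (rule eval_pmon_superset) (use keys_add[of m m'] in auto)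
  then show ?thesis
    by (simp add: lookup_add power_add prod.distrib eval_pmon_superset[of ?S])
qed

lemma eval_trpoly_single: "eval_trpoly A (Poly_Mapping.single m q) = q * eval_pmon A m"
  unfolding eval_trpoly_def eval_pmon_def by (rule sum_keys_single) simp

lemma eval_trpoly_add: "eval_trpoly A (c + e) = eval_trpoly A c + eval_trpoly A e"
  unfolding eval_trpoly_def by (rule sum_keys_add) (simp_all add: distrib_right)

lemma eval_trpoly_zero [simp]: "eval_trpoly A 0 = 0"
  by (simp add: eval_trpoly_def)

lemma eval_trpoly_mult: "eval_trpoly A (c * e) = eval_trpoly A c * eval_trpoly A e"
proof -
  have "Poly_Mapping.keys c \<subseteq> UNIV" by simp
  then show ?thesis
  proof (induction rule: poly_mapping_single_induct)
    case (single m q)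
    have "Poly_Mapping.keys e \<subseteq> UNIV" by simp
    then show ?case
      by (induction rule: poly_mapping_single_induct)
        (simp_all add: mult_single eval_trpoly_single eval_pmon_add distrib_left eval_trpoly_add)
  qed (simp_all add: distrib_right eval_trpoly_add)
qed

lemma eval_trpoly_rat_const [simp]: "eval_trpoly A (rat_const q) = q"
  by (simp add: rat_const_def eval_trpoly_single eval_pmon_def)

lemma rat_const_hom:
  "rat_const 0 = 0" "rat_const 1 = 1"
  "rat_const (p + q) = rat_const p + rat_const q" "rat_const (p * q) = rat_const p * rat_const q"
  "rat_const (- q) = - rat_const q"
  by (simp_all add: rat_const_def single_add mult_single single_uminus)

lemma eval_trpoly_one [simp]: "eval_trpoly A 1 = 1"
  using eval_trpoly_rat_const[of A 1] by (simp add: rat_const_hom)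

lemma rat_const_of_int: "rat_const (of_int k) = of_int k"
  by (simp add: rat_const_def)

lemma rat_const_of_nat: "rat_const (of_nat k) = of_nat k"
  by (simp add: rat_const_def)

lemma eval_trpoly_of_int [simp]: "eval_trpoly A (of_int k) = of_int k"
  using eval_trpoly_rat_const[of A "of_int k"] by (simp add: rat_const_of_int)

lemma eval_trpoly_of_nat [simp]: "eval_trpoly A (of_nat k) = of_nat k"
  using eval_trpoly_rat_const[of A "of_nat k"] by (simp add: rat_const_of_nat)

lemma eval_trpoly_tr_var [simp]: "eval_trpoly A (tr_var M) = trace (eval_mono A M)"
  by (simp add: tr_var_def eval_trpoly_single eval_pmon_def eval_cyclic_word.abs_eq)

lemma eval_trpoly_sum: "eval_trpoly A (\<Sum>i\<in>S. c i) = (\<Sum>i\<in>S. eval_trpoly A (c i))"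
  by (induction S rule: infinite_finite_induct) (simp_all add: eval_trpoly_add)

lemma eval_trpoly_prod: "eval_trpoly A (\<Prod>i\<in>S. c i) = (\<Prod>i\<in>S. eval_trpoly A (c i))"
  by (induction S rule: infinite_finite_induct) (simp_all add: eval_trpoly_mult)

lemma eval_trpoly_prod_list: "eval_trpoly A (prod_list cs) = prod_list (map (eval_trpoly A) cs)"
  by (induction cs) (simp_all add: eval_trpoly_mult)

text \<open>A permutation matrix has one nonzero entry in each row, so the sum over intermediate
  multi-indices in \<open>op_mult\<close> collapses. What remains is this product: factor
  \<open>k\<close> is read in row \<open>I ! \<sigma> k\<close> and column
  \<open>J ! k\<close>.\<close>

definition eval_basis :: "nat \<Rightarrow> (nat \<Rightarrow> rat^'d^'d) \<Rightarrow> basis_elem \<Rightarrow> 'd list \<Rightarrow> 'd list \<Rightarrow> rat" where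
  "eval_basis n A b I J = (\<Prod>k<n. eval_mono A (snd b ! k) $ (I ! fst b k) $ (J ! k))"

lemma op_mult_perm_tensor:
  fixes A :: "nat \<Rightarrow> rat^'d^'d::finite"
  assumes "(\<sigma>, Ms) \<in> basis n" "length I = n"
  shows "op_mult n (op_perm \<sigma>) (op_tensor (map (eval_mono A) Ms)) I J = eval_basis n A (\<sigma>, Ms) I J"
proof -
  from assms have \<sigma>: "\<sigma> permutes {..<n}" and [simp]: "length Ms = n" by (auto simp: basis_iff)
  let ?K = "map (\<lambda>k. I ! \<sigma> k) [0..<n]"
  have "I = map (\<lambda>k. K ! inv_into UNIV \<sigma> k) [0..<n] \<longleftrightarrow> K = ?K" if "length K = n" for K
  proof
    assume "I = map (\<lambda>k. K ! inv_into UNIV \<sigma> k) [0..<n]"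
    then have "I ! \<sigma> k = K ! k" if "k < n" for k
      using that permutes_less[OF \<sigma> that] by (simp add: permutes_inverses[OF \<sigma>])
    with that show "K = ?K" by (auto intro: nth_equalityI)
  next
    assume "K = ?K"
    then have "K ! inv_into UNIV \<sigma> k = I ! k" if "k < n" for k
      using permutes_inv_less[OF \<sigma> that] by (simp add: permutes_inverses[OF \<sigma>])
    with assms show "I = map (\<lambda>k. K ! inv_into UNIV \<sigma> k) [0..<n]" by (auto intro: nth_equalityI)
  qed
  then have "op_mult n (op_perm \<sigma>) (op_tensor (map (eval_mono A) Ms)) I J =
      (\<Sum>K | length K = n. if K = ?K then op_tensor (map (eval_mono A) Ms) K J else 0)"
    unfolding op_mult_def op_perm_def by (intro sum.cong) auto
  also have "\<dots> = op_tensor (map (eval_mono A) Ms) ?K J"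
    using finite_lists_length_eq[of "UNIV :: 'd set" n] by simp
  also have "\<dots> = eval_basis n A (\<sigma>, Ms) I J"
    by (simp add: op_tensor_def eval_basis_def)
  finally show ?thesis .
qed

lemma eval_twisted_eq:
  fixes A :: "nat \<Rightarrow> rat^'d^'d::finite"
  assumes "F \<in> carrier (twisted_algebra n)" "length I = n"
  shows "eval_twisted n A F I J =
    (\<Sum>b\<in>Poly_Mapping.keys F. eval_trpoly A (Poly_Mapping.lookup F b) * eval_basis n A b I J)"
  unfolding eval_twisted_def
proof (rule sum.cong[OF refl])
  fix b assume "b \<in> Poly_Mapping.keys F"
  with assms have "b \<in> basis n" by (auto simp: carrier_twisted)
  with assms(2) show "(case b of (\<sigma>, Ms) \<Rightarrow> eval_trpoly A (Poly_Mapping.lookup F (\<sigma>, Ms)) *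
      op_mult n (op_perm \<sigma>) (op_tensor (map (eval_mono A) Ms)) I J) =
    eval_trpoly A (Poly_Mapping.lookup F b) * eval_basis n A b I J"
    by (cases b) (simp add: op_mult_perm_tensor)
qed

lemma eval_twisted_add: "eval_twisted n A (F + G) I J = eval_twisted n A F I J + eval_twisted n A G I J"
  unfolding eval_twisted_def split_def prod.collapse
  by (rule sum_keys_add[where f = "\<lambda>b c. eval_trpoly A c *
      op_mult n (op_perm (fst b)) (op_tensor (map (eval_mono A) (snd b))) I J"])
    (simp_all add: eval_trpoly_add distrib_right)

lemma eval_twisted_zero [simp]: "eval_twisted n A 0 I J = 0"
  by (simp add: eval_twisted_def)

lemma eval_twisted_sum: "eval_twisted n A (\<Sum>i\<in>S. F i) I J = (\<Sum>i\<in>S. eval_twisted n A (F i) I J)"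
  by (induction S rule: infinite_finite_induct) (simp_all add: eval_twisted_add)

lemma eval_twisted_single:
  assumes "b \<in> basis n" "length I = n"
  shows "eval_twisted n A (Poly_Mapping.single b c) I J = eval_trpoly A c * eval_basis n A b I J"
  by (cases "c = 0") (simp_all add: eval_twisted_eq single_in_carrier assms)

lemma eval_twisted_scale:
  assumes "F \<in> carrier (twisted_algebra n)" "length I = n"
  shows "eval_twisted n A (scale c F) I J = eval_trpoly A c * eval_twisted n A F I J"
  using assms(1) unfolding carrier_twisted
  by (induction rule: poly_mapping_single_induct)
    (simp_all add: eval_twisted_single assms(2) eval_trpoly_mult mult.assoc scale_add eval_twisted_add distrib_left)

text \<open>Distributivity with the choices recorded as a list instead of a function, the form that
  both pure tensors and sums over multi-indices require.\<close>

lemma prod_sum_listset: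
  fixes f :: "nat \<Rightarrow> 'a \<Rightarrow> 'b::comm_semiring_1"
  assumes "\<And>S. S \<in> set Ss \<Longrightarrow> finite S"
  shows "finite (listset Ss) \<and>
    (\<Prod>k<length Ss. \<Sum>p\<in>Ss ! k. f k p) = (\<Sum>Ns\<in>listset Ss. \<Prod>k<length Ss. f k (Ns ! k))"
  using assms
proof (induction Ss arbitrary: f)
  case (Cons S Ss)
  have fin: "finite (listset Ss)" and
    IH: "(\<Prod>k<length Ss. \<Sum>p\<in>Ss ! k. f (Suc k) p) = (\<Sum>Ns\<in>listset Ss. \<Prod>k<length Ss. f (Suc k) (Ns ! k))"
    using Cons.IH[of "\<lambda>k. f (Suc k)"] Cons.prems by auto
  have S: "listset (S # Ss) = (\<lambda>(x, xs). x # xs) ` (S \<times> listset Ss)"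
    by (auto simp: set_Cons_def)
  have inj: "inj_on (\<lambda>(x, xs). x # xs) (S \<times> listset Ss)"
    by (auto simp: inj_on_def)
  have "(\<Prod>k<length (S # Ss). \<Sum>p\<in>(S # Ss) ! k. f k p) =
      (\<Sum>p\<in>S. f 0 p) * (\<Sum>Ns\<in>listset Ss. \<Prod>k<length Ss. f (Suc k) (Ns ! k))"
    by (simp add: prod.lessThan_Suc_shift IH del: prod.lessThan_Suc)
  also have "\<dots> = (\<Sum>(p, Ns)\<in>S \<times> listset Ss. f 0 p * (\<Prod>k<length Ss. f (Suc k) (Ns ! k)))"
    by (simp add: sum_product sum.cartesian_product)
  also have "\<dots> = (\<Sum>Ns\<in>listset (S # Ss). \<Prod>k<length (S # Ss). f k (Ns ! k))"
    unfolding S by (subst sum.reindex[OF inj])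
      (auto simp: prod.lessThan_Suc_shift split_def simp del: prod.lessThan_Suc intro!: sum.cong)
  finally show ?case unfolding S using fin Cons.prems by simp
qed simp

lemma listset_replicate_UNIV: "listset (replicate n UNIV) = {K. length K = n}"
proof (induction n)
  case (Suc n)
  then show ?case by (auto simp: set_Cons_def length_Suc_conv)
qed auto

lemma prod_sum_lists:
  fixes f :: "nat \<Rightarrow> 'd::finite \<Rightarrow> 'b::comm_semiring_1"
  shows "(\<Sum>K | length K = n. \<Prod>k<n. f k (K ! k)) = (\<Prod>k<n. \<Sum>p\<in>UNIV. f k p)"
  using prod_sum_listset[of "replicate n (UNIV :: 'd set)" f]
  by (simp add: listset_replicate_UNIV)

text \<open>The column \<open>K ! \<tau> k\<close> of the first element at position
  \<open>\<tau> k\<close> meets the same row index of the second element at position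
  \<open>k\<close>. Each entry of \<open>K\<close> occurs in one such pair, so the sum over
  \<open>K\<close> splits into matrix products.\<close>

lemma eval_basis_mult:
  fixes A :: "nat \<Rightarrow> rat^'d^'d::finite"
  assumes "b \<in> basis n" "c \<in> basis n"
  shows "(\<Sum>K | length K = n. eval_basis n A b I K * eval_basis n A c K J) = eval_basis n A (basis_mult b c) I J"
proof -
  obtain \<sigma> Ms \<tau> Ns where [simp]: "b = (\<sigma>, Ms)" "c = (\<tau>, Ns)" by (metis surj_pair)
  from assms have \<sigma>: "\<sigma> permutes {..<n}" and \<tau>: "\<tau> permutes {..<n}"
    and len: "length Ms = n" "length Ns = n" by (auto simp: basis_iff)
  define g where "g k p = eval_mono A (Ms ! \<tau> k) $ (I ! \<sigma> (\<tau> k)) $ p * eval_mono A (Ns ! k) $ p $ (J ! k)" for k p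
  have "eval_basis n A b I K * eval_basis n A c K J = (\<Prod>k<n. g (inv_into UNIV \<tau> k) (K ! k))" for K
  proof -
    have "eval_basis n A b I K = (\<Prod>k<n. eval_mono A (Ms ! \<tau> k) $ (I ! \<sigma> (\<tau> k)) $ (K ! \<tau> k))"
      unfolding eval_basis_def by (subst prod.permute[OF \<tau>]) simp
    then have "eval_basis n A b I K * eval_basis n A c K J = (\<Prod>k<n. g k (K ! \<tau> k))"
      by (simp add: eval_basis_def g_def flip: prod.distrib)
    \<comment> \<open>Reindexing by the inverse of \<open>\<tau>\<close> puts the entry
      \<open>K ! k\<close> into factor \<open>k\<close>, as the expansion of a product over lists
      demands.\<close>
    also have "\<dots> = (\<Prod>k<n. g (inv_into UNIV \<tau> k) (K ! k))"
      by (subst prod.permute[OF permutes_inv[OF \<tau>]]) (simp add: permutes_inverses[OF \<tau>])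
    finally show ?thesis .
  qed
  then have "(\<Sum>K | length K = n. eval_basis n A b I K * eval_basis n A c K J) =
      (\<Sum>K | length K = n. \<Prod>k<n. g (inv_into UNIV \<tau> k) (K ! k))" by simp
  also have "\<dots> = (\<Prod>k<n. \<Sum>p\<in>UNIV. g (inv_into UNIV \<tau> k) p)" by (rule prod_sum_lists)
  also have "\<dots> = (\<Prod>k<n. \<Sum>p\<in>UNIV. g k p)"
    by (subst (2) prod.permute[OF permutes_inv[OF \<tau>]]) simp
  also have "\<dots> = eval_basis n A (basis_mult b c) I J"
    by (simp add: eval_basis_def len g_def eval_mono_append matrix_matrix_mult_def)
  finally show ?thesis .
qed

lemma eval_twisted_mult:
  fixes A :: "nat \<Rightarrow> rat^'d^'d::finite"
  assumes "F \<in> carrier (twisted_algebra n)" "G \<in> carrier (twisted_algebra n)" "length I = n"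
  shows "eval_twisted n A (bilinear_ext basis_mult F G) I J =
    (\<Sum>K | length K = n. eval_twisted n A F I K * eval_twisted n A G K J)"
  using assms(1) unfolding carrier_twisted
proof (induction rule: poly_mapping_single_induct)
  case (single b x)
  note b = this
  show ?case
    using assms(2) unfolding carrier_twisted
  proof (induction rule: poly_mapping_single_induct)
    case (single c y)
    have "eval_twisted n A (bilinear_ext basis_mult (Poly_Mapping.single b x) (Poly_Mapping.single c y)) I J =
        eval_trpoly A x * eval_trpoly A y * (\<Sum>K | length K = n. eval_basis n A b I K * eval_basis n A c K J)"
      using b single assms(3)
      by (simp add: eval_twisted_single basis_mult_closed eval_trpoly_mult eval_basis_mult)
    also have "\<dots> = (\<Sum>K | length K = n. eval_twisted n A (Poly_Mapping.single b x) I K *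
        eval_twisted n A (Poly_Mapping.single c y) K J)"
      using b single assms(3)
      by (auto simp: eval_twisted_single sum_distrib_left intro!: sum.cong)
    finally show ?case .
  qed (simp_all add: bilinear_ext_add_right eval_twisted_add distrib_left sum.distrib)
qed (simp_all add: bilinear_ext_add_left eval_twisted_add distrib_right sum.distrib)

section \<open>The partial trace as contraction of the last tensor index\<close>

lemma permutes_shrink: "\<sigma> permutes {..<Suc n} \<Longrightarrow> \<sigma> n = n \<Longrightarrow> \<sigma> permutes {..<n}"
  by (erule permutes_superset) (auto simp: less_Suc_eq)

lemma basis_partial_trace_fixed:
  assumes "\<sigma> permutes {..<n}" "length Ms = n"
  shows "basis_partial_trace (\<sigma>, Ms @ [M]) = Poly_Mapping.single (\<sigma>, Ms) (tr_var M)"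
proof -
  have "\<sigma> n = n" using assms(1) by (simp add: permutes_def)
  then have "inv_into UNIV \<sigma> n = n" by (metis permutes_inverses(2)[OF assms(1)])
  then show ?thesis by (simp add: assms)
qed

lemma basis_partial_trace_moved:
  assumes "\<sigma> permutes {..<Suc n}" "length Ms = n" "i < n" "\<sigma> i = n"
  shows "basis_partial_trace (\<sigma>, Ms @ [M]) =
    Poly_Mapping.single (\<sigma> \<circ> Transposition.transpose n i, Ms[i := M @ Ms ! i]) 1"
proof -
  have "inv_into UNIV \<sigma> n = i" by (metis assms(1,4) permutes_inverses(2))
  then show ?thesis using assms by (simp add: nth_append)
qed

text \<open>The two cases match the clauses of the partial trace. In the second, \<open>i\<close> is
  the preimage of the last position \<open>n\<close>, so composing with the transposition of
  \<open>n\<close> and \<open>i\<close> fixes \<open>n\<close> and leaves a permutation of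
  \<open>n\<close> positions.\<close>

lemma basis_Suc_cases:
  assumes "b \<in> basis (Suc n)"
  obtains (fixed) \<sigma> Ms M where "b = (\<sigma>, Ms @ [M])" "\<sigma> permutes {..<n}" "length Ms = n"
    | (moved) \<sigma> Ms M i where "b = (\<sigma>, Ms @ [M])" "\<sigma> permutes {..<Suc n}" "length Ms = n" "i < n" "\<sigma> i = n"
        "\<sigma> n < n" "\<sigma> \<circ> Transposition.transpose n i permutes {..<n}"
proof -
  obtain \<sigma> Ns where b: "b = (\<sigma>, Ns)" "\<sigma> permutes {..<Suc n}" "length Ns = Suc n"
    using assms by (cases b) (auto simp: basis_iff)
  from b(3) obtain Ms M where Ns: "Ns = Ms @ [M]" "length Ms = n"
    by (metis length_Suc_conv_rev)
  show thesis
  proof (cases "\<sigma> n = n")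
    case True
    with b Ns show ?thesis by (intro fixed) (auto intro: permutes_shrink)
  next
    case False
    define i where "i = inv_into UNIV \<sigma> n"
    have i: "\<sigma> i = n" by (simp add: i_def permutes_inverses[OF b(2)])
    have "i < Suc n" unfolding i_def by (rule permutes_inv_less[OF b(2)]) simp
    with i False have "i < n" by (metis less_SucE)
    moreover have "\<sigma> n < n" using permutes_less[OF b(2), of n] False by simp
    moreover have "\<sigma> \<circ> Transposition.transpose n i permutes {..<n}"
    proof (rule permutes_shrink)
      show "\<sigma> \<circ> Transposition.transpose n i permutes {..<Suc n}"
        using \<open>i < n\<close> by (intro permutes_compose permutes_swap_id b(2)) auto
    qed (simp add: i)
    ultimately show ?thesis using b Ns i by (intro moved) auto
  qed
qed

lemma basis_partial_trace_closed:
  "b \<in> basis (Suc n) \<Longrightarrow> basis_partial_trace b \<in> carrier (twisted_algebra n)"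
  by (erule basis_Suc_cases)
    (auto simp: basis_partial_trace_fixed basis_partial_trace_moved basis_iff simp del: basis_partial_trace.simps intro!: single_in_carrier)

lemma keys_linear_ext:
  assumes "Poly_Mapping.keys F \<subseteq> B" "\<And>b. b \<in> B \<Longrightarrow> Poly_Mapping.keys (h b) \<subseteq> D"
  shows "Poly_Mapping.keys (linear_ext h F) \<subseteq> D"
proof -
  have "Poly_Mapping.keys (linear_ext h F) \<subseteq> (\<Union>b\<in>Poly_Mapping.keys F. Poly_Mapping.keys (h b))"
    unfolding linear_ext_def by (intro order_trans[OF keys_sum] UN_mono order_refl keys_scale)
  with assms show ?thesis by blast
qed

lemma partial_trace_closed:
  "F \<in> carrier (twisted_algebra (Suc n)) \<Longrightarrow> partial_trace F \<in> carrier (twisted_algebra n)"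
  unfolding carrier_twisted partial_trace_def
  by (erule keys_linear_ext) (use basis_partial_trace_closed in \<open>auto simp: carrier_twisted\<close>)

text \<open>If \<open>\<sigma>\<close> fixes \<open>n\<close>, the index \<open>p\<close> occurs
  only in the last factor and yields its trace. Otherwise \<open>p\<close> is the column of the last
  factor and the row of factor \<open>i\<close>, and the sum over \<open>p\<close> is the matrix
  product of the last word with the word at \<open>i\<close>, in this order.\<close>

lemma eval_basis_partial_trace:
  fixes A :: "nat \<Rightarrow> rat^'d^'d::finite"
  assumes "b \<in> basis (Suc n)" "length I = n" "length J = n"
  shows "eval_twisted n A (basis_partial_trace b) I J = (\<Sum>p\<in>UNIV. eval_basis (Suc n) A b (I @ [p]) (J @ [p]))"
  using assms(1)
proof (cases rule: basis_Suc_cases)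
  case (fixed \<sigma> Ms M)
  have "\<sigma> n = n" using fixed(2) by (simp add: permutes_def)
  moreover have "(\<Prod>k<n. eval_mono A ((Ms @ [M]) ! k) $ ((I @ [p]) ! \<sigma> k) $ ((J @ [p]) ! k)) =
      eval_basis n A (\<sigma>, Ms) I J" for p
    unfolding eval_basis_def using fixed assms by (intro prod.cong) (auto simp: nth_append permutes_less)
  ultimately have "eval_basis (Suc n) A b (I @ [p]) (J @ [p]) = eval_basis n A (\<sigma>, Ms) I J * eval_mono A M $ p $ p" for p
    using fixed assms by (simp add: eval_basis_def[of "Suc n"] nth_append)
  then show ?thesis using fixed assms
    by (simp add: basis_partial_trace_fixed eval_twisted_single basis_iff trace_def sum_distrib_left
        mult.commute del: basis_partial_trace.simps)
next
  case (moved \<sigma> Ms M i)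
  let ?S = "{..<n} - {i}"
  have *: "\<sigma> k < n" if "k \<in> ?S" for k
  proof -
    have "\<sigma> k < Suc n" using that moved(2) by (auto intro: permutes_less)
    moreover have "\<sigma> k \<noteq> n" using that moved by (metis DiffE insertI1 permutes_inverses(2))
    ultimately show ?thesis by simp
  qed
  \<comment> \<open>The factors not involving \<open>p\<close>.\<close>
  define R where "R = (\<Prod>k\<in>?S. eval_mono A (Ms ! k) $ (I ! \<sigma> k) $ (J ! k))"
  have "(\<Prod>k<n. eval_mono A ((Ms @ [M]) ! k) $ ((I @ [p]) ! \<sigma> k) $ ((J @ [p]) ! k)) =
     R * eval_mono A (Ms ! i) $ p $ (J ! i)" for p
  proof -
    have "(\<Prod>k\<in>?S. eval_mono A ((Ms @ [M]) ! k) $ ((I @ [p]) ! \<sigma> k) $ ((J @ [p]) ! k)) = R"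
      unfolding R_def using moved assms * by (intro prod.cong) (auto simp: nth_append)
    then show ?thesis using moved assms
      by (subst prod.remove[of _ i]) (auto simp: nth_append)
  qed
  then have 1: "eval_basis (Suc n) A b (I @ [p]) (J @ [p]) =
      R * (eval_mono A M $ (I ! \<sigma> n) $ p * eval_mono A (Ms ! i) $ p $ (J ! i))" for p
    using moved assms by (simp add: eval_basis_def nth_append mult_ac)
  have "(\<Prod>k\<in>?S. eval_mono A (Ms[i := M @ Ms ! i] ! k) $ (I ! (\<sigma> \<circ> Transposition.transpose n i) k) $ (J ! k)) = R"
    unfolding R_def by (intro prod.cong) (auto simp: transpose_def)
  then have "eval_basis n A (\<sigma> \<circ> Transposition.transpose n i, Ms[i := M @ Ms ! i]) I J =
      R * (\<Sum>p\<in>UNIV. eval_mono A M $ (I ! \<sigma> n) $ p * eval_mono A (Ms ! i) $ p $ (J ! i))"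
    using moved assms unfolding eval_basis_def
    by (subst prod.remove[of _ i]) (auto simp: eval_mono_append matrix_matrix_mult_def mult.commute)
  with moved assms 1 show ?thesis
    by (simp add: basis_partial_trace_moved eval_twisted_single basis_iff sum_distrib_left
        del: basis_partial_trace.simps)
qed

lemma eval_partial_trace:
  fixes A :: "nat \<Rightarrow> rat^'d^'d::finite"
  assumes "F \<in> carrier (twisted_algebra (Suc n))" "length I = n" "length J = n"
  shows "eval_twisted n A (partial_trace F) I J = (\<Sum>p\<in>UNIV. eval_twisted (Suc n) A F (I @ [p]) (J @ [p]))"
  using assms(1) unfolding carrier_twisted
proof (induction rule: poly_mapping_single_induct)
  case (single b c)
  then show ?case using assms
    by (simp add: partial_trace_def linear_ext_single eval_twisted_scale basis_partial_trace_closed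
        eval_basis_partial_trace eval_twisted_single sum_distrib_left del: basis_partial_trace.simps)
qed (simp_all add: partial_trace_def linear_ext_add eval_twisted_add sum.distrib)

section \<open>The outer tensor product under evaluation\<close>

lemma prod_lessThan_add:
  fixes f :: "nat \<Rightarrow> 'a::comm_monoid_mult"
  shows "(\<Prod>k<m + n. f k) = (\<Prod>k<m. f k) * (\<Prod>k<n. f (m + k))"
  by (induction n) (simp_all add: mult.assoc)

lemma basis_tensor_closed:
  assumes "b \<in> basis m" "c \<in> basis n"
  shows "basis_tensor b c \<in> basis (m + n)"
proof -
  obtain \<sigma> Ms \<tau> Ns where [simp]: "b = (\<sigma>, Ms)" "c = (\<tau>, Ns)" by (metis surj_pair)
  from assms have \<sigma>: "\<sigma> permutes {..<m}" and \<tau>: "\<tau> permutes {..<n}"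
    and len: "length Ms = m" "length Ns = n" by (auto simp: basis_iff)
  let ?f = "\<lambda>\<sigma> \<tau> i. if i < m then \<sigma> i else m + \<tau> (i - m)"
  have *: "?f \<sigma> \<tau> i < m + n" if "\<sigma> permutes {..<m}" "\<tau> permutes {..<n}" "i < m + n" for \<sigma> \<tau> i
    using permutes_less[OF that(1), of i] permutes_less[OF that(2), of "i - m"] that(3) by (auto)
  have "bij_betw (?f \<sigma> \<tau>) {..<m + n} {..<m + n}"
  proof (rule bij_betw_byWitness[where f' = "?f (inv_into UNIV \<sigma>) (inv_into UNIV \<tau>)"])
    show "?f \<sigma> \<tau> ` {..<m + n} \<subseteq> {..<m + n}" by (rule image_subsetI) (unfold lessThan_iff, rule *[OF \<sigma> \<tau>])
    show "?f (inv_into UNIV \<sigma>) (inv_into UNIV \<tau>) ` {..<m + n} \<subseteq> {..<m + n}"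
      by (rule image_subsetI) (unfold lessThan_iff, rule *[OF permutes_inv[OF \<sigma>] permutes_inv[OF \<tau>]])
  qed (auto simp: permutes_inverses[OF \<sigma>] permutes_inverses[OF \<tau>] permutes_less[OF \<sigma>] permutes_inv_less[OF \<sigma>])
  moreover have "?f \<sigma> \<tau> i = i" if "i \<notin> {..<m + n}" for i
  proof -
    have "m + (i - m) = i" "\<not> i < m" using that by auto
    with permutes_not_in[OF \<tau>, of "i - m"] that show ?thesis by auto
  qed
  ultimately have "?f \<sigma> \<tau> permutes {..<m + n}" by (rule bij_imp_permutes)
  then show ?thesis by (simp add: basis_iff len cong: if_cong)
qed

lemma outer_tensor_closed:
  "F \<in> carrier (twisted_algebra m) \<Longrightarrow> G \<in> carrier (twisted_algebra n) \<Longrightarrow>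
    outer_tensor F G \<in> carrier (twisted_algebra (m + n))"
  unfolding carrier_twisted outer_tensor_def by (erule (1) keys_bilinear_ext) (rule basis_tensor_closed)

lemma eval_basis_tensor:
  fixes A :: "nat \<Rightarrow> rat^'d^'d::finite"
  assumes "b \<in> basis m" "c \<in> basis n" "length I = m + n" "length J = m + n"
  shows "eval_basis (m + n) A (basis_tensor b c) I J =
    eval_basis m A b (take m I) (take m J) * eval_basis n A c (drop m I) (drop m J)"
proof -
  obtain \<sigma> Ms \<tau> Ns where [simp]: "b = (\<sigma>, Ms)" "c = (\<tau>, Ns)" by (metis surj_pair)
  from assms have \<sigma>: "\<sigma> permutes {..<m}" and \<tau>: "\<tau> permutes {..<n}"
    and len: "length Ms = m" "length Ns = n" by (auto simp: basis_iff)
  show ?thesis unfolding eval_basis_def prod_lessThan_add using assms(3,4)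
    by (intro arg_cong2[where f = "(*)"] prod.cong)
      (auto simp: len nth_append permutes_less[OF \<sigma>] permutes_less[OF \<tau>])
qed

lemma eval_outer_tensor:
  fixes A :: "nat \<Rightarrow> rat^'d^'d::finite"
  assumes "F \<in> carrier (twisted_algebra m)" "G \<in> carrier (twisted_algebra n)"
    and "length I = m + n" "length J = m + n"
  shows "eval_twisted (m + n) A (outer_tensor F G) I J =
    eval_twisted m A F (take m I) (take m J) * eval_twisted n A G (drop m I) (drop m J)"
  using assms(1) unfolding carrier_twisted outer_tensor_def
proof (induction rule: poly_mapping_single_induct)
  case (single b x)
  note b = this
  show ?case
    using assms(2) unfolding carrier_twisted
  proof (induction rule: poly_mapping_single_induct)
    case (single c y)
    with b assms(3,4) show ?case
      by (simp add: eval_twisted_single basis_tensor_closed eval_basis_tensor eval_trpoly_mult)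
  qed (simp_all add: bilinear_ext_add_right eval_twisted_add distrib_left)
qed (simp_all add: bilinear_ext_add_left eval_twisted_add distrib_right)

section \<open>Tensor identities form a T-ideal\<close>

lemma tensor_identitiesI:
  assumes "F \<in> carrier (twisted_algebra n)"
    and "\<And>(A :: nat \<Rightarrow> rat^'d^'d) I J. length I = n \<Longrightarrow> length J = n \<Longrightarrow> eval_twisted n A F I J = 0"
  shows "F \<in> tensor_identities TYPE('d::finite) n"
  using assms by (simp add: tensor_identities_def)

lemma tensor_identitiesD:
  assumes "F \<in> tensor_identities TYPE('d::finite) n"
  shows "F \<in> carrier (twisted_algebra n)"
    and "length I = n \<Longrightarrow> length J = n \<Longrightarrow> eval_twisted n (A :: nat \<Rightarrow> rat^'d^'d) F I J = 0"
  using assms by (simp_all add: tensor_identities_def)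

lemma eval_twisted_uminus: "eval_twisted n A (- F) I J = - eval_twisted n A F I J"
  using eval_twisted_add[of n A F "- F" I J] by simp

lemma ideal_tensor_identities: "ideal (tensor_identities TYPE('d::finite) n) (twisted_algebra n)"
proof -
  let ?T = "tensor_identities TYPE('d) n"
  interpret R: ring "twisted_algebra n" by (rule ring_twisted_algebra)
  have add: "F \<oplus>\<^bsub>twisted_algebra n\<^esub> G = F + G" and zero: "\<zero>\<^bsub>twisted_algebra n\<^esub> = 0" for F G
    by (simp_all add: twisted_algebra_def)
  show ?thesis
  proof (rule idealI)
    show "subgroup ?T (add_monoid (twisted_algebra n))"
    proof (rule R.add.subgroupI)
      show "?T \<subseteq> carrier (twisted_algebra n)" by (auto dest: tensor_identitiesD)
      have "0 \<in> ?T" by (rule tensor_identitiesI) (simp_all add: carrier_twisted)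
      then show "?T \<noteq> {}" by blast
      fix F assume F: "F \<in> ?T"
      have mF: "- F \<in> carrier (twisted_algebra n)"
        using tensor_identitiesD(1)[OF F] by (auto simp: carrier_twisted in_keys_iff)
      have "\<ominus>\<^bsub>twisted_algebra n\<^esub> F = - F"
        by (rule R.minus_equality[OF _ tensor_identitiesD(1)[OF F] mF]) (simp add: add zero)
      moreover have "- F \<in> ?T"
        using mF F by (intro tensor_identitiesI) (simp_all add: eval_twisted_uminus tensor_identitiesD)
      ultimately show "\<ominus>\<^bsub>twisted_algebra n\<^esub> F \<in> ?T" by simp
      fix G assume G: "G \<in> ?T"
      have "F \<oplus>\<^bsub>twisted_algebra n\<^esub> G \<in> carrier (twisted_algebra n)"
        using F G by (auto dest: tensor_identitiesD)
      then show "F \<oplus>\<^bsub>twisted_algebra n\<^esub> G \<in> ?T"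
        using F G by (intro tensor_identitiesI) (simp_all add: add eval_twisted_add tensor_identitiesD)
    qed
    fix F G assume F: "F \<in> ?T" and G: "G \<in> carrier (twisted_algebra n)"
    show "G \<otimes>\<^bsub>twisted_algebra n\<^esub> F \<in> ?T" "F \<otimes>\<^bsub>twisted_algebra n\<^esub> G \<in> ?T"
      using F G by (auto intro!: tensor_identitiesI simp: mult_twisted mult_closed eval_twisted_mult tensor_identitiesD)
  qed (rule ring_twisted_algebra)
qed

lemma outer_tensor_identities:
  assumes "F \<in> carrier (twisted_algebra m)" "G \<in> carrier (twisted_algebra n)"
    and "F \<in> tensor_identities TYPE('d::finite) m \<or> G \<in> tensor_identities TYPE('d) n"
  shows "outer_tensor F G \<in> tensor_identities TYPE('d) (m + n)"
  using assms by (auto intro!: tensor_identitiesI simp: outer_tensor_closed eval_outer_tensor tensor_identitiesD)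

lemma partial_trace_identities:
  "F \<in> tensor_identities TYPE('d::finite) (Suc n) \<Longrightarrow> partial_trace F \<in> tensor_identities TYPE('d) n"
  by (intro tensor_identitiesI) (simp_all add: partial_trace_closed eval_partial_trace tensor_identitiesD)

subsection \<open>Trace-compatible endomorphisms\<close>

lemma trace_monomial_prod_list:
  "\<exists>ts. Poly_Mapping.single m (1::rat) = prod_list (map tr_var ts)"
proof -
  have "Poly_Mapping.keys m \<subseteq> UNIV" by simp
  then show ?thesis
  proof (induction rule: poly_mapping_single_induct)
    case zero
    show ?case by (intro exI[of _ "[]"]) simp
  next
    case (single w k)
    obtain M where w: "w = abs_cyclic_word M"
      by (metis Quotient_abs_rep Quotient_cyclic_word)
    have "Poly_Mapping.single (Poly_Mapping.single w k) (1::rat) = prod_list (map tr_var (replicate k M))"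
    proof (induction k)
      case (Suc k)
      have "Poly_Mapping.single (Poly_Mapping.single w (Suc k)) (1::rat) =
        tr_var M * Poly_Mapping.single (Poly_Mapping.single w k) 1"
        by (simp add: tr_var_def w mult_single flip: single_add)
      with Suc show ?case by simp
    qed simp
    then show ?case by blast
  next
    case (add m m')
    then obtain ts ts' where "Poly_Mapping.single m (1::rat) = prod_list (map tr_var ts)"
      "Poly_Mapping.single m' (1::rat) = prod_list (map tr_var ts')" by blast
    then have "Poly_Mapping.single (m + m') (1::rat) = prod_list (map tr_var (ts @ ts'))"
      by (simp flip: mult_single[of m 1 m' "1::rat", simplified])
    then show ?case by blast
  qed
qed

text \<open>Rational constants and trace variables generate the trace ring, and on these generators
  the axioms in \<open>trace_endo\<close> show that \<open>g\<close> stays inside the image of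
  \<open>scalar\<close>.\<close>

lemma trpoly_induct [case_names const var add mult]:
  assumes const: "\<And>q. P (rat_const q)" and var: "\<And>M. P (tr_var M)"
    and add: "\<And>c e. P c \<Longrightarrow> P e \<Longrightarrow> P (c + e)" and mult: "\<And>c e. P c \<Longrightarrow> P e \<Longrightarrow> P (c * e)"
  shows "P c"
proof -
  have "Poly_Mapping.keys c \<subseteq> UNIV" by simp
  then show ?thesis
  proof (induction rule: poly_mapping_single_induct)
    case zero
    then show ?case using const[of 0] by (simp add: rat_const_hom)
  next
    case (single m q)
    obtain ts where ts: "Poly_Mapping.single m (1::rat) = prod_list (map tr_var ts)"
      using trace_monomial_prod_list by blast
    have "P (prod_list (map tr_var ts))"
      by (induction ts) (use const[of 1] in \<open>auto simp: rat_const_hom intro: mult var\<close>)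
    moreover have "Poly_Mapping.single m q = rat_const q * Poly_Mapping.single m 1"
      by (simp add: rat_const_def mult_single)
    ultimately show ?case using mult[OF const] by (simp add: ts)
  qed (rule add)
qed

text \<open>Evaluation on the free algebra with trace itself: an endomorphism sends a variable to an
  arbitrary element, whose matrix value becomes the new value of that variable.\<close>

definition eval_tralg :: "(nat \<Rightarrow> rat^'d^'d) \<Rightarrow> tralg \<Rightarrow> rat^'d^'d" where
  "eval_tralg A a =
    (\<chi> i j. \<Sum>M\<in>Poly_Mapping.keys a. eval_trpoly A (Poly_Mapping.lookup a M) * eval_mono A M $ i $ j)"

lemma eval_tralg_add: "eval_tralg A (a + b) = eval_tralg A a + eval_tralg A b"
proof -
  have "eval_tralg A (a + b) $ i $ j = eval_tralg A a $ i $ j + eval_tralg A b $ i $ j" for i j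
    unfolding eval_tralg_def vec_lambda_beta
    by (rule sum_keys_add) (simp_all add: eval_trpoly_add distrib_right)
  then show ?thesis by (simp add: vec_eq_iff)
qed

lemma eval_tralg_zero [simp]: "eval_tralg A 0 = 0"
  by (simp add: eval_tralg_def vec_eq_iff)

lemma eval_tralg_single: "eval_tralg A (Poly_Mapping.single M c) $ i $ j = eval_trpoly A c * eval_mono A M $ i $ j"
  unfolding eval_tralg_def vec_lambda_beta by (rule sum_keys_single) simp

lemma eval_tralg_mult:
  fixes A :: "nat \<Rightarrow> rat^'d^'d::finite"
  shows "eval_tralg A (a * b) = eval_tralg A a ** eval_tralg A b"
proof -
  have "Poly_Mapping.keys a \<subseteq> UNIV" by simp
  then show ?thesis
  proof (induction rule: poly_mapping_single_induct)
    case (single M c)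
    have "Poly_Mapping.keys b \<subseteq> UNIV" by simp
    then show ?case
    proof (induction rule: poly_mapping_single_induct)
      case (single N e)
      show ?case
        by (simp add: mult_single vec_eq_iff eval_tralg_single matrix_matrix_mult_def plus_list_def
            eval_mono_append eval_trpoly_mult sum_distrib_left mult_ac)
    qed (simp_all add: distrib_left eval_tralg_add matrix_add_ldistrib matrix_matrix_mult_def[of _ 0] vec_eq_iff)
  qed (simp_all add: distrib_right eval_tralg_add distrib_right sum.distrib matrix_matrix_mult_def vec_eq_iff)
qed

lemma eval_trpoly_formal_tr:
  fixes A :: "nat \<Rightarrow> rat^'d^'d::finite"
  shows "eval_trpoly A (formal_tr a) = trace (eval_tralg A a)"
proof -
  have "trace (eval_tralg A a) = (\<Sum>M\<in>Poly_Mapping.keys a.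
      \<Sum>i\<in>UNIV. eval_trpoly A (Poly_Mapping.lookup a M) * eval_mono A M $ i $ i)"
    unfolding trace_def eval_tralg_def vec_lambda_beta by (rule sum.swap)
  then show ?thesis
    by (simp add: formal_tr_def eval_trpoly_sum eval_trpoly_mult trace_def sum_distrib_left)
qed

lemma formal_tr_mono: "formal_tr (mono M) = tr_var M"
  by (simp add: formal_tr_def mono_def)

lemma mono_hom: "mono [] = 1" "mono (M @ N) = mono M * mono N"
  by (simp_all add: mono_def mult_single plus_list_def flip: zero_list_def)

lemma scalar_hom: "scalar 0 = 0" "scalar (c + e) = scalar c + scalar e" "scalar (c * e) = scalar c * scalar e"
  by (simp_all add: scalar_def single_add mult_single flip: zero_list_def)

lemma inj_scalar: "inj scalar"
  by (metis injI inj_single injD scalar_def)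

lemma trace_endo_zero: "trace_endo g \<Longrightarrow> g 0 = 0"
  unfolding trace_endo_def by (metis add_0_left add_cancel_right_left)

lemma restrict_to_trpolyI: "g (scalar c) = scalar c' \<Longrightarrow> restrict_to_trpoly g c = c'"
  by (simp add: restrict_to_trpoly_def inj_scalar)

lemma eval_endo_mono:
  fixes A :: "nat \<Rightarrow> rat^'d^'d::finite"
  assumes "trace_endo g"
  shows "eval_tralg A (g (mono M)) = eval_mono (\<lambda>x. eval_tralg A (g (mono [x]))) M"
proof (induction M)
  case Nil
  have "g (mono []) = mono []" using assms by (simp add: mono_hom trace_endo_def)
  then show ?case by (simp add: vec_eq_iff eval_mono_def mono_def eval_tralg_single)
next
  case (Cons x M)
  have "g (mono (x # M)) = g (mono [x]) * g (mono M)"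
    using assms mono_hom(2)[of "[x]" M] by (simp add: trace_endo_def)
  with Cons show ?case by (simp add: eval_tralg_mult eval_mono_def)
qed

text \<open>As \<open>restrict_to_trpoly\<close> inverts \<open>scalar\<close>, it is meaningful at
  \<open>c\<close> only if \<open>g\<close> maps \<open>scalar c\<close> into the image of
  \<open>scalar\<close>. One induction over the generators yields both the preimage and its
  value.\<close>

lemma trace_endo_scalar:
  fixes A :: "nat \<Rightarrow> rat^'d^'d::finite"
  assumes g: "trace_endo g"
  shows "g (scalar c) = scalar (restrict_to_trpoly g c)"
    and "eval_trpoly A (restrict_to_trpoly g c) = eval_trpoly (\<lambda>x. eval_tralg A (g (mono [x]))) c"
proof -
  let ?A = "\<lambda>x. eval_tralg A (g (mono [x]))"
  have "\<exists>c'. g (scalar c) = scalar c' \<and> eval_trpoly A c' = eval_trpoly ?A c"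
  proof (induction c rule: trpoly_induct)
    case (const q)
    have "g (scalar (rat_const q) * 1) = scalar (rat_const q) * 1"
      using g unfolding trace_endo_def by metis
    then show ?case by (intro exI[of _ "rat_const q"]) simp
  next
    case (var M)
    \<comment> \<open>A trace variable is the formal trace of a monomial, so compatibility with the
      trace applies to it.\<close>
    have "g (scalar (formal_tr (mono M))) = scalar (formal_tr (g (mono M)))"
      using g unfolding trace_endo_def by metis
    then show ?case
      by (intro exI[of _ "formal_tr (g (mono M))"])
        (simp add: formal_tr_mono eval_trpoly_formal_tr eval_endo_mono[OF g, of A M])
  next
    case (add c e)
    then obtain c' e' where "g (scalar c) = scalar c'" "eval_trpoly A c' = eval_trpoly ?A c"
      "g (scalar e) = scalar e'" "eval_trpoly A e' = eval_trpoly ?A e" by blast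
    then show ?case using g
      by (intro exI[of _ "c' + e'"]) (simp add: scalar_hom trace_endo_def eval_trpoly_add)
  next
    case (mult c e)
    then obtain c' e' where "g (scalar c) = scalar c'" "eval_trpoly A c' = eval_trpoly ?A c"
      "g (scalar e) = scalar e'" "eval_trpoly A e' = eval_trpoly ?A e" by blast
    then show ?case using g
      by (intro exI[of _ "c' * e'"]) (simp add: scalar_hom trace_endo_def eval_trpoly_mult)
  qed
  then obtain c' where "g (scalar c) = scalar c'" "eval_trpoly A c' = eval_trpoly ?A c" by blast
  with restrict_to_trpolyI[of g c c']
  show "g (scalar c) = scalar (restrict_to_trpoly g c)"
    and "eval_trpoly A (restrict_to_trpoly g c) = eval_trpoly ?A c" by simp_all
qed

lemma length_listset: "Ns \<in> listset Ss \<Longrightarrow> length Ns = length Ss"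
  by (induction Ss arbitrary: Ns) (auto simp: set_Cons_def)

lemma pure_tensor_closed:
  assumes "\<sigma> permutes {..<n}" "length as = n"
  shows "pure_tensor \<sigma> as \<in> carrier (twisted_algebra n)"
proof -
  have "Poly_Mapping.keys (pure_tensor \<sigma> as) \<subseteq> (\<Union>Ns\<in>listset (map Poly_Mapping.keys as). {(\<sigma>, Ns)})"
    unfolding pure_tensor_def by (intro order_trans[OF keys_sum] UN_mono order_refl) auto
  also have "\<dots> \<subseteq> basis n" using assms by (auto simp: basis_iff dest: length_listset)
  finally show ?thesis by (simp add: carrier_twisted)
qed

lemma eval_pure_tensor:
  fixes A :: "nat \<Rightarrow> rat^'d^'d::finite"
  assumes "\<sigma> permutes {..<n}" "length as = n" "length I = n"
  shows "eval_twisted n A (pure_tensor \<sigma> as) I J = (\<Prod>k<n. eval_tralg A (as ! k) $ (I ! \<sigma> k) $ (J ! k))"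
proof -
  have fin: "\<And>S. S \<in> set (map Poly_Mapping.keys as) \<Longrightarrow> finite S" by auto
  have "eval_twisted n A (pure_tensor \<sigma> as) I J =
    (\<Sum>Ns\<in>listset (map Poly_Mapping.keys as). \<Prod>k<n.
       eval_trpoly A (Poly_Mapping.lookup (as ! k) (Ns ! k)) * eval_mono A (Ns ! k) $ (I ! \<sigma> k) $ (J ! k))"
    unfolding pure_tensor_def eval_twisted_sum
    by (intro sum.cong refl, subst eval_twisted_single)
      (use assms in \<open>auto simp: basis_iff eval_trpoly_prod eval_basis_def prod.distrib dest: length_listset\<close>)
  also have "\<dots> = (\<Prod>k<n. \<Sum>N\<in>Poly_Mapping.keys (as ! k).
       eval_trpoly A (Poly_Mapping.lookup (as ! k) N) * eval_mono A N $ (I ! \<sigma> k) $ (J ! k))"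
    using prod_sum_listset[of "map Poly_Mapping.keys as", THEN conjunct2, OF fin, of "\<lambda>k N.
       eval_trpoly A (Poly_Mapping.lookup (as ! k) N) * eval_mono A N $ (I ! \<sigma> k) $ (J ! k)"] assms by auto
  finally show ?thesis by (simp add: eval_tralg_def)
qed

lemma induced_endo_single:
  assumes "trace_endo g"
  shows "induced_endo g (Poly_Mapping.single (\<sigma>, Ms) c) =
    scale (restrict_to_trpoly g c) (pure_tensor \<sigma> (map (\<lambda>M. g (mono M)) Ms))"
proof -
  have "restrict_to_trpoly g 0 = 0"
    by (rule restrict_to_trpolyI) (simp add: scalar_hom trace_endo_zero[OF assms])
  then show ?thesis by (cases "c = 0") (simp_all add: induced_endo_def)
qed

lemma induced_endo_add:
  assumes g: "trace_endo g"
  shows "induced_endo g (F + G) = induced_endo g F + induced_endo g G"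
proof -
  have "restrict_to_trpoly g 0 = 0"
    by (rule restrict_to_trpolyI) (simp add: scalar_hom trace_endo_zero[OF assms])
  moreover have "restrict_to_trpoly g (c + e) = restrict_to_trpoly g c + restrict_to_trpoly g e" for c e
    using g by (intro restrict_to_trpolyI) (simp add: scalar_hom trace_endo_def flip: trace_endo_scalar[OF g])
  ultimately show ?thesis
    unfolding induced_endo_def split_def prod.collapse
    by (intro sum_keys_add[where f = "\<lambda>b c. scale (restrict_to_trpoly g c)
      (pure_tensor (fst b) (map (\<lambda>M. g (mono M)) (snd b)))"]) (simp_all add: scale_add_left)
qed

lemma induced_endo_zero [simp]: "induced_endo g 0 = 0"
  by (simp add: induced_endo_def)

lemma scale_closed: "F \<in> carrier (twisted_algebra n) \<Longrightarrow> scale c F \<in> carrier (twisted_algebra n)"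
  using keys_scale[of c F] by (auto simp: carrier_twisted)

lemma induced_endo_closed:
  assumes "trace_endo g" "F \<in> carrier (twisted_algebra n)"
  shows "induced_endo g F \<in> carrier (twisted_algebra n)"
  using assms(2) unfolding carrier_twisted
proof (induction rule: poly_mapping_single_induct)
  case (single b c)
  then show ?case
    unfolding carrier_twisted[symmetric]
    by (cases b) (auto simp: induced_endo_single[OF assms(1)] basis_iff intro!: scale_closed pure_tensor_closed)
qed (simp_all add: induced_endo_add[OF assms(1)] keys_add_subset)

text \<open>Substitution followed by evaluation at \<open>A\<close> is evaluation at the matrices of
  the images of the variables, so elements vanishing at all assignments are sent to such
  elements.\<close>

lemma eval_induced_endo:
  fixes A :: "nat \<Rightarrow> rat^'d^'d::finite"
  assumes g: "trace_endo g" and F: "F \<in> carrier (twisted_algebra n)" and I: "length I = n"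
  shows "eval_twisted n A (induced_endo g F) I J = eval_twisted n (\<lambda>x. eval_tralg A (g (mono [x]))) F I J"
proof -
  define A' where "A' x = eval_tralg A (g (mono [x]))" for x
  have mono: "eval_tralg A (g (mono M)) = eval_mono A' M" for M
    unfolding A'_def by (rule eval_endo_mono[OF g])
  have scalar: "eval_trpoly A (restrict_to_trpoly g c) = eval_trpoly A' c" for c
    unfolding A'_def by (rule trace_endo_scalar(2)[OF g])
  have "eval_twisted n A (induced_endo g F) I J = eval_twisted n A' F I J"
    using F unfolding carrier_twisted
  proof (induction rule: poly_mapping_single_induct)
    case (single b c)
    obtain \<sigma> Ms where b: "b = (\<sigma>, Ms)" by (cases b)
    with single I show ?case
      by (simp add: induced_endo_single[OF g] eval_twisted_scale pure_tensor_closed basis_iff eval_pure_tensor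
          eval_twisted_single scalar eval_basis_def mono)
  qed (simp_all add: induced_endo_add[OF g] eval_twisted_add)
  then show ?thesis by (simp add: A'_def[abs_def])
qed

lemma T_ideal_tensor_identities: "T_ideal (tensor_identities TYPE('d::finite))"
  unfolding T_ideal_def
proof (intro conjI allI ballI impI)
  fix g and n
  assume g: "trace_endo g"
  show "induced_endo g ` tensor_identities TYPE('d) n \<subseteq> tensor_identities TYPE('d) n"
    by (auto intro!: tensor_identitiesI simp: induced_endo_closed[OF g] eval_induced_endo[OF g] tensor_identitiesD)
qed (auto simp: ideal_tensor_identities partial_trace_identities
    intro!: outer_tensor_identities dest: tensor_identitiesD)

lemma twisted0_in_tensor_identities:
  "twisted0 (tr_var [] - of_nat CARD('d)) \<in> tensor_identities TYPE('d::finite) 0"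
proof (rule tensor_identitiesI)
  have b: "(id, []) \<in> basis 0" by (simp add: basis_iff permutes_id)
  show "twisted0 (tr_var [] - of_nat CARD('d)) \<in> carrier (twisted_algebra 0)"
    unfolding twisted0_def by (rule single_in_carrier[OF b])
  fix A :: "nat \<Rightarrow> rat^'d^'d" and I J :: "'d list"
  have "eval_trpoly A (tr_var [] - of_nat CARD('d)) + eval_trpoly A (of_nat CARD('d)) = eval_trpoly A (tr_var [])"
    unfolding eval_trpoly_add[symmetric] by simp
  then have "eval_trpoly A (tr_var [] - of_nat CARD('d)) = 0"
    by (simp add: eval_mono_def trace_def mat_def)
  moreover assume "length I = 0" "length J = 0"
  ultimately show "eval_twisted 0 A (twisted0 (tr_var [] - of_nat CARD('d))) I J = 0"
    unfolding twisted0_def by (simp add: eval_twisted_single b)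
qed

text \<open>The entry at \<open>(I, J)\<close> of the operator of \<open>\<sigma>\<close> on the
  \<open>n\<close>-th tensor power, written without the inverse that occurs in
  \<open>op_perm\<close>.\<close>

definition perm_matches :: "nat \<Rightarrow> (nat \<Rightarrow> nat) \<Rightarrow> 'd list \<Rightarrow> 'd list \<Rightarrow> rat" where
  "perm_matches n \<sigma> I J = (if \<forall>k<n. I ! \<sigma> k = J ! k then 1 else 0)"

lemma eval_basis_perm:
  fixes A :: "nat \<Rightarrow> rat^'d^'d::finite"
  shows "eval_basis n A (\<sigma>, replicate n []) I J = perm_matches n \<sigma> I J"
proof -
  have "eval_basis n A (\<sigma>, replicate n []) I J = (\<Prod>k<n. if I ! \<sigma> k = J ! k then 1 else 0)"
    unfolding eval_basis_def by (intro prod.cong) (auto simp: eval_mono_def mat_def)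
  also have "\<dots> = perm_matches n \<sigma> I J"
    by (auto simp: perm_matches_def intro!: prod.neutral)
  finally show ?thesis .
qed

text \<open>A multi-index of length d + 1 over d basis vectors repeats a value. Composing on the
  left with the transposition of the two equal positions preserves all matching conditions and
  reverses all signs, so each entry equals its negative.\<close>

lemma antisymmetrizer_in_tensor_identities:
  "antisymmetrizer (CARD('d) + 1) \<in> tensor_identities TYPE('d::finite) (CARD('d) + 1)"
proof -
  define n where "n = CARD('d) + 1"
  let ?P = "{\<sigma>. \<sigma> permutes {..<n}}"
  have fin: "finite ?P" by (simp add: finite_permutations)
  have b: "(\<sigma>, replicate n []) \<in> basis n" if "\<sigma> \<in> ?P" for \<sigma> :: "nat \<Rightarrow> nat"
    using that by (simp add: basis_iff)
  have "antisymmetrizer n \<in> tensor_identities TYPE('d) n"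
  proof (rule tensor_identitiesI)
    show "antisymmetrizer n \<in> carrier (twisted_algebra n)"
      unfolding antisymmetrizer_def carrier_twisted
      by (rule order_trans[OF keys_sum]) (use b in \<open>auto split: if_splits\<close>)
    fix A :: "nat \<Rightarrow> rat^'d^'d" and I J :: "'d list"
    assume I: "length I = n" and J: "length J = n"
    have "\<not> inj_on ((!) I) {..<n}"
      by (rule pigeonhole) (use card_mono[of UNIV "(!) I ` {..<n}"] in \<open>simp add: n_def\<close>)
    then obtain i j where ij: "i < n" "j < n" "i \<noteq> j" "I ! i = I ! j"
      by (auto simp: inj_on_def)
    define t where "t = Transposition.transpose i j"
    have t: "t permutes {..<n}" unfolding t_def using ij by (intro permutes_swap_id) auto
    have tt: "t \<circ> (t \<circ> \<sigma>) = \<sigma>" for \<sigma> :: "nat \<Rightarrow> nat" by (simp add: t_def fun_eq_iff)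
    have It: "I ! t k = I ! k" for k using ij by (auto simp: t_def Transposition.transpose_def)
    have "permutation t" using t permutation_permutes by blast
    then have st: "sign (t \<circ> \<sigma>) = - sign \<sigma>" if "\<sigma> \<in> ?P" for \<sigma>
      using that ij permutation_permutes[of \<sigma>] by (auto simp: sign_compose t_def sign_swap_id)
    let ?s = "\<Sum>\<sigma>\<in>?P. of_int (sign \<sigma>) * perm_matches n \<sigma> I J"
    have "?s = (\<Sum>\<sigma>\<in>?P. of_int (sign (t \<circ> \<sigma>)) * perm_matches n (t \<circ> \<sigma>) I J)"
      by (rule sum.reindex_bij_witness[of _ "\<lambda>\<sigma>. t \<circ> \<sigma>" "\<lambda>\<sigma>. t \<circ> \<sigma>"])
        (auto simp: tt permutes_compose t)
    also have "\<dots> = - ?s"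
      unfolding sum_negf[symmetric] by (rule sum.cong) (simp_all add: st perm_matches_def It)
    finally have "?s = 0" by simp
    moreover have "eval_twisted n A (antisymmetrizer n) I J = ?s"
      unfolding antisymmetrizer_def eval_twisted_sum
      by (rule sum.cong) (use b I in \<open>simp_all add: eval_twisted_single eval_basis_perm\<close>)
    ultimately show "eval_twisted n A (antisymmetrizer n) I J = 0" by simp
  qed
  then show ?thesis by (simp add: n_def)
qed

section \<open>Elementary properties of T-ideals\<close>

lemma T_ideal_ideal: "T_ideal J \<Longrightarrow> ideal (J n) (twisted_algebra n)"
  by (simp add: T_ideal_def)

lemma T_ideal_carrier: "T_ideal J \<Longrightarrow> F \<in> J n \<Longrightarrow> F \<in> carrier (twisted_algebra n)"
  using additive_subgroup.a_subset[OF ideal.axioms(1)[OF T_ideal_ideal]] by blast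

lemma T_ideal_zero: "T_ideal J \<Longrightarrow> 0 \<in> J n"
  using additive_subgroup.zero_closed[OF ideal.axioms(1)[OF T_ideal_ideal[of J n]]]
  by (simp add: twisted_algebra_def)

lemma T_ideal_add: "T_ideal J \<Longrightarrow> F \<in> J n \<Longrightarrow> G \<in> J n \<Longrightarrow> F + G \<in> J n"
  using additive_subgroup.a_closed[OF ideal.axioms(1)[OF T_ideal_ideal[of J n]], of F G]
  by (simp add: twisted_algebra_def)

lemma T_ideal_mult_left:
  "T_ideal J \<Longrightarrow> F \<in> J n \<Longrightarrow> G \<in> carrier (twisted_algebra n) \<Longrightarrow> bilinear_ext basis_mult G F \<in> J n"
  using ideal.I_l_closed[OF T_ideal_ideal[of J n], of F G] by (simp add: mult_twisted)

lemma T_ideal_mult_right: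
  "T_ideal J \<Longrightarrow> F \<in> J n \<Longrightarrow> G \<in> carrier (twisted_algebra n) \<Longrightarrow> bilinear_ext basis_mult F G \<in> J n"
  using ideal.I_r_closed[OF T_ideal_ideal[of J n], of F G] by (simp add: mult_twisted)

lemma T_ideal_scale:
  assumes "T_ideal J" "F \<in> J n"
  shows "scale c F \<in> J n"
proof -
  have "Poly_Mapping.single (id, replicate n []) c \<in> carrier (twisted_algebra n)"
    by (rule single_in_carrier) (simp add: basis_iff permutes_id)
  from T_ideal_mult_left[OF assms this] show ?thesis
    by (simp add: mult_one_left T_ideal_carrier[OF assms])
qed

lemma T_ideal_diff:
  assumes "T_ideal J" "F \<in> J n" "G \<in> J n"
  shows "F - G \<in> J n"
proof -
  have "scale (- 1) G = - G" by (rule poly_mapping_eqI) simp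
  with T_ideal_add[OF assms(1,2) T_ideal_scale[OF assms(1,3), of "- 1"]] show ?thesis by simp
qed

lemma T_ideal_sum:
  assumes "T_ideal J" "\<And>i. i \<in> I \<Longrightarrow> F i \<in> J n"
  shows "(\<Sum>i\<in>I. F i) \<in> J n"
  using assms(2) by (induction I rule: infinite_finite_induct) (simp_all add: T_ideal_zero T_ideal_add assms(1))

lemma T_ideal_partial_trace: "T_ideal J \<Longrightarrow> F \<in> J (Suc n) \<Longrightarrow> partial_trace F \<in> J n"
  unfolding T_ideal_def by blast

lemma T_ideal_outer_left:
  "T_ideal J \<Longrightarrow> F \<in> J m \<Longrightarrow> G \<in> carrier (twisted_algebra n) \<Longrightarrow> outer_tensor F G \<in> J (m + n)"
  unfolding T_ideal_def by blast


section \<open>The kernel of the symmetric group acting on tensors\<close>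

text \<open>The rational group algebra of the symmetric group, inside the twisted algebra as the
  elements with empty words. A coefficient function is used so that the support can be bounded in
  the lexicographic order.\<close>

definition perm_sum :: "nat \<Rightarrow> ((nat \<Rightarrow> nat) \<Rightarrow> rat) \<Rightarrow> twisted" where
  "perm_sum n a = (\<Sum>\<sigma> | \<sigma> permutes {..<n}. Poly_Mapping.single (\<sigma>, replicate n []) (rat_const (a \<sigma>)))"

lemma perm_sum_diff:
  "perm_sum n (\<lambda>\<sigma>. a \<sigma> - q * b \<sigma>) = perm_sum n a - scale (rat_const q) (perm_sum n b)"
proof -
  have "rat_const (x - q * y) = rat_const x - rat_const q * rat_const y" for x y
    by (simp add: rat_const_hom diff_conv_add_uminus del: add_uminus_conv_diff)
  then show ?thesis
    by (simp add: perm_sum_def scale_sum single_diff flip: sum_subtractf)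
qed

lemma perm_sum_closed: "perm_sum n a \<in> carrier (twisted_algebra n)"
  unfolding perm_sum_def carrier_twisted
  by (rule order_trans[OF keys_sum]) (auto simp: basis_iff split: if_splits)

lemma eval_perm_sum:
  fixes A :: "nat \<Rightarrow> rat^'d^'d::finite"
  assumes "length I = n"
  shows "eval_twisted n A (perm_sum n a) I J = (\<Sum>\<sigma> | \<sigma> permutes {..<n}. a \<sigma> * perm_matches n \<sigma> I J)"
  unfolding perm_sum_def eval_twisted_sum
  by (rule sum.cong) (simp_all add: eval_twisted_single basis_iff assms eval_basis_perm)

text \<open>\<open>\<pi>\<close> need not be injective: coefficients of a permutation arising from
  several \<open>x\<close> are added. This turns an explicit family into a coefficient
  function.\<close>

lemma perm_sum_family:
  assumes X: "finite X" and \<pi>: "\<And>x. x \<in> X \<Longrightarrow> \<pi> x permutes {..<n}"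
  shows "perm_sum n (\<lambda>\<tau>. \<Sum>x\<in>X. if \<pi> x = \<tau> then r x else 0) =
    (\<Sum>x\<in>X. Poly_Mapping.single (\<pi> x, replicate n []) (rat_const (r x)))"
proof -
  have "Poly_Mapping.single b (rat_const (\<Sum>x\<in>X. f x)) = (\<Sum>x\<in>X. Poly_Mapping.single b (rat_const (f x)))"
    for b :: basis_elem and f
    using X by (induction X) (simp_all add: rat_const_hom single_add)
  then have "perm_sum n (\<lambda>\<tau>. \<Sum>x\<in>X. if \<pi> x = \<tau> then r x else 0) =
      (\<Sum>\<tau> | \<tau> permutes {..<n}. \<Sum>x\<in>X. if \<pi> x = \<tau> then Poly_Mapping.single (\<tau>, replicate n []) (rat_const (r x)) else 0)"
    unfolding perm_sum_def by (intro sum.cong refl) (simp add: if_distrib rat_const_hom cong: if_cong)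
  also have "\<dots> = (\<Sum>x\<in>X. \<Sum>\<tau> | \<tau> permutes {..<n}.
      if \<pi> x = \<tau> then Poly_Mapping.single (\<tau>, replicate n []) (rat_const (r x)) else 0)"
    by (rule sum.swap)
  also have "\<dots> = (\<Sum>x\<in>X. Poly_Mapping.single (\<pi> x, replicate n []) (rat_const (r x)))"
    by (intro sum.cong refl, subst sum.delta') (auto simp: finite_permutations \<pi>)
  finally show ?thesis .
qed

text \<open>Moves the positions of a decreasing chain to the initial positions, where the
  antisymmetriser acts.\<close>

lemma ex_permutes_image_lessThan:
  assumes "S \<subseteq> {..<n}" "card S = m"
  obtains \<theta> where "\<theta> permutes {..<n}" "\<theta> ` S = {..<m}"
proof -
  have fin: "finite S" using assms finite_subset by blast
  have mn: "m \<le> n" using card_mono[of "{..<n}" S] assms by simp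
  obtain f where f: "bij_betw f S {..<m}"
    using fin assms finite_same_card_bij[of S "{..<m}"] by auto
  have "card ({..<n} - S) = card ({..<n} - {..<m})"
    using assms mn fin by (simp add: card_Diff_subset)
  then obtain g where g: "bij_betw g ({..<n} - S) ({..<n} - {..<m})"
    using finite_same_card_bij by (metis finite_Diff finite_lessThan)
  define \<theta> where "\<theta> i = (if i \<in> S then f i else if i < n then g i else i)" for i
  have 1: "bij_betw \<theta> S {..<m}"
    using f by (rule bij_betw_cong[THEN iffD1, rotated]) (simp add: \<theta>_def)
  have "bij_betw \<theta> ({..<n} - S) ({..<n} - {..<m})"
    using g by (rule bij_betw_cong[THEN iffD1, rotated]) (simp add: \<theta>_def)
  with 1 have "bij_betw \<theta> (S \<union> ({..<n} - S)) ({..<m} \<union> ({..<n} - {..<m}))"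
    by (rule bij_betw_combine) auto
  moreover have "S \<union> ({..<n} - S) = {..<n}" "{..<m} \<union> ({..<n} - {..<m}) = {..<n}"
    using assms mn by auto
  ultimately have "bij_betw \<theta> {..<n} {..<n}" by simp
  then have "\<theta> permutes {..<n}"
    by (rule bij_imp_permutes) (use assms in \<open>auto simp: \<theta>_def\<close>)
  with 1 show thesis by (intro that) (auto simp: bij_betw_def)
qed

lemma replicate_word_mult:
  "basis_mult (\<sigma>, replicate n []) (\<tau>, replicate n []) = (\<sigma> \<circ> \<tau>, replicate n [])" if "\<tau> permutes {..<n}"
  using that by (auto intro: nth_equalityI simp: permutes_less)

text \<open>Tensoring with the identity makes the antisymmetriser act on the first \<open>m\<close>
  of \<open>n\<close> positions, conjugation by \<open>\<theta>\<close> carries it to the positions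
  that \<open>\<theta>\<close> sends below \<open>m\<close>, and left multiplication by
  \<open>\<pi>\<close> gives the signed sum over the rearrangements of the values of
  \<open>\<pi>\<close> there.\<close>

lemma antisymmetrized_chain_in_T_ideal:
  assumes J: "T_ideal J" "antisymmetrizer m \<in> J m"
    and perms: "\<pi> permutes {..<n}" "\<theta> permutes {..<n}" and "m \<le> n"
  shows "(\<Sum>h | h permutes {..<m}.
    Poly_Mapping.single (\<pi> \<circ> inv_into UNIV \<theta> \<circ> h \<circ> \<theta>, replicate n []) (of_int (sign h))) \<in> J n"
proof -
  obtain r where n: "n = m + r" using \<open>m \<le> n\<close> le_Suc_ex by blast
  have hn: "h permutes {..<n}" if "h permutes {..<m}" for h
    using that by (rule permutes_subset) (simp add: n)
  let ?H = "{h. h permutes {..<m}}"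
  let ?X = "\<Sum>h\<in>?H. Poly_Mapping.single (h, replicate n []) (of_int (sign h)) :: twisted"
  let ?one = "Poly_Mapping.single (id, replicate r []) 1 :: twisted"
  have "basis_tensor (h, replicate m []) (id, replicate r []) = (h, replicate n [])" if "h permutes {..<m}" for h
  proof -
    have "(\<lambda>i. if i < m then h i else m + id (i - m)) = h"
      using permutes_not_in[OF that] by (auto simp: fun_eq_iff)
    then show ?thesis by (simp add: n replicate_add cong: if_cong)
  qed
  then have "outer_tensor (antisymmetrizer m) ?one = ?X"
    unfolding outer_tensor_def antisymmetrizer_def bilinear_ext_sum_left
    by (intro sum.cong refl) (simp del: basis_tensor.simps)
  moreover have "outer_tensor (antisymmetrizer m) ?one \<in> J (m + r)"
    by (rule T_ideal_outer_left[OF J]) (auto intro!: single_in_carrier simp: basis_iff permutes_id)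
  ultimately have "?X \<in> J n" by (simp add: n)
  then have "bilinear_ext basis_mult (bilinear_ext basis_mult
      (Poly_Mapping.single (\<pi> \<circ> inv_into UNIV \<theta>, replicate n []) 1) ?X)
      (Poly_Mapping.single (\<theta>, replicate n []) 1) \<in> J n"
    using perms by (intro T_ideal_mult_right T_ideal_mult_left J(1) single_in_carrier)
      (auto simp: basis_iff permutes_compose permutes_inv)
  also have "bilinear_ext basis_mult (bilinear_ext basis_mult
      (Poly_Mapping.single (\<pi> \<circ> inv_into UNIV \<theta>, replicate n []) 1) ?X)
      (Poly_Mapping.single (\<theta>, replicate n []) 1) =
    (\<Sum>h\<in>?H. Poly_Mapping.single (\<pi> \<circ> inv_into UNIV \<theta> \<circ> h \<circ> \<theta>, replicate n []) (of_int (sign h)))"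
    unfolding bilinear_ext_sum_left bilinear_ext_sum_right
    by (intro sum.cong refl) (simp add: replicate_word_mult hn perms del: basis_mult.simps)
  finally show ?thesis .
qed

text \<open>The number with base \<open>b\<close> digits \<open>\<sigma> 0\<close>, ...,
  \<open>\<sigma> (n - 1)\<close>, leading digit first. When all digits are below \<open>b\<close>,
  its order is the lexicographic order of value sequences, and as a natural number it permits
  induction on a bound.\<close>

primrec lex_code :: "nat \<Rightarrow> nat \<Rightarrow> (nat \<Rightarrow> nat) \<Rightarrow> nat" where
  "lex_code b 0 \<sigma> = 0"
| "lex_code b (Suc n) \<sigma> = lex_code b n \<sigma> * b + \<sigma> n"

lemma lex_code_cong: "(\<And>j. j < n \<Longrightarrow> \<sigma> j = \<tau> j) \<Longrightarrow> lex_code b n \<sigma> = lex_code b n \<tau>"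
  by (induction n) auto

lemma lex_code_less:
  assumes "k < n" "\<And>j. j < k \<Longrightarrow> \<tau> j = \<sigma> j" "\<tau> k < \<sigma> k" "\<And>j. j < n \<Longrightarrow> \<tau> j < b"
  shows "lex_code b n \<tau> < lex_code b n \<sigma>"
  using assms(1,4)
proof (induction n)
  case (Suc n)
  show ?case
  proof (cases "k = n")
    case True
    with assms(2,3) show ?thesis using lex_code_cong[of n \<tau> \<sigma>] by simp
  next
    case False
    with Suc have "lex_code b n \<tau> < lex_code b n \<sigma>" by simp
    then have "(lex_code b n \<tau> + 1) * b \<le> lex_code b n \<sigma> * b" by (intro mult_right_mono) auto
    moreover have "\<tau> n < b" using Suc.prems by simp
    ultimately show ?thesis by simp
  qed
qed simp

text \<open>All points below the least moved point \<open>k\<close> are fixed, so by injectivity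
  \<open>h k\<close> is none of them, and \<open>k\<close> has to move up.\<close>

lemma first_moved_point:
  fixes h :: "nat \<Rightarrow> nat"
  assumes "h permutes {..<n}" "h \<noteq> id"
  obtains k where "k < n" "\<And>j. j < k \<Longrightarrow> h j = j" "k < h k"
proof -
  define k where "k = (LEAST k. h k \<noteq> k)"
  have k: "h k \<noteq> k" unfolding k_def by (rule LeastI_ex) (use assms(2) in \<open>auto simp: fun_eq_iff\<close>)
  have below: "h j = j" if "j < k" for j using that not_less_Least k_def by blast
  have "\<not> h k < k" using below[of "h k"] k injD[OF permutes_inj[OF assms(1)], of "h k" k] by auto
  moreover have "k < n" using k permutes_not_in[OF assms(1), of k] by auto
  ultimately show thesis using k below that by (metis linorder_neqE_nat)
qed

text \<open>The value sequences of \<open>\<sigma>\<close> and \<open>\<sigma> \<circ> h\<close>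
  first differ at the least moved point of \<open>h\<close>, which moves up. Hence a condition on
  the pairs \<open>k < h k\<close> decides the comparison, in either direction.\<close>

lemma lex_code_compose:
  assumes \<sigma>: "\<sigma> permutes {..<n}" and h: "h permutes {..<n}" "h \<noteq> id"
  shows "(\<And>k. k < n \<Longrightarrow> k < h k \<Longrightarrow> \<sigma> k < \<sigma> (h k)) \<Longrightarrow> lex_code n n \<sigma> < lex_code n n (\<sigma> \<circ> h)"
    and "(\<And>k. k < n \<Longrightarrow> k < h k \<Longrightarrow> \<sigma> (h k) < \<sigma> k) \<Longrightarrow> lex_code n n (\<sigma> \<circ> h) < lex_code n n \<sigma>"
proof -
  obtain k where k: "k < n" "\<And>j. j < k \<Longrightarrow> h j = j" "k < h k"
    using first_moved_point[OF h] by blast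
  show "lex_code n n \<sigma> < lex_code n n (\<sigma> \<circ> h)" if "\<And>k. k < n \<Longrightarrow> k < h k \<Longrightarrow> \<sigma> k < \<sigma> (h k)"
    using that k by (intro lex_code_less[of k]) (simp_all add: permutes_less[OF \<sigma>])
  show "lex_code n n (\<sigma> \<circ> h) < lex_code n n \<sigma>" if "\<And>k. k < n \<Longrightarrow> k < h k \<Longrightarrow> \<sigma> (h k) < \<sigma> k"
    using that k by (intro lex_code_less[of k]) (simp_all add: permutes_less[OF \<sigma>] permutes_less[OF h(1)])
qed

lemma lex_code_inj:
  assumes "\<sigma> permutes {..<n}" "\<tau> permutes {..<n}" "lex_code n n \<sigma> = lex_code n n \<tau>"
  shows "\<sigma> = \<tau>"
proof (rule ccontr)
  assume "\<sigma> \<noteq> \<tau>"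
  define k where "k = (LEAST k. \<sigma> k \<noteq> \<tau> k)"
  have k: "\<sigma> k \<noteq> \<tau> k" unfolding k_def by (rule LeastI_ex) (use \<open>\<sigma> \<noteq> \<tau>\<close> in \<open>auto simp: fun_eq_iff\<close>)
  have below: "\<sigma> j = \<tau> j" if "j < k" for j using that not_less_Least k_def by blast
  have "k < n"
    by (metis k lessThan_iff permutes_not_in[OF assms(1)] permutes_not_in[OF assms(2)])
  then have "lex_code n n \<sigma> < lex_code n n \<tau> \<or> lex_code n n \<tau> < lex_code n n \<sigma>"
    using k below lex_code_less[of k n \<sigma> \<tau> n] lex_code_less[of k n \<tau> \<sigma> n]
    by (metis assms(1,2) linorder_neqE_nat permutes_less)
  with assms(3) show False by simp
qed

text \<open>The colour of \<open>i\<close> is the maximal length of a decreasing chain ending at \<open>i\<close>.\<close>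

lemma decreasing_chain_or_colouring:
  fixes \<sigma> :: "nat \<Rightarrow> nat"
  assumes inj: "inj \<sigma>"
  obtains (chain) S where "S \<subseteq> {..<n}" "card S = d + 1" "\<And>i j. i \<in> S \<Longrightarrow> j \<in> S \<Longrightarrow> i < j \<Longrightarrow> \<sigma> j < \<sigma> i"
    | (colouring) c where "\<And>i. i < n \<Longrightarrow> c i < d"
      "\<And>i j. i < j \<Longrightarrow> j < n \<Longrightarrow> c i = c j \<Longrightarrow> \<sigma> i < \<sigma> j"
proof -
  define dec where "dec S \<longleftrightarrow> (\<forall>i\<in>S. \<forall>j\<in>S. i < j \<longrightarrow> \<sigma> j < \<sigma> i)" for S
  show thesis
  proof (cases "\<exists>S. S \<subseteq> {..<n} \<and> card S = d + 1 \<and> dec S")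
    case True
    then show ?thesis using chain unfolding dec_def by blast
  next
    case False
    \<comment> \<open>Chains with greatest index \<open>i\<close>; the singleton is one of them, so
      the maximum below exists.\<close>
    define ending where "ending i = {S. S \<subseteq> {..i} \<and> i \<in> S \<and> dec S}" for i
    define c where "c i = Max (card ` ending i)" for i
    have fin: "finite (ending i)" for i unfolding ending_def by simp
    have single: "{i} \<in> ending i" for i by (auto simp: ending_def dec_def)
    have ge: "card S \<le> c i" if "S \<in> ending i" for S i
      unfolding c_def using fin that by (intro Max_ge) auto
    have ex: "\<exists>S\<in>ending i. card S = c i" for i
      using Max_in[of "card ` ending i"] fin single unfolding c_def by fastforce
    have le: "c i \<le> d" if "i < n" for i
    proof (rule ccontr)
      assume "\<not> c i \<le> d"
      obtain S where S: "S \<in> ending i" "card S = c i" using ex by blast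
      then obtain T where T: "T \<subseteq> S" "card T = d + 1"
        using obtain_subset_with_card_n[of "d + 1" S] \<open>\<not> c i \<le> d\<close> by auto
      have "T \<subseteq> {..<n}" using T S that by (auto simp: ending_def)
      moreover have "dec T" using S T unfolding ending_def dec_def by blast
      ultimately show False using False T by blast
    qed
    have pos: "1 \<le> c i" for i using ge[OF single] by simp
    show ?thesis
    \<comment> \<open>Maximal lengths run from 1 to \<open>d\<close>; the shift by one gives colours
      below \<open>d\<close>, which can index the basis vectors.\<close>
    proof (rule colouring[of "\<lambda>i. c i - 1"])
      show "c i - 1 < d" if "i < n" for i using le[OF that] pos[of i] by simp
      fix i j assume ij: "i < j" "j < n" "c i - 1 = c j - 1"
      then have eq: "c i = c j" using pos[of i] pos[of j] by simp
      show "\<sigma> i < \<sigma> j"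
      proof (rule ccontr)
        assume "\<not> \<sigma> i < \<sigma> j"
        with ij injD[OF inj, of i j] have less: "\<sigma> j < \<sigma> i" by (metis linorder_neqE_nat order_less_irrefl)
        \<comment> \<open>A longest chain ending at \<open>i\<close> extends by \<open>j\<close>
          because \<open>\<sigma> j < \<sigma> i\<close>; so the maximal length at \<open>j\<close>
          exceeds the one at \<open>i\<close>.\<close>
        obtain S where S: "S \<in> ending i" "card S = c i" using ex by blast
        have S': "S \<subseteq> {..i}" "i \<in> S" "dec S" using S by (auto simp: ending_def)
        have "\<sigma> j < \<sigma> k" if "k \<in> S" for k
        proof (cases "k = i")
          case False
          with that S' have "k < i" by force
          with that S' have "\<sigma> i < \<sigma> k" unfolding dec_def by blast
          with less show ?thesis by simp
        qed (simp add: less)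
        then have "insert j S \<in> ending j"
        proof -
          have "k < j" if "k \<in> S" for k using that S'(1) ij by auto
          with \<open>\<And>k. k \<in> S \<Longrightarrow> \<sigma> j < \<sigma> k\<close> have "dec (insert j S)"
            using S'(3) unfolding dec_def by (metis insert_iff less_asym)
          moreover have "insert j S \<subseteq> {..j}" using S'(1) ij by auto
          ultimately show ?thesis by (simp add: ending_def)
        qed
        from ge[OF this] have "card S + 1 \<le> c j"
          using S' ij finite_subset[OF S'(1)] by (subst (asm) card_insert_disjoint) auto
        with S eq show False by simp
      qed
    qed
  qed
qed

text \<open>Induction on a strict bound \<open>B\<close> for the codes of the support. At most one
  permutation has the top code. If it has a long decreasing chain, subtracting a multiple of the
  antisymmetrised chain trades it for smaller codes. If not, a colouring provides a matrix entry
  equal to its coefficient, which must then be zero.\<close>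

lemma kernel_in_T_ideal:
  fixes a :: "(nat \<Rightarrow> nat) \<Rightarrow> rat"
  assumes J: "T_ideal J" "antisymmetrizer (CARD('d) + 1) \<in> J (CARD('d) + 1)"
    and a: "perm_sum n a \<in> tensor_identities TYPE('d::finite) n"
  shows "perm_sum n a \<in> J n"
proof -
  note TI = T_ideal_tensor_identities[where 'd = 'd]
  let ?m = "CARD('d) + 1"
  have "perm_sum n a \<in> J n" if "\<And>\<pi>. \<pi> permutes {..<n} \<Longrightarrow> a \<pi> \<noteq> 0 \<Longrightarrow> lex_code n n \<pi> < B"
    "perm_sum n a \<in> tensor_identities TYPE('d::finite) n" for B a
    using that
  proof (induction B arbitrary: a)
    case 0
    then have "a \<pi> = 0" if "\<pi> permutes {..<n}" for \<pi> using that by blast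
    then have "perm_sum n a = 0"
      unfolding perm_sum_def by (intro sum.neutral ballI) (simp add: rat_const_hom)
    then show ?case by (simp add: T_ideal_zero J)
  next
    case (Suc B)
    show ?case
    proof (cases "\<exists>\<pi>. \<pi> permutes {..<n} \<and> a \<pi> \<noteq> 0 \<and> lex_code n n \<pi> = B")
      case False
      then have "lex_code n n \<pi> < B" if "\<pi> permutes {..<n}" "a \<pi> \<noteq> 0" for \<pi>
        using Suc.prems(1)[of \<pi>] that by (metis less_antisym)
      then show ?thesis using Suc by blast
    next
      case True
      then obtain \<pi> where \<pi>: "\<pi> permutes {..<n}" "a \<pi> \<noteq> 0" "lex_code n n \<pi> = B" by blast
      from permutes_inj[OF \<pi>(1)] show ?thesis
      proof (cases rule: decreasing_chain_or_colouring[of \<pi> n "CARD('d)"])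
        case (chain S)
        obtain \<theta> where \<theta>: "\<theta> permutes {..<n}" "\<theta> ` S = {..<?m}"
          using ex_permutes_image_lessThan[OF chain(1,2)] by blast
        have "?m \<le> n" using card_mono[OF _ chain(1)] chain(2) by simp
        let ?H = "{h. h permutes {..<?m}}"
        define conj where "conj h = inv_into UNIV \<theta> \<circ> h \<circ> \<theta>" for h
        \<comment> \<open>The antisymmetrised chain as a coefficient function. Only
          \<open>h = id\<close> contributes at \<open>\<pi>\<close>, so its coefficient there is
          1.\<close>
        define u where "u \<tau> = (\<Sum>h\<in>?H. if \<pi> \<circ> conj h = \<tau> then of_int (sign h) else 0 :: rat)" for \<tau>
        have conj: "conj h permutes {..<n}" if "h permutes {..<?m}" for h
        proof -
          have "h permutes {..<n}" using that by (rule permutes_subset) (use \<open>?m \<le> n\<close> in auto)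
          then show ?thesis unfolding conj_def by (intro permutes_compose permutes_inv \<theta>(1))
        qed
        have conj_id: "h = id" if "conj h = id" for h
        proof
          fix x
          have "inv_into UNIV \<theta> (h (\<theta> (inv_into UNIV \<theta> x))) = inv_into UNIV \<theta> x"
            using fun_cong[OF that, of "inv_into UNIV \<theta> x"] by (simp add: conj_def)
          then show "h x = id x" by (metis \<theta>(1) permutes_inverses(1) id_apply)
        qed
        \<comment> \<open>\<open>conj h\<close> permutes chain positions only, and there a larger
          position carries a smaller value: \<open>\<pi>\<close> is the lexicographically largest of
          the rearrangements.\<close>
        have lower: "lex_code n n (\<pi> \<circ> conj h) < B" if h: "h permutes {..<?m}" "h \<noteq> id" for h
        proof -
          have "\<pi> (conj h k) < \<pi> k" if "k < conj h k" for k
          proof -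
            have "\<theta> k < ?m"
            proof (rule ccontr)
              assume "\<not> \<theta> k < ?m"
              then have "conj h k = k"
                using permutes_not_in[OF h(1), of "\<theta> k"] by (simp add: conj_def permutes_inverses[OF \<theta>(1)])
              with that show False by simp
            qed
            moreover have "x \<in> S" if "\<theta> x < ?m" for x
              using that \<theta> by (metis imageE lessThan_iff permutes_inverses(2))
            moreover have "\<theta> (conj h k) = h (\<theta> k)"
              by (simp add: conj_def permutes_inverses[OF \<theta>(1)])
            ultimately have "k \<in> S" "conj h k \<in> S" using permutes_less[OF h(1)] by metis+
            then show ?thesis using chain(3) that by blast
          qed
          then have "lex_code n n (\<pi> \<circ> conj h) < lex_code n n \<pi>"
            using conj_id h by (intro lex_code_compose \<pi> conj) auto
          then show ?thesis by (simp add: \<pi>)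
        qed
        have u_eq: "perm_sum n u = (\<Sum>h\<in>?H. Poly_Mapping.single (\<pi> \<circ> inv_into UNIV \<theta> \<circ> h \<circ> \<theta>, replicate n []) (of_int (sign h)))"
          unfolding u_def[abs_def] using conj \<pi>(1)
          by (subst perm_sum_family)
            (auto simp: finite_permutations rat_const_of_int conj_def comp_assoc intro: permutes_compose)
        \<comment> \<open>Used for \<open>J\<close> itself and for the tensor identities; the latter
          keeps the remainder \<open>a'\<close> an identity.\<close>
        have u_in: "perm_sum n u \<in> K n" if "T_ideal K" "antisymmetrizer ?m \<in> K ?m" for K
          unfolding u_eq using that \<pi>(1) \<theta>(1) \<open>?m \<le> n\<close> by (rule antisymmetrized_chain_in_T_ideal)
        have u_top: "u \<pi> = 1"
        proof -
          have "\<pi> \<circ> conj h = \<pi> \<longleftrightarrow> h = id" for h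
          proof
            assume "\<pi> \<circ> conj h = \<pi>"
            then have "conj h = id"
              using permutes_inv_o(2)[OF \<pi>(1)] by (metis comp_assoc comp_id id_comp)
            then show "h = id" by (rule conj_id)
          qed (simp add: conj_def permutes_inv_o[OF \<theta>(1)])
          then show ?thesis unfolding u_def
            by (simp add: sum.delta finite_permutations permutes_id)
        qed
        define a' where "a' \<tau> = a \<tau> - a \<pi> * u \<tau>" for \<tau>
        have a': "perm_sum n a' = perm_sum n a - scale (rat_const (a \<pi>)) (perm_sum n u)"
          unfolding a'_def[abs_def] by (rule perm_sum_diff)
        have "perm_sum n a' \<in> J n"
        proof (rule Suc.IH)
          fix \<tau> assume \<tau>: "\<tau> permutes {..<n}" "a' \<tau> \<noteq> 0"
          show "lex_code n n \<tau> < B"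
          proof (cases "u \<tau> = 0")
            case True
            with \<tau> have "a \<tau> \<noteq> 0" "\<tau> \<noteq> \<pi>" using u_top by (auto simp: a'_def)
            then have "lex_code n n \<tau> < Suc B" "lex_code n n \<tau> \<noteq> B"
              using Suc.prems(1) \<tau> \<pi> lex_code_inj by auto
            then show ?thesis by simp
          next
            case False
            obtain h where h: "h permutes {..<?m}" "\<pi> \<circ> conj h = \<tau>"
            proof (rule ccontr)
              assume "\<not> thesis"
              with that have "\<pi> \<circ> conj h \<noteq> \<tau>" if "h \<in> ?H" for h using \<open>h \<in> ?H\<close> by blast
              then have "u \<tau> = 0" unfolding u_def by (intro sum.neutral) simp
              with False show False by contradiction
            qed
            have "h \<noteq> id"
            proof
              assume "h = id"
              then have "\<tau> = \<pi>" using h(2) by (simp add: conj_def permutes_inv_o[OF \<theta>(1)])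
              with \<tau>(2) show False by (simp add: a'_def u_top)
            qed
            with lower[OF h(1)] h(2) show ?thesis by simp
          qed
        next
          show "perm_sum n a' \<in> tensor_identities TYPE('d) n"
            unfolding a' by (intro T_ideal_diff T_ideal_scale TI Suc.prems u_in antisymmetrizer_in_tensor_identities)
        qed
        then have "perm_sum n a' + scale (rat_const (a \<pi>)) (perm_sum n u) \<in> J n"
          by (intro T_ideal_add T_ideal_scale u_in J)
        then show ?thesis by (simp add: a')
      next
        case (colouring c)
        obtain e :: "nat \<Rightarrow> 'd" where "bij_betw e {0..<CARD('d)} UNIV"
          using ex_bij_betw_nat_finite[of "UNIV :: 'd set"] by auto
        then have e: "e x = e y \<longleftrightarrow> x = y" if "x < CARD('d)" "y < CARD('d)" for x y
          using that by (auto simp: bij_betw_def inj_on_def)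
        \<comment> \<open>Position \<open>k\<close> of \<open>R\<close> carries the basis vector of
          its colour, and \<open>L\<close> is \<open>R\<close> moved along by \<open>\<pi>\<close>.
          A permutation matches the two exactly when it is \<open>\<pi> \<circ> h\<close> with
          \<open>h\<close> preserving colours. As \<open>\<pi>\<close> increases on each colour
          class, such a permutation other than \<open>\<pi>\<close> has a larger code and lies
          outside the support of \<open>a\<close>.\<close>
        define L where "L = map (\<lambda>k. e (c (inv_into UNIV \<pi> k))) [0..<n]"
        define R where "R = map (\<lambda>k. e (c k)) [0..<n]"
        have "a \<tau> * perm_matches n \<tau> L R = (if \<tau> = \<pi> then a \<pi> else 0)" if \<tau>: "\<tau> permutes {..<n}" for \<tau>
        proof (cases "\<tau> = \<pi>")
          case True
          then show ?thesis
            by (simp add: perm_matches_def L_def R_def permutes_less[OF \<pi>(1)] permutes_inverses[OF \<pi>(1)])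
        next
          case False
          define h where "h = inv_into UNIV \<pi> \<circ> \<tau>"
          have h: "h permutes {..<n}" unfolding h_def by (intro permutes_compose permutes_inv \<tau> \<pi>(1))
          have \<tau>_eq: "\<tau> = \<pi> \<circ> h" by (simp add: h_def fun_eq_iff permutes_inverses[OF \<pi>(1)])
          have "a \<tau> = 0" if match: "\<forall>k<n. L ! \<tau> k = R ! k"
          proof (rule ccontr)
            assume "a \<tau> \<noteq> 0"
            have "c (h k) = c k" if "k < n" for k
            proof -
              have "L ! \<tau> k = R ! k" using match that by blast
              then have "e (c (h k)) = e (c k)"
                using that permutes_less[OF \<tau> that] by (simp add: L_def R_def h_def)
              then show ?thesis using e colouring(1) permutes_less[OF h] that by blast
            qed
            then have "\<pi> k < \<pi> (h k)" if "k < n" "k < h k" for k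
              using colouring(2)[of k "h k"] that permutes_less[OF h] by simp
            moreover have "h \<noteq> id" using False \<tau>_eq by auto
            ultimately have "lex_code n n \<pi> < lex_code n n \<tau>"
              unfolding \<tau>_eq by (intro lex_code_compose \<pi> h)
            with Suc.prems(1)[OF \<tau> \<open>a \<tau> \<noteq> 0\<close>] \<pi> show False by simp
          qed
          with False show ?thesis by (auto simp: perm_matches_def)
        qed
        then have "(\<Sum>\<tau> | \<tau> permutes {..<n}. a \<tau> * perm_matches n \<tau> L R) = a \<pi>"
          using \<pi>(1) by (simp add: finite_permutations)
        \<comment> \<open>All words are empty, so every assignment gives this entry; the zero
          assignment is taken.\<close>
        moreover have "eval_twisted n (\<lambda>_. 0) (perm_sum n a) L R = 0"
          using Suc.prems(2) by (rule tensor_identitiesD) (simp_all add: L_def R_def)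
        ultimately have "a \<pi> = 0" by (simp add: eval_perm_sum L_def)
        with \<pi> show ?thesis by simp
      qed
    qed
  qed
  moreover have "\<exists>B. \<forall>\<pi>. \<pi> permutes {..<n} \<longrightarrow> lex_code n n \<pi> < B"
    using finite_nat_set_iff_bounded[of "lex_code n n ` {\<pi>. \<pi> permutes {..<n}}"]
    by (auto simp: finite_permutations)
  ultimately show ?thesis using a by blast
qed

section \<open>Multilinear elements as iterated partial traces\<close>

lemma bilinear_ext_scale_left: "bilinear_ext h (scale c F) G = scale c (bilinear_ext h F G)"
proof -
  have "Poly_Mapping.keys F \<subseteq> UNIV" by simp
  then show ?thesis
  proof (induction rule: poly_mapping_single_induct)
    case (single b x)
    have "Poly_Mapping.keys G \<subseteq> UNIV" by simp
    then show ?case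
      by (induction rule: poly_mapping_single_induct) (simp_all add: bilinear_ext_add_right scale_add mult.assoc)
  qed (simp_all add: bilinear_ext_add_left scale_add)
qed

lemma bilinear_ext_diff_left: "bilinear_ext h (F - F') G = bilinear_ext h F G - bilinear_ext h F' G"
  by (metis add_diff_cancel diff_add_cancel bilinear_ext_add_left)

lemma partial_trace_diff: "partial_trace (F - G) = partial_trace F - partial_trace G"
  by (simp add: partial_trace_def linear_ext_diff)

lemma partial_trace_scale: "partial_trace (scale c F) = scale c (partial_trace F)"
  by (simp add: partial_trace_def linear_ext_scale)

lemma partial_trace_single: "partial_trace (Poly_Mapping.single b c) = scale c (basis_partial_trace b)"
  by (simp add: partial_trace_def linear_ext_single)

lemma partial_trace_zero [simp]: "partial_trace 0 = 0"
  by (simp add: partial_trace_def)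

lemma partial_trace_add: "partial_trace (F + G) = partial_trace F + partial_trace G"
  by (simp add: partial_trace_def linear_ext_add)

definition words :: "monomial list \<Rightarrow> twisted" where
  "words Ns = Poly_Mapping.single (id, Ns) 1"

lemma single_mult_words:
  "length Ms = length Ns \<Longrightarrow>
    bilinear_ext basis_mult (Poly_Mapping.single (\<sigma>, Ms) c) (words Ns) = Poly_Mapping.single (\<sigma>, map2 (@) Ms Ns) c"
  by (auto simp: words_def intro!: arg_cong2[where f = Poly_Mapping.single] nth_equalityI)

text \<open>Right multiplication appends words at their positions, whereas contraction prepends the
  last word at position \<open>i\<close>. The two commute, so the partial trace is right linear over
  words with 1 in the last place.\<close>

lemma partial_trace_mult_right:
  assumes F: "F \<in> carrier (twisted_algebra (Suc n))" and Ns: "length Ns = n"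
  shows "partial_trace (bilinear_ext basis_mult F (words (Ns @ [[]]))) =
    bilinear_ext basis_mult (partial_trace F) (words Ns)"
  using F unfolding carrier_twisted
proof (induction rule: poly_mapping_single_induct)
  case (single b c)
  then show ?case
  proof (cases rule: basis_Suc_cases)
    case (fixed \<sigma> Ms M)
    with Ns show ?thesis
      by (simp add: partial_trace_single single_mult_words basis_partial_trace_fixed
          del: basis_mult.simps basis_partial_trace.simps)
  next
    case (moved \<sigma> Ms M i)
    have "(map2 (@) Ms Ns)[i := M @ map2 (@) Ms Ns ! i] = map2 (@) (Ms[i := M @ Ms ! i]) Ns"
      using moved Ns by (intro nth_equalityI) (auto simp: nth_list_update)
    with moved Ns show ?thesis
      by (simp add: partial_trace_single single_mult_words basis_partial_trace_moved
          del: basis_mult.simps basis_partial_trace.simps)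
  qed
qed (simp_all add: bilinear_ext_add_left partial_trace_add)

lemma funpow_partial_trace_closed:
  "F \<in> carrier (twisted_algebra (n + N)) \<Longrightarrow> (partial_trace ^^ N) F \<in> carrier (twisted_algebra n)"
  by (induction N arbitrary: F) (simp_all add: partial_trace_closed funpow_Suc_right del: funpow.simps(2))

lemma funpow_partial_trace_in_T_ideal:
  "T_ideal J \<Longrightarrow> F \<in> J (n + N) \<Longrightarrow> (partial_trace ^^ N) F \<in> J n"
  by (induction N arbitrary: F) (simp_all add: T_ideal_partial_trace funpow_Suc_right del: funpow.simps(2))

lemma funpow_partial_trace_mult_right:
  assumes "F \<in> carrier (twisted_algebra (n + N))" "length Ns = n"
  shows "(partial_trace ^^ N) (bilinear_ext basis_mult F (words (Ns @ replicate N []))) =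
    bilinear_ext basis_mult ((partial_trace ^^ N) F) (words Ns)"
  using assms(1)
proof (induction N arbitrary: F)
  case (Suc N)
  have "Ns @ replicate (Suc N) [] = (Ns @ replicate N []) @ [[]]"
    by (simp add: replicate_append_same)
  then show ?case
    using Suc assms(2) partial_trace_mult_right[of F "n + N" "Ns @ replicate N []"]
    by (simp add: funpow_Suc_right partial_trace_closed del: funpow.simps(2) replicate_Suc)
qed simp

text \<open>Traces are kept as a list of representative words, so that a letter inside a trace can
  be singled out and letters can be substituted.\<close>

definition trace_term :: "monomial list \<Rightarrow> (nat \<Rightarrow> nat) \<Rightarrow> monomial list \<Rightarrow> twisted" where
  "trace_term ts \<sigma> Ms = Poly_Mapping.single (\<sigma>, Ms) (prod_list (map tr_var ts))"

text \<open>The normal form of a term: \<open>n\<close> open positions with empty words, and one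
  position for each letter of \<open>l\<close>, traced out. How the letters are arranged in words
  and traces is encoded in \<open>\<pi>\<close> alone.\<close>

definition contraction :: "nat \<Rightarrow> nat list \<Rightarrow> (nat \<Rightarrow> nat) \<Rightarrow> twisted" where
  "contraction n l \<pi> = (partial_trace ^^ length l)
     (Poly_Mapping.single (\<pi>, replicate n [] @ map (\<lambda>x. [x]) l) 1)"

lemma contraction_basis:
  "\<pi> permutes {..<n + length l} \<Longrightarrow> (\<pi>, replicate n [] @ map (\<lambda>x. [x]) l) \<in> basis (n + length l)"
  by (simp add: basis_iff)

lemma contraction_closed:
  "\<pi> permutes {..<n + length l} \<Longrightarrow> contraction n l \<pi> \<in> carrier (twisted_algebra n)"
  unfolding contraction_def by (intro funpow_partial_trace_closed single_in_carrier contraction_basis)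

text \<open>By right linearity the letter \<open>y\<close> can be multiplied in before the other
  traces are taken. It then sits in the first position after the \<open>n\<close> open ones, hence
  in front of \<open>l\<close>.\<close>

lemma contraction_Cons:
  assumes "\<pi> permutes {..<Suc n + length l}"
  shows "partial_trace (bilinear_ext basis_mult (contraction (Suc n) l \<pi>)
      (words (replicate n [] @ [[y]]))) = contraction n (y # l) \<pi>"
proof -
  have *: "map2 (@) (replicate (Suc n) [] @ map (\<lambda>x. [x]) l) ((replicate n [] @ [[y]]) @ replicate (length l) []) =
      replicate n [] @ map (\<lambda>x. [x]) (y # l)"
  proof -
    have "map2 (@) (replicate n []) (replicate n []) = (replicate n [] :: monomial list)" by (induction n) auto
    moreover have "map2 (@) (map (\<lambda>x. [x]) l) (replicate (length l) []) = map (\<lambda>x. [x]) l" by (induction l) auto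
    moreover have "replicate (Suc n) [] = replicate n [] @ [[] :: monomial]" by (simp add: replicate_append_same)
    ultimately show ?thesis by (simp only: append_assoc) simp
  qed
  have "bilinear_ext basis_mult (contraction (Suc n) l \<pi>) (words (replicate n [] @ [[y]])) =
    (partial_trace ^^ length l) (bilinear_ext basis_mult
      (Poly_Mapping.single (\<pi>, replicate (Suc n) [] @ map (\<lambda>x. [x]) l) 1)
      (words ((replicate n [] @ [[y]]) @ replicate (length l) [])))"
    unfolding contraction_def
    by (rule funpow_partial_trace_mult_right[symmetric, OF single_in_carrier[OF contraction_basis[OF assms]]]) simp
  also have "\<dots> = (partial_trace ^^ length l)
      (Poly_Mapping.single (\<pi>, replicate n [] @ map (\<lambda>x. [x]) (y # l)) 1)"
    by (subst single_mult_words) (simp_all only: * length_append length_replicate length_map list.size mult_1)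
  finally show ?thesis by (simp add: contraction_def)
qed

text \<open>Right multiplication by \<open>y\<close> in the last position completes the last word of
  the term and adds a letter to its contraction; the partial trace then closes that position in
  both.\<close>

lemma extraction_step:
  assumes J: "T_ideal J" and "\<sigma> permutes {..<Suc n}" "length Ns = n" "\<pi> permutes {..<Suc n + length l}"
    and mem: "trace_term ts \<sigma> (Ns @ [M]) - scale c (contraction (Suc n) l \<pi>) \<in> J (Suc n)"
  shows "partial_trace (trace_term ts \<sigma> (Ns @ [M @ [y]])) - scale c (contraction n (y # l) \<pi>) \<in> J n"
proof -
  let ?R = "words (replicate n [] @ [[y]])"
  have R: "?R \<in> carrier (twisted_algebra (Suc n))"
    unfolding words_def by (rule single_in_carrier) (simp add: basis_iff permutes_id)
  have "map2 (@) Ns (replicate n []) = Ns" using assms(3) by (intro nth_equalityI) auto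
  then have "bilinear_ext basis_mult (trace_term ts \<sigma> (Ns @ [M])) ?R = trace_term ts \<sigma> (Ns @ [M @ [y]])"
    unfolding trace_term_def using assms(3) by (simp add: single_mult_words del: basis_mult.simps)
  with T_ideal_partial_trace[OF J T_ideal_mult_right[OF J mem R]]
  show ?thesis
    by (simp add: bilinear_ext_diff_left bilinear_ext_scale_left partial_trace_diff partial_trace_scale
        contraction_Cons[OF assms(4)])
qed

lemma tr_var_cyclic: "tr_var (M @ N) = tr_var (N @ M)"
proof -
  have "cyc_equiv (M @ N) (N @ M)"
    unfolding cyc_equiv_def by (intro exI[of _ "length M"]) (simp add: rotate_append)
  then have "abs_cyclic_word (M @ N) = abs_cyclic_word (N @ M)" by (simp only: cyclic_word.abs_eq_iff)
  then show ?thesis by (simp add: tr_var_def)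
qed

lemma outer_tensor_twisted0: "outer_tensor (twisted0 c) F = scale c F"
proof -
  have "Poly_Mapping.keys F \<subseteq> UNIV" by simp
  then show ?thesis
  proof (induction rule: poly_mapping_single_induct)
    case (single b x)
    show ?case by (cases b) (simp add: outer_tensor_def twisted0_def)
  qed (simp_all add: outer_tensor_def bilinear_ext_add_right scale_add)
qed

text \<open>The outer product with an element of the trace ring is scaling, so every multiple of
  \<open>tr_var [] - of_nat d\<close> lies in \<open>J\<close>. Powers follow by telescoping: with
  \<open>t = tr_var []\<close>, \<open>t * (t ^ k - d ^ k) + (t - d) * d ^ k = t ^ (k + 1) - d ^ (k
  + 1)\<close>.\<close>

lemma tr_one_power:
  assumes J: "T_ideal J" "twisted0 (tr_var [] - of_nat d) \<in> J 0" and F: "F \<in> carrier (twisted_algebra n)"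
  shows "scale (tr_var [] ^ k) F - scale (of_nat d ^ k) F \<in> J n"
proof (induction k)
  case 0
  show ?case using J by (simp add: T_ideal_zero)
next
  case (Suc k)
  have "outer_tensor (twisted0 (tr_var [] - of_nat d)) (scale (of_nat d ^ k) F) \<in> J (0 + n)"
    by (intro T_ideal_outer_left J scale_closed F)
  then have "scale ((tr_var [] - of_nat d) * of_nat d ^ k) F \<in> J n"
    by (simp add: outer_tensor_twisted0)
  from T_ideal_add[OF J(1) T_ideal_scale[OF J(1) Suc, of "tr_var []"] this]
  have "scale (tr_var []) (scale (tr_var [] ^ k) F - scale (of_nat d ^ k) F) +
    scale ((tr_var [] - of_nat d) * of_nat d ^ k) F \<in> J n" .
  also have "scale (tr_var []) (scale (tr_var [] ^ k) F - scale (of_nat d ^ k) F) +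
    scale ((tr_var [] - of_nat d) * of_nat d ^ k) F = scale (tr_var [] ^ Suc k) F - scale (of_nat d ^ Suc k) F"
    by (rule poly_mapping_eqI) (simp add: lookup_add lookup_minus algebra_simps)
  finally show ?case .
qed

text \<open>
  A letter of a word \<open>M x M'\<close> in a tensor position is moved to a new last position by writing the
  term as the partial trace of \<open>\<sigma>(n,i) \<circ> \<dots> M' \<dots> \<otimes> M x\<close>; a trace \<open>tr(M x M')\<close> is the partial trace of
  the new tensor factor \<open>M' M x\<close>. Keeping the substitution \<open>s\<close> arbitrary lets the same permutation
  serve for the multilinear term and for all its specialisations.
\<close>

lemma extraction:
  fixes l :: "nat list"
  assumes "\<sigma> permutes {..<n}" "length Ms = n" "mset (concat ts) + mset (concat Ms) = mset l"
  shows "\<exists>\<pi> c. \<pi> permutes {..<n + length l} \<and>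
    (\<forall>J s. T_ideal J \<longrightarrow> twisted0 (tr_var [] - of_nat d) \<in> J 0 \<longrightarrow>
      trace_term (map (map s) ts) \<sigma> (map (map s) Ms) - scale (rat_const c) (contraction n (map s l) \<pi>) \<in> J n)"
  using assms
proof (induction l arbitrary: n ts \<sigma> Ms)
  case Nil
  then have "set (concat ts) = {}" "set (concat Ms) = {}" by auto
  then have ts: "ts = replicate (length ts) []" and Ms: "Ms = replicate n []"
    using Nil.prems(2) by (auto simp: replicate_length_same[symmetric] intro!: replicate_eqI)
  have F: "(Poly_Mapping.single (\<sigma>, replicate n []) 1 :: twisted) \<in> carrier (twisted_algebra n)"
    using Nil.prems(1) by (intro single_in_carrier) (simp add: basis_iff)
  have pw: "rat_const (of_nat d ^ k) = of_nat d ^ k" for k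
    using rat_const_of_nat[of "d ^ k"] by simp
  show ?case
  proof (intro exI conjI allI impI)
    fix J and s :: "nat \<Rightarrow> nat"
    assume "T_ideal J" "twisted0 (tr_var [] - of_nat d) \<in> J 0"
    \<comment> \<open>No letters remain, so each trace in \<open>ts\<close> is tr(1); this gives the
      constant \<open>d ^ length ts\<close> with the permutation \<open>\<sigma>\<close>
      itself.\<close>
    from tr_one_power[OF this F, of "length ts"]
    show "trace_term (map (map s) ts) \<sigma> (map (map s) Ms) -
        scale (rat_const (of_nat d ^ length ts)) (contraction n (map s []) \<sigma>) \<in> J n"
      by (subst ts, subst Ms) (simp add: trace_term_def contraction_def pw map_replicate_const)
  qed (use Nil.prems in simp)
next
  case (Cons x l)
  have "x \<in># mset (concat ts) + mset (concat Ms)" using Cons.prems by simp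
  then consider (trace) "x \<in> set (concat ts)" | (word) "x \<in> set (concat Ms)" by auto
  then show ?case
  proof cases
    case trace
    then obtain u where "u \<in> set ts" "x \<in> set u" by auto
    then obtain ts1 ts2 M M' where ts: "ts = ts1 @ (M @ x # M') # ts2" by (metis split_list)
    have "\<sigma> permutes {..<Suc n}" using Cons.prems(1) by (rule permutes_subset) auto
    moreover have "mset (concat (ts1 @ ts2)) + mset (concat (Ms @ [M' @ M])) = mset l"
      using Cons.prems(3) by (simp add: ts ac_simps)
    ultimately obtain \<pi> c where \<pi>: "\<pi> permutes {..<Suc n + length l}"
      and IH: "\<And>J s. T_ideal J \<Longrightarrow> twisted0 (tr_var [] - of_nat d) \<in> J 0 \<Longrightarrow>
        trace_term (map (map s) (ts1 @ ts2)) \<sigma> (map (map s) (Ms @ [M' @ M])) -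
        scale (rat_const c) (contraction (Suc n) (map s l) \<pi>) \<in> J (Suc n)"
      using Cons.IH[of \<sigma> "Suc n" "Ms @ [M' @ M]" "ts1 @ ts2"] Cons.prems(2) by auto
    show ?thesis
    proof (intro exI conjI allI impI)
      show "\<pi> permutes {..<n + length (x # l)}" using \<pi> by simp
      fix J and s :: "nat \<Rightarrow> nat"
      assume J: "T_ideal J" "twisted0 (tr_var [] - of_nat d) \<in> J 0"
      have "partial_trace (trace_term (map (map s) (ts1 @ ts2)) \<sigma> (map (map s) Ms @ [map s (M' @ M) @ [s x]])) -
          scale (rat_const c) (contraction n (s x # map s l) \<pi>) \<in> J n"
        using IH[OF J, of s] \<pi> Cons.prems \<open>\<sigma> permutes {..<Suc n}\<close> by (intro extraction_step J) auto
      moreover have "partial_trace (trace_term (map (map s) (ts1 @ ts2)) \<sigma> (map (map s) Ms @ [map s (M' @ M) @ [s x]])) =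
          trace_term (map (map s) ts) \<sigma> (map (map s) Ms)"
        using tr_var_cyclic[of "map s M'" "map s M @ [s x]"] Cons.prems(1,2)
        by (simp add: trace_term_def partial_trace_single basis_partial_trace_fixed ts mult_ac
            del: basis_partial_trace.simps)
      ultimately show "trace_term (map (map s) ts) \<sigma> (map (map s) Ms) -
          scale (rat_const c) (contraction n (map s (x # l)) \<pi>) \<in> J n" by simp
    qed
  next
    case word
    then obtain u where "u \<in> set Ms" "x \<in> set u" by auto
    then obtain Ms1 Ms2 M M' where Ms: "Ms = Ms1 @ (M @ x # M') # Ms2" by (metis split_list)
    define i where "i = length Ms1"
    have i: "i < n" using Cons.prems(2) by (simp add: i_def Ms)
    define \<tau> where "\<tau> = \<sigma> \<circ> Transposition.transpose n i"
    have "\<sigma> permutes {..<Suc n}" using Cons.prems(1) by (rule permutes_subset) auto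
    moreover have "Transposition.transpose n i permutes {..<Suc n}"
      using i by (intro permutes_swap_id) auto
    ultimately have \<tau>: "\<tau> permutes {..<Suc n}" unfolding \<tau>_def by (intro permutes_compose)
    have \<tau>i: "\<tau> i = n" using Cons.prems(1) by (simp add: \<tau>_def permutes_not_in)
    have \<sigma>: "\<tau> \<circ> Transposition.transpose n i = \<sigma>" by (simp add: \<tau>_def fun_eq_iff)
    have "mset (concat ts) + mset (concat ((Ms1 @ M' # Ms2) @ [M])) = mset l"
      using Cons.prems(3) by (simp add: Ms ac_simps)
    then obtain \<pi> c where \<pi>: "\<pi> permutes {..<Suc n + length l}"
      and IH: "\<And>J s. T_ideal J \<Longrightarrow> twisted0 (tr_var [] - of_nat d) \<in> J 0 \<Longrightarrow>
        trace_term (map (map s) ts) \<tau> (map (map s) ((Ms1 @ M' # Ms2) @ [M])) -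
        scale (rat_const c) (contraction (Suc n) (map s l) \<pi>) \<in> J (Suc n)"
      using Cons.IH[OF \<tau>, of "(Ms1 @ M' # Ms2) @ [M]" ts] Cons.prems(2) by (auto simp: Ms)
    show ?thesis
    proof (intro exI conjI allI impI)
      show "\<pi> permutes {..<n + length (x # l)}" using \<pi> by simp
      fix J and s :: "nat \<Rightarrow> nat"
      assume J: "T_ideal J" "twisted0 (tr_var [] - of_nat d) \<in> J 0"
      let ?Ns = "map (map s) (Ms1 @ M' # Ms2)"
      have len: "length ?Ns = n" using Cons.prems(2) by (simp add: Ms)
      have "partial_trace (trace_term (map (map s) ts) \<tau> (?Ns @ [map s M @ [s x]])) -
          scale (rat_const c) (contraction n (s x # map s l) \<pi>) \<in> J n"
        using IH[OF J, of s] \<pi> len \<tau> by (intro extraction_step J) auto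
      moreover have "?Ns[i := (map s M @ [s x]) @ ?Ns ! i] = map (map s) Ms"
        by (simp add: Ms i_def nth_append list_update_append)
      then have "partial_trace (trace_term (map (map s) ts) \<tau> (?Ns @ [map s M @ [s x]])) =
          trace_term (map (map s) ts) \<sigma> (map (map s) Ms)"
        unfolding trace_term_def partial_trace_single
        by (subst basis_partial_trace_moved[OF \<tau> len i \<tau>i]) (simp add: \<sigma>)
      ultimately show "trace_term (map (map s) ts) \<sigma> (map (map s) Ms) -
          scale (rat_const c) (contraction n (map s (x # l)) \<pi>) \<in> J n" by simp
    qed
  qed
qed

subsection \<open>Evaluation of contractions\<close>

lemma sum_lists_Suc:
  fixes f :: "'d::finite list \<Rightarrow> 'b::comm_monoid_add"
  shows "(\<Sum>K | length K = Suc N. f K) = (\<Sum>K | length K = N. \<Sum>p\<in>UNIV. f (K @ [p]))"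
  unfolding sum.cartesian_product
  by (rule sum.reindex_bij_witness[of _ "\<lambda>(K, p). K @ [p]" "\<lambda>K. (butlast K, last K)"])
    (auto simp: length_Suc_conv_rev)

lemma eval_funpow_partial_trace:
  fixes A :: "nat \<Rightarrow> rat^'d^'d::finite"
  assumes "F \<in> carrier (twisted_algebra (n + N))" "length I = n" "length J = n"
  shows "eval_twisted n A ((partial_trace ^^ N) F) I J =
    (\<Sum>K | length K = N. eval_twisted (n + N) A F (I @ K) (J @ K))"
  using assms(1)
proof (induction N arbitrary: F)
  case (Suc N)
  have "eval_twisted n A ((partial_trace ^^ Suc N) F) I J =
      (\<Sum>K | length K = N. eval_twisted (n + N) A (partial_trace F) (I @ K) (J @ K))"
    using Suc partial_trace_closed[of F "n + N"] by (simp add: funpow_Suc_right del: funpow.simps(2))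
  also have "\<dots> = (\<Sum>K | length K = N. \<Sum>p\<in>UNIV. eval_twisted (Suc (n + N)) A F (I @ K @ [p]) (J @ K @ [p]))"
    using Suc assms by (intro sum.cong refl) (simp add: eval_partial_trace)
  finally show ?case by (simp add: sum_lists_Suc)
qed simp

text \<open>\<open>K\<close> runs over the common row and column indices of the traced positions;
  the open positions carry identity matrices and give the matching condition.\<close>

lemma eval_contraction:
  fixes A :: "nat \<Rightarrow> rat^'d^'d::finite"
  assumes \<pi>: "\<pi> permutes {..<n + N}" and "length I = n" "length J = n"
  shows "eval_twisted n A (contraction n [0..<N] \<pi>) I J =
    (\<Sum>K | length K = N. (if \<forall>k<n. (I @ K) ! \<pi> k = J ! k then 1 else 0) *
      (\<Prod>k<N. A k $ ((I @ K) ! \<pi> (n + k)) $ (K ! k)))"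
proof -
  let ?b = "(\<pi>, replicate n [] @ map (\<lambda>x. [x]) [0..<N])"
  have b: "?b \<in> basis (n + N)" using contraction_basis[of \<pi> n "[0..<N]"] \<pi> by simp
  have "eval_basis (n + N) A ?b (I @ K) (J @ K) = (if \<forall>k<n. (I @ K) ! \<pi> k = J ! k then 1 else 0) *
      (\<Prod>k<N. A k $ ((I @ K) ! \<pi> (n + k)) $ (K ! k))" for K
  proof -
    have "(\<Prod>k<n. eval_mono A (snd ?b ! k) $ ((I @ K) ! fst ?b k) $ ((J @ K) ! k)) =
        (\<Prod>k<n. if (I @ K) ! \<pi> k = J ! k then 1 else 0)"
      using assms by (intro prod.cong) (auto simp: nth_append eval_mono_def mat_def)
    also have "\<dots> = (if \<forall>k<n. (I @ K) ! \<pi> k = J ! k then 1 else 0)"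
      by (auto intro!: prod.neutral)
    finally have "(\<Prod>k<n. eval_mono A (snd ?b ! k) $ ((I @ K) ! fst ?b k) $ ((J @ K) ! k)) =
      (if \<forall>k<n. (I @ K) ! \<pi> k = J ! k then 1 else 0)" .
    moreover have "(\<Prod>k<N. eval_mono A (snd ?b ! (n + k)) $ ((I @ K) ! fst ?b (n + k)) $ ((J @ K) ! (n + k))) =
        (\<Prod>k<N. A k $ ((I @ K) ! \<pi> (n + k)) $ (K ! k))"
      using assms by (intro prod.cong) (auto simp: nth_append eval_mono_def)
    ultimately show ?thesis unfolding eval_basis_def prod_lessThan_add by (simp only:)
  qed
  moreover have "Poly_Mapping.single ?b 1 \<in> carrier (twisted_algebra (n + N))"
    by (rule single_in_carrier[OF b])
  ultimately show ?thesis unfolding contraction_def length_upt using assms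
    by (subst eval_funpow_partial_trace) (auto intro!: sum.cong simp: eval_twisted_single[OF b])
qed

text \<open>Letter \<open>k\<close> is the matrix unit with row \<open>Q ! k\<close> and column
  \<open>P ! k\<close>. The columns force \<open>K = P\<close> and the rows impose the remaining
  matching conditions, so every entry of the operator of \<open>\<pi>\<close> on
  \<open>n + N\<close> factors is a value of the contraction.\<close>

lemma eval_contraction_matrix_units:
  fixes P Q :: "'d::finite list"
  assumes \<pi>: "\<pi> permutes {..<n + N}" and "length I = n" "length J = n" "length P = N" "length Q = N"
  shows "eval_twisted n (\<lambda>k. \<chi> p q. if p = Q ! k \<and> q = P ! k then 1 else 0) (contraction n [0..<N] \<pi>) I J =
    perm_matches (n + N) \<pi> (I @ P) (J @ Q)"
proof -
  have split: "(\<forall>k<n + N. p k) \<longleftrightarrow> (\<forall>k<n. p k) \<and> (\<forall>k<N. p (n + k))" for p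
    by (metis add_less_cancel_left le_add_diff_inverse linorder_not_less trans_less_add1)
  have *: "(if \<forall>k<n. (I @ K) ! \<pi> k = J ! k then 1 else 0) *
      (\<Prod>k<N. (\<chi> p q. if p = Q ! k \<and> q = P ! k then 1 else 0) $ ((I @ K) ! \<pi> (n + k)) $ (K ! k)) =
    (if K = P then perm_matches (n + N) \<pi> (I @ P) (J @ Q) else 0)" (is "?l * ?r = _") if len: "length K = N" for K
  proof (cases "K = P")
    case True
    have "?r = (if \<forall>k<N. (I @ P) ! \<pi> (n + k) = Q ! k then 1 else 0)"
      using True by (auto intro!: prod.neutral)
    then show ?thesis using True assms by (simp add: perm_matches_def split nth_append)
  next
    case False
    then obtain k where "k < N" "K ! k \<noteq> P ! k" using nth_equalityI[of K P] len assms by auto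
    then have "?r = 0" by auto
    with False show ?thesis by simp
  qed
  have "eval_twisted n (\<lambda>k. \<chi> p q. if p = Q ! k \<and> q = P ! k then 1 else 0) (contraction n [0..<N] \<pi>) I J =
      (\<Sum>K | length K = N. if K = P then perm_matches (n + N) \<pi> (I @ P) (J @ Q) else 0)"
    unfolding eval_contraction[OF assms(1-3)] by (intro sum.cong refl) (use * in blast)
  then show ?thesis using assms finite_lists_length_eq[of "UNIV :: 'd set" N] by simp
qed

text \<open>Each letter occurs in exactly one factor, linearly; \<open>f\<close> records the summand
  chosen for each letter.\<close>

lemma eval_contraction_multilinear:
  fixes C :: "nat \<Rightarrow> rat^'d^'d::finite"
  assumes "\<pi> permutes {..<n + N}" and "length I = n" "length J = n" "finite H"
  shows "eval_twisted n (\<lambda>k. \<chi> p q. \<Sum>h\<in>H. w k h * C h $ p $ q) (contraction n [0..<N] \<pi>) I J =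
    (\<Sum>f\<in>{..<N} \<rightarrow>\<^sub>E H. (\<Prod>k<N. w k (f k)) * eval_twisted n (\<lambda>k. C (f k)) (contraction n [0..<N] \<pi>) I J)"
proof -
  define m where "m K = (if \<forall>k<n. (I @ K) ! \<pi> k = J ! k then 1 else 0 :: rat)" for K
  have "m K * (\<Prod>k<N. (\<chi> p q. \<Sum>h\<in>H. w k h * C h $ p $ q) $ ((I @ K) ! \<pi> (n + k)) $ (K ! k)) =
    (\<Sum>f\<in>{..<N} \<rightarrow>\<^sub>E H. (\<Prod>k<N. w k (f k)) * (m K * (\<Prod>k<N. C (f k) $ ((I @ K) ! \<pi> (n + k)) $ (K ! k))))" for K
    using assms(4) by (simp add: prod_sum_PiE sum_distrib_left prod.distrib mult_ac)
  then show ?thesis unfolding eval_contraction[OF assms(1-3)] m_def[symmetric] sum_distrib_left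
    by (simp add: sum.swap[of _ "{..<N} \<rightarrow>\<^sub>E H"])
qed

section \<open>Homogeneous components and polarisation\<close>

text \<open>Vanishing against all powers is vanishing against all polynomials, and the polynomial
  whose roots are the values of \<open>v\<close> other than \<open>x\<close> isolates
  \<open>x\<close>.\<close>

lemma power_sums_vanish:
  fixes w v :: "'i \<Rightarrow> rat"
  assumes S: "finite S" and vanish: "\<And>k. (\<Sum>j\<in>S. w j * v j ^ k) = 0"
  shows "(\<Sum>j | j \<in> S \<and> v j = x. w j) = 0"
proof -
  have poly: "(\<Sum>j\<in>S. w j * poly p (v j)) = 0" for p
  proof -
    have "(\<Sum>j\<in>S. w j * poly p (v j)) = (\<Sum>i\<le>degree p. coeff p i * (\<Sum>j\<in>S. w j * v j ^ i))"
      unfolding poly_altdef sum_distrib_left by (subst sum.swap) (simp add: mult_ac)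
    then show ?thesis by (simp add: vanish)
  qed
  define p where "p = (\<Prod>\<mu>\<in>v ` S - {x}. [:- \<mu>, 1:])"
  have p: "poly p y = (\<Prod>\<mu>\<in>v ` S - {x}. y - \<mu>)" for y by (simp add: p_def poly_prod)
  have "poly p x \<noteq> 0" using S by (auto simp: p)
  moreover have "poly p (v j) = 0" if "j \<in> S" "v j \<noteq> x" for j
    unfolding p by (rule prod_zero) (use S that in auto)
  then have "(\<Sum>j\<in>S. w j * poly p (v j)) = (\<Sum>j | j \<in> S \<and> v j = x. w j * poly p x)"
    using S by (intro sum.mono_neutral_cong_right) auto
  ultimately show ?thesis using poly[of p] by (simp flip: sum_distrib_right)
qed

text \<open>
  Evaluating the variable \<open>x\<^sub>i\<close> at powers of the \<open>i\<close>-th prime separates monomials by unique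
  factorisation.
\<close>

lemma monomials_independent:
  fixes w :: "'i \<Rightarrow> rat" and M :: "'i \<Rightarrow> nat multiset"
  assumes S: "finite S" and vanish: "\<And>z. (\<Sum>j\<in>S. w j * prod_mset (image_mset z (M j))) = 0"
  shows "(\<Sum>j | j \<in> S \<and> M j = \<mu>. w j) = 0"
proof -
  obtain p :: "nat \<Rightarrow> nat" where "inj p" "range p \<subseteq> {p. prime p}"
    using infinite_countable_subset[OF primes_infinite] by blast
  then have p: "inj p" "prime (p i)" for i by auto
  define v where "v X = prod_mset (image_mset p X)" for X
  have v_inj: "X = Y" if "v X = v Y" for X Y
  proof -
    have "prime_factorization (v Z) = image_mset p Z" for Z
      unfolding v_def using p(2) by (intro prime_factorization_prod_mset_primes) auto
    with that have "image_mset p X = image_mset p Y" by metis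
    then have "image_mset (inv_into UNIV p) (image_mset p X) = image_mset (inv_into UNIV p) (image_mset p Y)" by simp
    then show ?thesis by (simp add: multiset.map_comp p(1))
  qed
  \<comment> \<open>Raising the primes to the power \<open>k\<close> raises the value of each
    monomial to the power \<open>k\<close>, so all power sums of these values vanish.\<close>
  have "prod_mset (image_mset (\<lambda>i. rat_of_nat (p i) ^ k) X) = rat_of_nat (v X) ^ k" for k X
    by (induction X) (simp_all add: v_def power_mult_distrib)
  then have "(\<Sum>j\<in>S. w j * rat_of_nat (v (M j)) ^ k) = 0" for k
    using vanish[of "\<lambda>i. rat_of_nat (p i) ^ k"] by (simp only:)
  from power_sums_vanish[OF S this, of "rat_of_nat (v \<mu>)"]
  have "(\<Sum>j | j \<in> S \<and> rat_of_nat (v (M j)) = rat_of_nat (v \<mu>). w j) = 0" .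
  moreover have "rat_of_nat (v (M j)) = rat_of_nat (v \<mu>) \<longleftrightarrow> M j = \<mu>" for j
    using v_inj[of "M j" \<mu>] by auto
  ultimately show ?thesis by (simp only:)
qed

section \<open>Trace terms and their multidegree\<close>

lemma trace_term_closed: "(\<sigma>, Ms) \<in> basis n \<Longrightarrow> trace_term ts \<sigma> Ms \<in> carrier (twisted_algebra n)"
  unfolding trace_term_def by (rule single_in_carrier)

lemma eval_trace_term:
  assumes "(\<sigma>, Ms) \<in> basis n" "length I = n"
  shows "eval_twisted n A (trace_term ts \<sigma> Ms) I J =
    prod_list (map (\<lambda>t. trace (eval_mono A t)) ts) * eval_basis n A (\<sigma>, Ms) I J"
  using assms by (simp add: trace_term_def eval_twisted_single eval_trpoly_prod_list comp_def)

lemma eval_mono_map: "eval_mono A (map s M) = eval_mono (\<lambda>x. A (s x)) M"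
  by (induction M) (simp_all add: eval_mono_def)

lemma eval_trace_term_map:
  assumes "(\<sigma>, Ms) \<in> basis n" "length I = n"
  shows "eval_twisted n A (trace_term (map (map s) ts) \<sigma> (map (map s) Ms)) I J =
    eval_twisted n (\<lambda>x. A (s x)) (trace_term ts \<sigma> Ms) I J"
proof -
  have "(\<sigma>, map (map s) Ms) \<in> basis n" "length Ms = n" using assms by (auto simp: basis_iff)
  then show ?thesis using assms by (simp add: eval_trace_term eval_mono_map comp_def eval_basis_def)
qed

lemma eval_mono_scaled:
  fixes A :: "nat \<Rightarrow> rat^'d^'d::finite"
  shows "eval_mono (\<lambda>x. \<chi> p q. z x * A x $ p $ q) M $ i $ j = prod_list (map z M) * eval_mono A M $ i $ j"
proof (induction M arbitrary: i j)
  case (Cons x M)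
  then show ?case
    by (simp add: eval_mono_def matrix_matrix_mult_def sum_distrib_left mult_ac)
qed (simp add: eval_mono_def)

text \<open>Rescaling the variables multiplies a term by the monomial of its content, letters in
  traces and in words counted alike. This torus action separates the multidegrees.\<close>

lemma eval_trace_term_scaled:
  fixes A :: "nat \<Rightarrow> rat^'d^'d::finite"
  assumes "(\<sigma>, Ms) \<in> basis n" "length I = n"
  shows "eval_twisted n (\<lambda>x. \<chi> p q. z x * A x $ p $ q) (trace_term ts \<sigma> Ms) I J =
    prod_mset (image_mset z (mset (concat ts) + mset (concat Ms))) * eval_twisted n A (trace_term ts \<sigma> Ms) I J"
proof -
  let ?A = "\<lambda>x. \<chi> p q. z x * A x $ p $ q"
  have len: "length Ms = n" using assms by (simp add: basis_iff)
  have mset: "prod_mset (image_mset z (mset M)) = prod_list (map z M)" for M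
    by (metis mset_map prod_mset_prod_list)
  have "trace (eval_mono ?A t) = prod_list (map z t) * trace (eval_mono A t)" for t
    by (simp add: trace_def eval_mono_scaled sum_distrib_left)
  then have 1: "prod_list (map (\<lambda>t. trace (eval_mono ?A t)) ts) =
      prod_list (map z (concat ts)) * prod_list (map (\<lambda>t. trace (eval_mono A t)) ts)"
    by (induction ts) (simp_all add: mult_ac)
  have "prod_list (map z (concat Ms)) = prod_list (map (\<lambda>M. prod_list (map z M)) Ms)"
    by (induction Ms) simp_all
  also have "\<dots> = (\<Prod>k<n. prod_list (map z (Ms ! k)))"
    by (simp add: prod.list_conv_set_nth len atLeast0LessThan)
  finally have "eval_basis n ?A (\<sigma>, Ms) I J = prod_list (map z (concat Ms)) * eval_basis n A (\<sigma>, Ms) I J"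
    by (simp add: eval_basis_def eval_mono_scaled prod.distrib)
  with 1 show ?thesis using assms by (simp add: eval_trace_term mset image_mset_union)
qed

text \<open>Coefficients are split into rational multiples of products of traces, so that each
  summand has a definite content. Terms may repeat in the family.\<close>

lemma sum_trace_terms:
  assumes F: "F \<in> carrier (twisted_algebra n)"
  obtains K :: nat and q ts \<sigma> Ms where "\<And>j. j < K \<Longrightarrow> (\<sigma> j, Ms j) \<in> basis n"
    and "F = (\<Sum>j<K. scale (rat_const (q j)) (trace_term (ts j) (\<sigma> j) (Ms j)))"
proof -
  define val where "val = (\<lambda>(q, ts, \<sigma>, Ms). scale (rat_const q) (trace_term ts \<sigma> Ms))"
  define spanned where "spanned F \<longleftrightarrow> (\<exists>xs. (\<forall>(q, ts, b)\<in>set xs. b \<in> basis n) \<and> F = sum_list (map val xs))" for F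
  have add: "spanned (F + G)" if F: "spanned F" and G: "spanned G" for F G
  proof -
    obtain xs ys where "\<forall>(q, ts, b)\<in>set xs. b \<in> basis n" "F = sum_list (map val xs)"
      "\<forall>(q, ts, b)\<in>set ys. b \<in> basis n" "G = sum_list (map val ys)"
      using F G unfolding spanned_def by blast
    then show ?thesis unfolding spanned_def by (intro exI[of _ "xs @ ys"]) auto
  qed
  have zero: "spanned 0" unfolding spanned_def by (intro exI[of _ "[]"]) simp
  have "spanned F" using F unfolding carrier_twisted
  proof (induction rule: poly_mapping_single_induct)
    case (single b c)
    have "Poly_Mapping.keys c \<subseteq> UNIV" by simp
    then show ?case
    proof (induction rule: poly_mapping_single_induct)
      case (single m r)
      obtain ts where "Poly_Mapping.single m (1::rat) = prod_list (map tr_var ts)"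
        using trace_monomial_prod_list by blast
      moreover have "Poly_Mapping.single m r = rat_const r * Poly_Mapping.single m 1"
        by (simp add: rat_const_def mult_single)
      ultimately have "Poly_Mapping.single b (Poly_Mapping.single m r) = sum_list (map val [(r, ts, b)])"
        by (cases b) (simp add: val_def trace_term_def)
      moreover have "\<forall>(q, ts, b)\<in>set [(r, ts, b)]. b \<in> basis n" using \<open>b \<in> basis n\<close> by simp
      ultimately show ?case unfolding spanned_def by blast
    qed (simp_all add: zero single_add add)
  qed (simp_all add: zero add)
  then obtain xs where xs: "\<forall>(q, ts, b)\<in>set xs. b \<in> basis n" "F = sum_list (map val xs)"
    unfolding spanned_def by blast
  show thesis
  proof (rule that[of "length xs" "\<lambda>j. fst (snd (snd (xs ! j)))" "\<lambda>j. snd (snd (snd (xs ! j)))"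
        "\<lambda>j. fst (xs ! j)" "\<lambda>j. fst (snd (xs ! j))"])
    show "(fst (snd (snd (xs ! j))), snd (snd (snd (xs ! j)))) \<in> basis n" if "j < length xs" for j
      using xs(1) nth_mem[OF that] by (auto simp: split_def)
    show "F = (\<Sum>j<length xs. scale (rat_const (fst (xs ! j)))
        (trace_term (fst (snd (xs ! j))) (fst (snd (snd (xs ! j)))) (snd (snd (snd (xs ! j))))))"
      unfolding xs(2) by (simp add: sum.list_conv_set_nth atLeast0LessThan val_def split_def)
  qed
qed

section \<open>Multilinear lifts\<close>

lemma unconcat:
  assumes "map f L = concat xss"
  shows "\<exists>yss. map (map f) yss = xss \<and> concat yss = L"
  using assms
proof (induction xss arbitrary: L)
  case (Cons xs xss)
  then obtain L1 L2 where L: "L = L1 @ L2" "map f L1 = xs" "map f L2 = concat xss"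
    by (auto simp: map_eq_append_conv)
  with Cons.IH obtain yss where "map (map f) yss = xss" "concat yss = L2" by blast
  with L show ?case by (intro exI[of _ "L1 # yss"]) simp
qed simp

text \<open>Every occurrence of a letter is replaced by a position of \<open>l\<close> carrying it,
  each position being used once. The choice among equal letters is arbitrary, and the relabellings
  summed over later account for it.\<close>

lemma multilinear_lift:
  assumes "mset (concat ts) + mset (concat Ms) = mset l"
  shows "\<exists>ts' Ms'. map (map ((!) l)) ts' = ts \<and> map (map ((!) l)) Ms' = Ms \<and>
    mset (concat ts') + mset (concat Ms') = mset_set {0..<length l}"
proof -
  have "mset (concat (ts @ Ms)) = mset l" using assms by simp
  then obtain p where p: "p permutes {..<length l}" "permute_list p l = concat (ts @ Ms)"
    by (rule mset_eq_permutation)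
  have "map ((!) l) (map p [0..<length l]) = concat (ts @ Ms)"
    using p(2) by (simp add: permute_list_def comp_def)
  from unconcat[OF this] obtain yss where yss: "map (map ((!) l)) yss = ts @ Ms" "concat yss = map p [0..<length l]"
    by blast
  define ts' Ms' where "ts' = take (length ts) yss" and "Ms' = drop (length ts) yss"
  have "map (map ((!) l)) ts' = ts" "map (map ((!) l)) Ms' = Ms"
    unfolding ts'_def Ms'_def take_map[symmetric] drop_map[symmetric] yss(1) by simp_all
  moreover have "mset (concat ts') + mset (concat Ms') = mset (concat yss)"
    by (metis append_take_drop_id concat_append mset_append ts'_def Ms'_def)
  moreover have "mset (concat yss) = mset_set {0..<length l}"
    using p(1) by (simp add: yss(2) image_mset_mset_set permutes_inj_on permutes_image atLeast0LessThan)
  ultimately show ?thesis by (intro exI[of _ ts'] exI[of _ Ms']) simp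
qed

text \<open>Traces and words are not expanded directly: \<open>extraction\<close>, applied to the
  T-ideal of tensor identities, makes the value of the term a constant times the value of one
  contraction, which is visibly multilinear.\<close>

lemma eval_trace_term_multilinear:
  fixes C :: "nat \<Rightarrow> rat^'d^'d::finite"
  assumes "(\<sigma>, Ms) \<in> basis n" "length I = n" "length J = n"
    and "mset (concat ts) + mset (concat Ms) = mset_set {0..<N}" "finite H"
  shows "eval_twisted n (\<lambda>k. \<chi> p q. \<Sum>h\<in>H. w k h * C h $ p $ q) (trace_term ts \<sigma> Ms) I J =
    (\<Sum>f\<in>{..<N} \<rightarrow>\<^sub>E H. (\<Prod>k<N. w k (f k)) * eval_twisted n (\<lambda>k. C (f k)) (trace_term ts \<sigma> Ms) I J)"
proof -
  have "\<sigma> permutes {..<n}" "length Ms = n" "mset (concat ts) + mset (concat Ms) = mset [0..<N]"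
    using assms by (simp_all add: basis_iff)
  from extraction[OF this, of "CARD('d)"] obtain \<pi> c where \<pi>: "\<pi> permutes {..<n + N}"
    and "\<And>J s. T_ideal J \<Longrightarrow> twisted0 (tr_var [] - of_nat CARD('d)) \<in> J 0 \<Longrightarrow>
      trace_term (map (map s) ts) \<sigma> (map (map s) Ms) - scale (rat_const c) (contraction n (map s [0..<N]) \<pi>) \<in> J n"
    by auto
  from this(2)[OF T_ideal_tensor_identities[where 'd = 'd] twisted0_in_tensor_identities[where 'd = 'd], of id]
  have mem: "trace_term ts \<sigma> Ms - scale (rat_const c) (contraction n [0..<N] \<pi>) \<in> tensor_identities TYPE('d) n"
    by simp
  have cl: "contraction n [0..<N] \<pi> \<in> carrier (twisted_algebra n)"
    using contraction_closed[of \<pi> n "[0..<N]"] \<pi> by simp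
  have *: "eval_twisted n A (trace_term ts \<sigma> Ms) I J = c * eval_twisted n A (contraction n [0..<N] \<pi>) I J" for A :: "nat \<Rightarrow> rat^'d^'d"
  proof -
    have "eval_twisted n A (trace_term ts \<sigma> Ms - scale (rat_const c) (contraction n [0..<N] \<pi>) +
        scale (rat_const c) (contraction n [0..<N] \<pi>)) I J = c * eval_twisted n A (contraction n [0..<N] \<pi>) I J"
      unfolding eval_twisted_add using assms tensor_identitiesD(2)[OF mem] by (simp add: eval_twisted_scale cl)
    then show ?thesis by simp
  qed
  show ?thesis unfolding * eval_contraction_multilinear[OF \<pi> assms(2,3,5)]
    by (simp add: sum_distrib_left mult_ac)
qed

section \<open>From the group algebra back to the T-ideal\<close>

lemma funpow_partial_trace_linear:
  "(partial_trace ^^ N) 0 = 0"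
  "(partial_trace ^^ N) (F + G) = (partial_trace ^^ N) F + (partial_trace ^^ N) G"
  "(partial_trace ^^ N) (scale c F) = scale c ((partial_trace ^^ N) F)"
  by (induction N) (simp_all add: partial_trace_add partial_trace_scale)

lemma funpow_partial_trace_sum:
  "(partial_trace ^^ N) (\<Sum>x\<in>X. F x) = (\<Sum>x\<in>X. (partial_trace ^^ N) (F x))"
  by (induction X rule: infinite_finite_induct) (simp_all add: funpow_partial_trace_linear)

text \<open>Right multiplication by the letters of \<open>l\<close>, followed by partial traces,
  carries a relation in the group algebra to one between contractions, for any
  \<open>l\<close>.\<close>

lemma sum_contractions_in_T_ideal:
  assumes J: "T_ideal J"
    and mem: "(\<Sum>x\<in>X. Poly_Mapping.single (\<pi> x, replicate (n + length l) []) (c x)) \<in> J (n + length l)"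
  shows "(\<Sum>x\<in>X. scale (c x) (contraction n l (\<pi> x))) \<in> J n"
proof -
  let ?W = "replicate n [] @ map (\<lambda>x. [x]) l"
  have "words ?W \<in> carrier (twisted_algebra (n + length l))"
    unfolding words_def by (rule single_in_carrier) (simp add: basis_iff permutes_id)
  from T_ideal_mult_right[OF J mem this]
  have "(\<Sum>x\<in>X. bilinear_ext basis_mult (Poly_Mapping.single (\<pi> x, replicate (n + length l) []) (c x)) (words ?W))
      \<in> J (n + length l)" by (simp only: bilinear_ext_sum_left)
  moreover have "map2 (@) (replicate (n + length l) []) ?W = ?W"
    by (intro nth_equalityI) auto
  then have "bilinear_ext basis_mult (Poly_Mapping.single (\<pi> x, replicate (n + length l) []) (c x)) (words ?W) =
      scale (c x) (Poly_Mapping.single (\<pi> x, ?W) 1)" for x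
    by (subst single_mult_words) simp_all
  ultimately have "(\<Sum>x\<in>X. scale (c x) (Poly_Mapping.single (\<pi> x, ?W) 1)) \<in> J (n + length l)"
    by (simp del: scale_single)
  from funpow_partial_trace_in_T_ideal[OF J this] show ?thesis
    by (simp add: funpow_partial_trace_sum funpow_partial_trace_linear contraction_def del: scale_single)
qed

text \<open>The coefficients \<open>q j * c j f\<close> are collected at the permutations
  \<open>\<pi> j f\<close>, over all pairs of a term \<open>j\<close> and a relabelling
  \<open>f\<close>. Polarisation and matrix units show that the result acts as zero on
  \<open>n + N\<close> tensor factors; membership in \<open>J\<close> is then carried back to the
  letters of \<open>l\<close>.\<close>

lemma homogeneous_identity_in_T_ideal:
  fixes X :: "'i set" and q :: "'i \<Rightarrow> rat"
  assumes J: "T_ideal J" "antisymmetrizer (CARD('d::finite) + 1) \<in> J (CARD('d) + 1)"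
      "twisted0 (tr_var [] - of_nat CARD('d)) \<in> J 0"
    and X: "finite X" and basis: "\<And>j. j \<in> X \<Longrightarrow> (\<sigma> j, Ms j) \<in> basis n"
    and content: "\<And>j. j \<in> X \<Longrightarrow> mset (concat (ts j)) + mset (concat (Ms j)) = \<mu>"
    and vanish: "\<And>(A :: nat \<Rightarrow> rat^'d^'d) I L. length I = n \<Longrightarrow> length L = n \<Longrightarrow>
      (\<Sum>j\<in>X. q j * eval_twisted n A (trace_term (ts j) (\<sigma> j) (Ms j)) I L) = 0"
  shows "(\<Sum>j\<in>X. scale (rat_const (q j)) (trace_term (ts j) (\<sigma> j) (Ms j))) \<in> J n"
proof -
  note TI = T_ideal_tensor_identities[where 'd = 'd] twisted0_in_tensor_identities[where 'd = 'd]
  obtain l where l: "mset l = \<mu>" using ex_mset by blast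
  define N where "N = length l"
  have "\<exists>ts' Ms'. map (map ((!) l)) ts' = ts j \<and> map (map ((!) l)) Ms' = Ms j \<and>
    mset (concat ts') + mset (concat Ms') = mset_set {0..<N}" if "j \<in> X" for j
    unfolding N_def using content[OF that] l by (intro multilinear_lift) simp
  then obtain ts' Ms' where lift: "\<And>j. j \<in> X \<Longrightarrow> map (map ((!) l)) (ts' j) = ts j"
    "\<And>j. j \<in> X \<Longrightarrow> map (map ((!) l)) (Ms' j) = Ms j"
    "\<And>j. j \<in> X \<Longrightarrow> mset (concat (ts' j)) + mset (concat (Ms' j)) = mset_set {0..<N}"
    by metis
  have basis': "(\<sigma> j, Ms' j) \<in> basis n" if "j \<in> X" for j
    using basis[OF that] arg_cong[OF lift(2)[OF that], of length] by (simp add: basis_iff)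
  have small: "k < N" if "j \<in> X" "k \<in> set (concat (ts' j)) \<union> set (concat (Ms' j))" for j k
  proof -
    have "k \<in># mset_set {0..<N}" unfolding lift(3)[OF that(1), symmetric] using that(2) by auto
    then show ?thesis by simp
  qed
  \<comment> \<open>\<open>D\<close> consists of the reassignments of positions that respect the
    letters of \<open>l\<close>; those in \<open>G\<close> hit every position exactly once, so
    \<open>G\<close> is the stabiliser of the word \<open>l\<close>.\<close>
  define D where "D = {f \<in> {..<N} \<rightarrow>\<^sub>E {..<N}. \<forall>k<N. l ! f k = l ! k}"
  define G where "G = {f \<in> D. image_mset f (mset_set {0..<N}) = mset_set {0..<N}}"
  have finD: "finite D" unfolding D_def by (simp add: finite_PiE)
  have finG: "finite G" unfolding G_def using finD by simp
  have "restrict id {..<N} \<in> G"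
  proof -
    have "image_mset (restrict id {..<N}) (mset_set {0..<N}) = image_mset id (mset_set {0..<N})"
      by (rule image_mset_cong) simp
    then show ?thesis by (simp add: G_def D_def)
  qed
  then have card_pos: "card G \<noteq> 0" using finG by auto
  \<comment> \<open>Used with \<open>K\<close> the tensor identities and \<open>s = id\<close> to
    compute values, and with \<open>K = J\<close> and \<open>s = (!) l\<close> to return to the
    original term, always with the same \<open>\<pi>\<close> and \<open>c\<close>.\<close>
  define good where "good j f \<pi> c \<longleftrightarrow> \<pi> permutes {..<n + N} \<and>
    (\<forall>K s. T_ideal K \<longrightarrow> twisted0 (tr_var [] - of_nat CARD('d)) \<in> K 0 \<longrightarrow>
      trace_term (map (map s) (map (map f) (ts' j))) (\<sigma> j) (map (map s) (map (map f) (Ms' j))) -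
      scale (rat_const c) (contraction n (map s [0..<N]) \<pi>) \<in> K n)" for j f \<pi> c
  have "\<exists>\<pi> c. good j f \<pi> c" if j: "j \<in> X" and f: "f \<in> G" for j f
  proof -
    have "mset (concat (map (map f) (ts' j))) + mset (concat (map (map f) (Ms' j))) =
        image_mset f (mset (concat (ts' j)) + mset (concat (Ms' j)))"
      by (simp add: map_concat[symmetric])
    also have "\<dots> = mset [0..<N]" using f lift(3)[OF j] by (simp add: G_def)
    finally show ?thesis
      using extraction[of "\<sigma> j" n "map (map f) (Ms' j)" "map (map f) (ts' j)" "[0..<N]" "CARD('d)"] basis'[OF j]
      unfolding good_def by (simp add: basis_iff)
  qed
  then obtain \<pi> c where good: "\<And>j f. j \<in> X \<Longrightarrow> f \<in> G \<Longrightarrow> good j f (\<pi> j f) (c j f)"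
    by metis
  have perm: "\<pi> j f permutes {..<n + N}" if "j \<in> X" "f \<in> G" for j f
    using good[OF that] by (simp add: good_def)
  have cl: "contraction n [0..<N] (\<pi> j f) \<in> carrier (twisted_algebra n)" if "j \<in> X" "f \<in> G" for j f
    using contraction_closed[of "\<pi> j f" n "[0..<N]"] perm[OF that] by simp
  define e where "e j (C :: nat \<Rightarrow> rat^'d^'d) I L = eval_twisted n C (trace_term (ts' j) (\<sigma> j) (Ms' j)) I L" for j C I L
  have e_contraction: "e j (\<lambda>k. C (f k)) I L = c j f * eval_twisted n C (contraction n [0..<N] (\<pi> j f)) I L"
    if j: "j \<in> X" and f: "f \<in> G" and I: "length I = n" "length L = n" for j f C I L
  proof -
    let ?F = "trace_term (map (map f) (ts' j)) (\<sigma> j) (map (map f) (Ms' j))"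
    let ?C = "scale (rat_const (c j f)) (contraction n [0..<N] (\<pi> j f))"
    have "trace_term (map (map id) (map (map f) (ts' j))) (\<sigma> j) (map (map id) (map (map f) (Ms' j))) -
        scale (rat_const (c j f)) (contraction n (map id [0..<N]) (\<pi> j f)) \<in> tensor_identities TYPE('d) n"
      using good[OF j f] TI unfolding good_def by blast
    then have "?F - ?C \<in> tensor_identities TYPE('d) n" by simp
    then have "eval_twisted n C (?F - ?C + ?C) I L = c j f * eval_twisted n C (contraction n [0..<N] (\<pi> j f)) I L"
      unfolding eval_twisted_add using I tensor_identitiesD(2) cl[OF j f] by (simp add: eval_twisted_scale)
    then show ?thesis
      unfolding e_def using eval_trace_term_map[OF basis'[OF j] I(1), of C f "ts' j" L] by simp
  qed
  have polarised: "(\<Sum>f\<in>G. \<Sum>j\<in>X. q j * e j (\<lambda>k. C (f k)) I L) = 0"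
    if I: "length I = n" "length L = n" for C I L
  proof -
    have "(\<Sum>f\<in>D. (\<Sum>j\<in>X. q j * e j (\<lambda>k. C (f k)) I L) *
        prod_mset (image_mset z (image_mset f (mset_set {0..<N})))) = 0" for z
    proof -
      \<comment> \<open>Polarisation: variable \<open>x\<close> receives the combination of the
        matrices \<open>C h\<close> over the positions \<open>h\<close> carrying \<open>x\<close>,
        with parameters \<open>z h\<close>. Only the \<open>f\<close> in \<open>D\<close> survive in
        the expansion.\<close>
      define A where "A x = (\<chi> p q. \<Sum>h\<in>{..<N}. (if l ! h = x then z h else 0) * C h $ p $ q)" for x
      have "q j * eval_twisted n A (trace_term (ts j) (\<sigma> j) (Ms j)) I L =
          (\<Sum>f\<in>D. q j * e j (\<lambda>k. C (f k)) I L * (\<Prod>k<N. z (f k)))" if j: "j \<in> X" for j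
      proof -
        have "eval_twisted n A (trace_term (ts j) (\<sigma> j) (Ms j)) I L = e j (\<lambda>k. A (l ! k)) I L"
          unfolding e_def lift(1,2)[OF j, symmetric] by (rule eval_trace_term_map[OF basis'[OF j] I(1)])
        also have "\<dots> = (\<Sum>f\<in>{..<N} \<rightarrow>\<^sub>E {..<N}. (\<Prod>k<N. if l ! f k = l ! k then z (f k) else 0) * e j (\<lambda>k. C (f k)) I L)"
          unfolding e_def A_def by (rule eval_trace_term_multilinear[OF basis'[OF j] I lift(3)[OF j]]) simp
        also have "\<dots> = (\<Sum>f\<in>D. (\<Prod>k<N. z (f k)) * e j (\<lambda>k. C (f k)) I L)"
          unfolding D_def by (intro sum.mono_neutral_cong_right) (auto simp: finite_PiE)
        finally show ?thesis by (simp add: sum_distrib_left mult_ac)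
      qed
      then have "0 = (\<Sum>j\<in>X. \<Sum>f\<in>D. q j * e j (\<lambda>k. C (f k)) I L * (\<Prod>k<N. z (f k)))"
        using vanish[OF I, of A] by simp
      also have "\<dots> = (\<Sum>f\<in>D. (\<Sum>j\<in>X. q j * e j (\<lambda>k. C (f k)) I L) * (\<Prod>k<N. z (f k)))"
        by (subst sum.swap) (simp add: sum_distrib_right)
      finally show ?thesis
        by (simp add: prod_unfold_prod_mset multiset.map_comp comp_def atLeast0LessThan)
    qed
    \<comment> \<open>Taking the coefficient of the monomial in which each \<open>z h\<close> occurs
      once picks out \<open>G\<close> from \<open>D\<close>.\<close>
    from monomials_independent[OF finD this, of "mset_set {0..<N}"] show ?thesis by (simp add: G_def)
  qed
  let ?r = "\<lambda>(j, f). q j * c j f" and ?\<pi> = "\<lambda>(j, f). \<pi> j f"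
  let ?a = "\<lambda>\<tau>. \<Sum>x\<in>X \<times> G. if ?\<pi> x = \<tau> then ?r x else 0"
  have fam: "perm_sum (n + N) ?a = (\<Sum>x\<in>X \<times> G. Poly_Mapping.single (?\<pi> x, replicate (n + N) []) (rat_const (?r x)))"
    using X finG perm by (intro perm_sum_family) auto
  have "perm_sum (n + N) ?a \<in> tensor_identities TYPE('d) (n + N)"
  proof (rule tensor_identitiesI[OF perm_sum_closed])
    fix A :: "nat \<Rightarrow> rat^'d^'d" and I' L' :: "'d list"
    assume I': "length I' = n + N" and L': "length L' = n + N"
    define I P L Q where "I = take n I'" and "P = drop n I'" and "L = take n L'" and "Q = drop n L'"
    have len: "length I = n" "length P = N" "length L = n" "length Q = N" and
      split: "I' = I @ P" "L' = L @ Q"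
      using I' L' by (simp_all add: I_def P_def L_def Q_def)
    let ?C = "(\<lambda>k. \<chi> p q. if p = Q ! k \<and> q = P ! k then 1 else 0) :: nat \<Rightarrow> rat^'d^'d"
    have "eval_twisted (n + N) A (perm_sum (n + N) ?a) I' L' =
        (\<Sum>x\<in>X \<times> G. ?r x * perm_matches (n + N) (?\<pi> x) I' L')"
      unfolding fam eval_twisted_sum using perm I'
      by (intro sum.cong refl) (auto simp: eval_twisted_single basis_iff eval_basis_perm)
    also have "\<dots> = (\<Sum>j\<in>X. \<Sum>f\<in>G. q j * c j f * perm_matches (n + N) (\<pi> j f) I' L')"
      by (simp add: sum.cartesian_product split_def)
    \<comment> \<open>The relabelling is absorbed into \<open>\<pi> j f\<close>, so each contraction
      is evaluated at the same matrix units \<open>?C\<close>, independently of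
      \<open>f\<close>.\<close>
    also have "\<dots> = (\<Sum>j\<in>X. \<Sum>f\<in>G. q j * e j (\<lambda>k. ?C (f k)) I L)"
      using perm len by (intro sum.cong refl)
        (simp add: e_contraction[of _ _ I L ?C] eval_contraction_matrix_units split)
    also have "\<dots> = 0"
      using polarised[OF len(1,3), of ?C] by (subst sum.swap) simp
    finally show "eval_twisted (n + N) A (perm_sum (n + N) ?a) I' L' = 0" .
  qed
  from kernel_in_T_ideal[OF J(1,2) this] have "(\<Sum>x\<in>X \<times> G. scale (rat_const (?r x)) (contraction n l (?\<pi> x))) \<in> J n"
    unfolding fam unfolding N_def by (rule sum_contractions_in_T_ideal[OF J(1)])
  moreover have "(\<Sum>x\<in>X \<times> G. case x of (j, f) \<Rightarrow> scale (rat_const (q j)) (trace_term (ts j) (\<sigma> j) (Ms j) -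
      scale (rat_const (c j f)) (contraction n l (\<pi> j f)))) \<in> J n"
  proof (rule T_ideal_sum[OF J(1)], clarify)
    fix j f assume j: "j \<in> X" and f: "f \<in> G"
    have "trace_term (map (map ((!) l)) (map (map f) (ts' j))) (\<sigma> j) (map (map ((!) l)) (map (map f) (Ms' j))) -
        scale (rat_const (c j f)) (contraction n (map ((!) l) [0..<N]) (\<pi> j f)) \<in> J n"
      using good[OF j f] J unfolding good_def by blast
    \<comment> \<open>\<open>f\<close> fixes the word \<open>l\<close>, so specialising the
      relabelled lift returns the original term for every \<open>f\<close>.\<close>
    moreover have "l ! f k = l ! k" if "k < N" for k using f that by (auto simp: G_def D_def)
    then have "map (map ((!) l)) (map (map f) (ts' j)) = ts j" "map (map ((!) l)) (map (map f) (Ms' j)) = Ms j"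
      unfolding lift(1,2)[OF j, symmetric] using small[OF j] by auto
    moreover have "map ((!) l) [0..<N] = l" by (simp add: N_def map_nth)
    ultimately show "scale (rat_const (q j)) (trace_term (ts j) (\<sigma> j) (Ms j) -
        scale (rat_const (c j f)) (contraction n l (\<pi> j f))) \<in> J n"
      by (simp add: T_ideal_scale[OF J(1)])
  qed
  ultimately have "(\<Sum>x\<in>X \<times> G. scale (rat_const (?r x)) (contraction n l (?\<pi> x))) +
    (\<Sum>x\<in>X \<times> G. case x of (j, f) \<Rightarrow> scale (rat_const (q j)) (trace_term (ts j) (\<sigma> j) (Ms j) -
      scale (rat_const (c j f)) (contraction n l (\<pi> j f)))) \<in> J n"
    by (rule T_ideal_add[OF J(1)])
  also have "(\<Sum>x\<in>X \<times> G. scale (rat_const (?r x)) (contraction n l (?\<pi> x))) +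
    (\<Sum>x\<in>X \<times> G. case x of (j, f) \<Rightarrow> scale (rat_const (q j)) (trace_term (ts j) (\<sigma> j) (Ms j) -
      scale (rat_const (c j f)) (contraction n l (\<pi> j f)))) =
    (\<Sum>(j, f)\<in>X \<times> G. scale (rat_const (q j)) (trace_term (ts j) (\<sigma> j) (Ms j)))"
    unfolding sum.distrib[symmetric]
    by (intro sum.cong refl) (auto simp: scale_diff rat_const_hom)
  also have "\<dots> = (\<Sum>j\<in>X. scale (of_nat (card G)) (scale (rat_const (q j)) (trace_term (ts j) (\<sigma> j) (Ms j))))"
  proof -
    have "(\<Sum>f\<in>G. F) = scale (of_nat (card G)) F" for F :: twisted
      by (rule poly_mapping_eqI) (simp add: lookup_sum)
    then show ?thesis unfolding sum.cartesian_product[symmetric] by (intro sum.cong refl)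
  qed
  also have "\<dots> = scale (of_nat (card G)) (\<Sum>j\<in>X. scale (rat_const (q j)) (trace_term (ts j) (\<sigma> j) (Ms j)))"
    by (rule scale_sum[symmetric])
  finally have "scale (of_nat (card G)) (\<Sum>j\<in>X. scale (rat_const (q j)) (trace_term (ts j) (\<sigma> j) (Ms j))) \<in> J n" .
  \<comment> \<open>Division by \<open>card G\<close> is possible because \<open>G\<close> contains
    the identity and the constants are rational.\<close>
  from T_ideal_scale[OF J(1) this, of "rat_const (1 / of_nat (card G))"] show ?thesis
    using card_pos by (simp flip: rat_const_of_nat rat_const_hom(4)) (simp add: rat_const_hom)
qed

text \<open>Rescaling the variables splits an identity into finitely many components of fixed
  content, each of them again an identity.\<close>

lemma tensor_identities_subset:
  assumes J: "T_ideal J" "antisymmetrizer (CARD('d::finite) + 1) \<in> J (CARD('d) + 1)"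
      "twisted0 (tr_var [] - of_nat CARD('d)) \<in> J 0"
  shows "tensor_identities TYPE('d) n \<subseteq> J n"
proof
  fix F assume F: "F \<in> tensor_identities TYPE('d) n"
  obtain K :: nat and q ts \<sigma> Ms where basis: "\<And>j. j < K \<Longrightarrow> (\<sigma> j, Ms j) \<in> basis n"
    and F_eq: "F = (\<Sum>j<K. scale (rat_const (q j)) (trace_term (ts j) (\<sigma> j) (Ms j)))"
    by (rule sum_trace_terms[OF tensor_identitiesD(1)[OF F]]) (rule that)
  define content where "content j = mset (concat (ts j)) + mset (concat (Ms j))" for j
  have eval: "eval_twisted n A F I L = (\<Sum>j<K. q j * eval_twisted n A (trace_term (ts j) (\<sigma> j) (Ms j)) I L)"
    if "length I = n" for A :: "nat \<Rightarrow> rat^'d^'d" and I L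
    unfolding F_eq eval_twisted_sum
    by (intro sum.cong refl) (simp add: eval_twisted_scale trace_term_closed basis that)
  have "(\<Sum>j | j \<in> {..<K} \<and> content j = \<mu>. scale (rat_const (q j)) (trace_term (ts j) (\<sigma> j) (Ms j))) \<in> J n" for \<mu>
  proof (rule homogeneous_identity_in_T_ideal[where 'd = 'd, OF J])
    fix A :: "nat \<Rightarrow> rat^'d^'d" and I L :: "'d list"
    assume I: "length I = n" "length L = n"
    have "(\<Sum>j<K. q j * eval_twisted n A (trace_term (ts j) (\<sigma> j) (Ms j)) I L *
        prod_mset (image_mset z (content j))) = 0" for z
    proof -
      have "(\<Sum>j<K. q j * eval_twisted n A (trace_term (ts j) (\<sigma> j) (Ms j)) I L * prod_mset (image_mset z (content j))) =
        eval_twisted n (\<lambda>x. \<chi> p q. z x * A x $ p $ q) F I L"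
        unfolding eval[OF I(1)] content_def
        by (intro sum.cong refl) (simp add: eval_trace_term_scaled basis I mult_ac)
      then show ?thesis using tensor_identitiesD(2)[OF F I] by simp
    qed
    from monomials_independent[OF finite_lessThan this]
    show "(\<Sum>j | j \<in> {..<K} \<and> content j = \<mu>. q j * eval_twisted n A (trace_term (ts j) (\<sigma> j) (Ms j)) I L) = 0" .
  qed (auto simp: basis content_def)
  then have "(\<Sum>\<mu>\<in>content ` {..<K}. \<Sum>j | j \<in> {..<K} \<and> content j = \<mu>.
      scale (rat_const (q j)) (trace_term (ts j) (\<sigma> j) (Ms j))) \<in> J n"
    by (rule T_ideal_sum[OF J(1)])
  then show "F \<in> J n" unfolding F_eq by (subst sum.image_gen[of _ _ content]) simp_all
qed

theorem theorem3p18: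
  shows "T_ideal_generated_by
           {(CARD('d) + 1, antisymmetrizer (CARD('d) + 1)),
            (0, twisted0 (tr_var [] - of_nat CARD('d)))}
           (tensor_identities TYPE('d::finite))"
  unfolding T_ideal_generated_by_def
proof (intro conjI allI impI)
  let ?S = "{(CARD('d) + 1, antisymmetrizer (CARD('d) + 1)), (0, twisted0 (tr_var [] - of_nat CARD('d)))}"
  show "T_ideal (tensor_identities TYPE('d))"
    by (rule T_ideal_tensor_identities)
  show "\<forall>(n, F)\<in>?S. F \<in> tensor_identities TYPE('d) n"
    using antisymmetrizer_in_tensor_identities[where 'd = 'd] twisted0_in_tensor_identities[where 'd = 'd] by simp
  fix J n
  assume "T_ideal J \<and> (\<forall>(n, F)\<in>?S. F \<in> J n)"
  then show "tensor_identities TYPE('d) n \<subseteq> J n"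
    by (intro tensor_identities_subset) simp_all
qed

end
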